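(* Let $d\ge 2$ and let $\mathbb{T}^d=(V,E)$ be the Cayley tree of order $d$ with root $\rho$. Let $Q:\mathbb{Z}\to(0,\infty)$ be symmetric ($Q(-j)=Q(j)$) with $\sum_{j\in\mathbb{N}}j^2Q(j)<\infty$, and let $\nu$ be the corresponding free state on $(\Omega^\nabla,\mathcal{F}^\nabla)$. Let $H_r(\omega)=\frac{1}{|W_r|}\sum_{v\in W_r}\omega_v$ for $\omega\in\Omega=\mathbb{Z}^V$, $r\in\mathbb{N}$. Then the following hold. (a) (Existence.) The limit $H:=\lim_{r\to\infty}H_r$ exists almost surely and in $\mathcal{L}^2$ with respect to the measure $\nu\circ(\sigma^{\rho,0})^{-1}$, and $H$ (set equal to $\limsup_{r\to\infty}H_r$ at those $\omega$ where the limit does not exist) is a height-offset variable for $\nu$. In particular, the measure $\mu^H=\nu\circ G_H^{-1}$ is a Gibbs measure on $(\Omega,\mathcal{F})$ for the specification $\gamma$ associated with $Q$. (b1) (Regularity of the density.) The distribution of $H^{\rho,0}$ under $\nu$ has an infinitely often differentiable Lebesgue density $f_{H^{\rho,0}}$. Moreover, $f_{H^{\rho,0}}$ is strictly positive on $\mathbb{R}$. (b2) (Localization.) Assume furthermore that there is some $R>0$ such that $\sum_{j\in\mathbb{Z}}e^{tj}\frac{Q(j)}{\Vert Q\Vert_1}<\infty$ for all $t\in(-R,R)$. Then for every $A<(d+1)R$ there exists $B(A)\in(0,\infty)$ such that $$\mu^H(|\sigma_\rho|\ge s)\le B(A)e^{-As}\quad\text{for every } s\in\mathbb{N}.$$ (c1)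 The measure $\mu^H$ is not invariant under the translations of the tree. (c2) The measure $\mu^H$ is not a tree-indexed Markov chain, and in particular it is not extreme in the set of all Gibbs measures for the specification $\gamma$ associated with $Q$.
   Context: Tree. $\mathbb{T}^d=(V,E)$ is the infinite tree in which every vertex has exactly $d+1$ nearest neighbors, with root $\rho\in V$ and graph distance $\mathrm{d}(\cdot,\cdot)$. $\vec E$ is the set of oriented edges $(x,y)$ with $\{x,y\}\in E$. $W_r=\{v\in V: \mathrm{d}(\rho,v)=r\}$. $\Gamma(x,y)\subset\vec E$ is the set of oriented edges of the directed self-avoiding path from $x$ to $y$. For $\Lambda\subset V$, $\partial\Lambda$ is the set of vertices outside $\Lambda$ adjacent to a vertex of $\Lambda$. Translations: $V$ is identified with the group generated by $d+1$ generators subject only to the relations that each generator squares to the identity (the free product of $d+1$ copies of $\mathbb{Z}/2\mathbb{Z}$), $\rho$ being the identity and $\mathbb{T}^d$ its Cayley graph; the translations of the tree are the left multiplications $l_v:u\mapsto vu$, $v\in V$, which are graph automorphisms and act on $\Omega$ by permuting coordinates. Configurations. $\Omega=\mathbb{Z}^V$ with product $\sigma$-algebra $\mathcal{F}$ and coordinate maps $\sigma_x(\omega)=\omega_x$; $\mathcal{F}_\Lambda=\sigma(\sigma_x:x\in\Lambda)$; the tail $\sigma$-algebra is $\mathcal{T}=\bigcap_{\Lambda\Subset V}\mathcal{F}_{V\setminus\Lambda}$ ($\Lambda\Subset V$ means finite subset). $\Omega^\nabla=\{\zeta\in\mathbb{Z}^{\vec E}:\zeta_{(u,v)}=-\zeta_{(v,u)}\}$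 with product $\sigma$-algebra $\mathcal{F}^\nabla$ and coordinate maps $\eta_b(\zeta)=\zeta_b$. For $x\in V$, $s\in\mathbb{Z}$, the map $\sigma^{x,s}:\Omega^\nabla\to\Omega$ is $\sigma^{x,s}_v(\zeta)=s+\sum_{b\in\Gamma(x,v)}\zeta_b$. For $a\in\mathbb{Z}$, $\tau_a(\omega)=(\omega_x-a)_{x\in V}$. Gibbs measures. The specification $\gamma=(\gamma_\Lambda)_{\Lambda\Subset V}$ associated with $Q$ consists of the kernels under which the configuration outside $\Lambda$ is fixed to $\omega$ and $$\gamma_\Lambda(\sigma_\Lambda=\tilde\omega_\Lambda\mid\omega)=\frac{1}{Z_\Lambda(\omega_{\partial\Lambda})}\prod_{\{x,y\}\in E,\;x,y\in\Lambda}Q(\tilde\omega_x-\tilde\omega_y)\prod_{\{x,y\}\in E,\;x\in\partial\Lambda,\,y\in\Lambda}Q(\omega_x-\tilde\omega_y),$$ with $Z_\Lambda$ the (finite) normalizing constant. A probability measure $\mu$ on $(\Omega,\mathcal{F})$ is a Gibbs measure for $\gamma$ if $\int\gamma_\Lambda(A\mid\omega)\,\mu(d\omega)=\mu(A)$ for all $A\in\mathcal{F}$ and all $\Lambda\Subset V$. It is extreme if it is an extreme point of the convex set of all Gibbs measures for $\gamma$. Free state. $\nu$ is the probability measure on $(\Omega^\nabla,\mathcal{F}^\nabla)$ under which the variables $\eta_{(x,y)}$, for edges $(x,y)$ oriented away from the root $\rho$, are i.i.d. with $\nu(\eta_{(x,y)}=j)=Q(j)/\Vert Q\Vert_1$,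 where $\Vert Q\Vert_1=\sum_{j\in\mathbb{Z}}Q(j)$. Height-offset variable. A function $H:\Omega\to\mathbb{R}\cup\{\pm\infty\}$ is a height-offset variable for $\nu$ if (i) $H(\tau_{-a}(\omega))=H(\omega)+a$ for all $a\in\mathbb{Z}$, $\omega\in\Omega$; (ii) $H$ is $\mathcal{T}$-measurable; (iii) $\nu(|H\circ\sigma^{x,s}|<\infty)=1$ for some $x\in V$ and $s\in\mathbb{Z}$ (equivalently for all). Given such $H$, on the $\nu$-full set where $|H\circ\sigma^{\rho,0}|<\infty$ put $G_H(\zeta)=\sigma^{x,s}(\zeta)-\lfloor H(\sigma^{x,s}(\zeta))\rfloor\in\Omega$ (subtraction of the same integer at each site); this does not depend on the choice of $x,s$. Set $\mu^H=\nu\circ G_H^{-1}$. Pinned averages. $H_r^{\rho,0}(\zeta)=\frac1{|W_r|}\sum_{v\in W_r}\sigma_v^{\rho,0}(\zeta)$ for $\zeta\in\Omega^\nabla$, and $H^{\rho,0}=\lim_{r\to\infty}H_r^{\rho,0}$ is its $\nu$-a.s. limit, i.e. $H^{\rho,0}=H\circ\sigma^{\rho,0}$ $\nu$-a.s. Tree-indexed Markov chain. For $(u,v)\in\vec E$ the past is $[-\infty,uv)=\{w\in V:\mathrm{d}(w,u)<\mathrm{d}(w,v)\}$. A probability measure $\mu$ on $(\Omega,\mathcal{F})$ is a tree-indexed Markov chain if for every $(u,v)\in\vec E$, $\mu(\sigma_v=\cdot\mid\mathcal{F}_{[-\infty,uv)})=\mu(\sigma_v=\cdot\mid\mathcal{F}_{\{u\}})$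 $\mu$-a.s. *)

theory Defs
  imports "HOL-Probability.Probability"
begin

section \<open>The Cayley tree\<close>

text \<open>
  The free product of \<open>d + 1\<close> copies of the group with two elements, with generators
  \<open>0, \<dots>, d\<close>. A group element is represented by its unique reduced word,
  the identity being the empty word, and the inverse of a word is its reversal.
\<close>

definition verts :: "nat \<Rightarrow> nat list set" where
  "verts d = {w. set w \<subseteq> {..d} \<and> distinct_adj w}"

abbreviation (input) tree_root :: "nat list" where
  "tree_root \<equiv> []"

fun gen_cons :: "nat \<Rightarrow> nat list \<Rightarrow> nat list" where
  "gen_cons g [] = [g]"
| "gen_cons g (h # w) = (if g = h then w else g # h # w)"

definition gmult :: "nat list \<Rightarrow> nat list \<Rightarrow> nat list" where
  "gmult u v = foldr gen_cons u v"

text \<open>The oriented edges of the Cayley graph; this relation is symmetric.\<close>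

definition arcs :: "nat \<Rightarrow> (nat list \<times> nat list) set" where
  "arcs d = {(u, gmult u [g]) | u g. u \<in> verts d \<and> g \<le> d}"

definition tdist :: "nat \<Rightarrow> nat list \<Rightarrow> nat list \<Rightarrow> nat" where
  "tdist d u v = (LEAST n. (u, v) \<in> arcs d ^^ n)"

definition sphere_verts :: "nat \<Rightarrow> nat \<Rightarrow> nat list set" where
  "sphere_verts d r = {v \<in> verts d. tdist d tree_root v = r}"

definition outward_arcs :: "nat \<Rightarrow> (nat list \<times> nat list) set" where
  "outward_arcs d = {(u, v) \<in> arcs d. tdist d tree_root u < tdist d tree_root v}"

definition self_avoiding_path :: "nat \<Rightarrow> nat list \<Rightarrow> nat list \<Rightarrow> nat list list" where
  "self_avoiding_path d u v =
     (THE p. p \<noteq> [] \<and> hd p = u \<and> last p = v \<and> distinct p \<and>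
             successively (\<lambda>x y. (x, y) \<in> arcs d) p)"

definition path_arcs :: "nat \<Rightarrow> nat list \<Rightarrow> nat list \<Rightarrow> (nat list \<times> nat list) set" where
  "path_arcs d u v = (let p = self_avoiding_path d u v in set (zip p (tl p)))"

definition outer_boundary :: "nat \<Rightarrow> nat list set \<Rightarrow> nat list set" where
  "outer_boundary d \<Lambda> = {v \<in> verts d - \<Lambda>. \<exists>u\<in>\<Lambda>. (u, v) \<in> arcs d}"


section \<open>Height configurations\<close>

type_synonym height_config = "nat list \<Rightarrow> int"
type_synonym gradient_config = "nat list \<times> nat list \<Rightarrow> int"

definition height_space :: "nat \<Rightarrow> height_config measure" where
  "height_space d = PiM (verts d) (\<lambda>_. count_space UNIV)"

definition coord_algebra :: "nat \<Rightarrow> nat list set \<Rightarrow> height_config measure" where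
  "coord_algebra d \<Lambda> =
     sigma (space (height_space d)) {{\<omega> \<in> space (height_space d). \<omega> x \<in> A} | x A. x \<in> \<Lambda>}"

text \<open>
  The intersection below is itself a sigma-algebra; \<open>sigma\<close> only turns it into a
  measurable space.
\<close>

definition tail_algebra :: "nat \<Rightarrow> height_config measure" where
  "tail_algebra d =
     sigma (space (height_space d))
       (\<Inter>\<Lambda>\<in>{\<Lambda>. finite \<Lambda> \<and> \<Lambda> \<subseteq> verts d}. sets (coord_algebra d (verts d - \<Lambda>)))"

definition height_shift :: "nat \<Rightarrow> int \<Rightarrow> height_config \<Rightarrow> height_config" where
  "height_shift d a \<omega> = (\<lambda>x\<in>verts d. \<omega> x - a)"

text \<open>
  The action on configurations of the left multiplication by \<open>v\<close>; recall that
  \<open>rev v\<close> is the inverse of \<open>v\<close>.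
\<close>

definition translate :: "nat \<Rightarrow> nat list \<Rightarrow> height_config \<Rightarrow> height_config" where
  "translate d v \<omega> = (\<lambda>u\<in>verts d. \<omega> (gmult (rev v) u))"


section \<open>Gradient configurations and the free state\<close>

definition gradient_space :: "nat \<Rightarrow> gradient_config measure" where
  "gradient_space d =
     restrict_space (PiM (arcs d) (\<lambda>_. count_space UNIV))
       {\<zeta>. \<forall>(u, v)\<in>arcs d. \<zeta> (u, v) = - \<zeta> (v, u)}"

definition heights_from :: "nat \<Rightarrow> nat list \<Rightarrow> int \<Rightarrow> gradient_config \<Rightarrow> height_config" where
  "heights_from d x s \<zeta> = (\<lambda>v\<in>verts d. s + (\<Sum>b\<in>path_arcs d x v. \<zeta> b))"

definition l1_norm :: "(int \<Rightarrow> real) \<Rightarrow> real" where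
  "l1_norm Q = (\<Sum>\<^sub>\<infinity>j. Q j)"

definition increment_law :: "(int \<Rightarrow> real) \<Rightarrow> int measure" where
  "increment_law Q = density (count_space UNIV) (\<lambda>j. ennreal (Q j / l1_norm Q))"

text \<open>
  The increments along the edges oriented away from the root are independent with the law
  above; those along the reversed edges are determined by antisymmetry.
\<close>

definition free_state :: "nat \<Rightarrow> (int \<Rightarrow> real) \<Rightarrow> gradient_config measure" where
  "free_state d Q =
     distr (PiM (outward_arcs d) (\<lambda>_. increment_law Q)) (gradient_space d)
       (\<lambda>\<xi>. \<lambda>b\<in>arcs d. if b \<in> outward_arcs d then \<xi> b else - \<xi> (snd b, fst b))"


section \<open>Gibbs measures\<close>

text \<open>
  The first product runs over the unordered edges inside \<open>\<Lambda>\<close>, each one being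
  represented by its orientation away from the root. The choice of orientation is
  immaterial for symmetric \<open>Q\<close>.
\<close>

definition boltzmann_weight ::
  "nat \<Rightarrow> (int \<Rightarrow> real) \<Rightarrow> nat list set \<Rightarrow> height_config \<Rightarrow> height_config \<Rightarrow> real" where
  "boltzmann_weight d Q \<Lambda> \<omega> \<xi> =
     (\<Prod>(x, y)\<in>{(x, y) \<in> outward_arcs d. x \<in> \<Lambda> \<and> y \<in> \<Lambda>}. Q (\<xi> x - \<xi> y)) *
     (\<Prod>(x, y)\<in>{(x, y) \<in> arcs d. x \<in> outer_boundary d \<Lambda> \<and> y \<in> \<Lambda>}. Q (\<omega> x - \<xi> y))"

definition partition_function ::
  "nat \<Rightarrow> (int \<Rightarrow> real) \<Rightarrow> nat list set \<Rightarrow> height_config \<Rightarrow> ennreal" where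
  "partition_function d Q \<Lambda> \<omega> =
     (\<integral>\<^sup>+ \<xi>. ennreal (boltzmann_weight d Q \<Lambda> \<omega> \<xi>) \<partial>count_space (\<Lambda> \<rightarrow>\<^sub>E UNIV))"

definition gibbs_kernel ::
  "nat \<Rightarrow> (int \<Rightarrow> real) \<Rightarrow> nat list set \<Rightarrow> height_config \<Rightarrow> height_config measure" where
  "gibbs_kernel d Q \<Lambda> \<omega> =
     distr
       (density (count_space (\<Lambda> \<rightarrow>\<^sub>E UNIV))
         (\<lambda>\<xi>. ennreal (boltzmann_weight d Q \<Lambda> \<omega> \<xi>) / partition_function d Q \<Lambda> \<omega>))
       (height_space d)
       (\<lambda>\<xi>. \<lambda>x\<in>verts d. if x \<in> \<Lambda> then \<xi> x else \<omega> x)"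

definition gibbs_measure :: "nat \<Rightarrow> (int \<Rightarrow> real) \<Rightarrow> height_config measure \<Rightarrow> bool" where
  "gibbs_measure d Q \<mu> \<longleftrightarrow>
     prob_space \<mu> \<and> sets \<mu> = sets (height_space d) \<and>
     (\<forall>\<Lambda> A. finite \<Lambda> \<and> \<Lambda> \<subseteq> verts d \<and> A \<in> sets (height_space d) \<longrightarrow>
        (\<integral>\<^sup>+ \<omega>. emeasure (gibbs_kernel d Q \<Lambda> \<omega>) A \<partial>\<mu>) = emeasure \<mu> A)"

text \<open>
  Measures do not form a vector space, so that the library's \<open>extreme_point_of\<close> is
  not applicable here.
\<close>

definition extreme_gibbs_measure :: "nat \<Rightarrow> (int \<Rightarrow> real) \<Rightarrow> height_config measure \<Rightarrow> bool" where
  "extreme_gibbs_measure d Q \<mu> \<longleftrightarrow>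
     gibbs_measure d Q \<mu> \<and>
     \<not> (\<exists>\<mu>\<^sub>1 \<mu>\<^sub>2 t. gibbs_measure d Q \<mu>\<^sub>1 \<and> gibbs_measure d Q \<mu>\<^sub>2 \<and> \<mu>\<^sub>1 \<noteq> \<mu>\<^sub>2 \<and>
           0 < t \<and> t < 1 \<and>
           (\<forall>A\<in>sets (height_space d).
              measure \<mu> A = t * measure \<mu>\<^sub>1 A + (1 - t) * measure \<mu>\<^sub>2 A))"


section \<open>Height-offset variables\<close>

definition height_offset :: "nat \<Rightarrow> gradient_config measure \<Rightarrow> (height_config \<Rightarrow> ereal) \<Rightarrow> bool" where
  "height_offset d \<nu> H \<longleftrightarrow>
     (\<forall>a. \<forall>\<omega>\<in>space (height_space d). H (height_shift d (- a) \<omega>) = H \<omega> + ereal (of_int a)) \<and>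
     H \<in> borel_measurable (tail_algebra d) \<and>
     (\<exists>x\<in>verts d. \<exists>s. AE \<zeta> in \<nu>. \<bar>H (heights_from d x s \<zeta>)\<bar> \<noteq> \<infinity>)"

text \<open>
  The pinning is done at the root with height 0. Where \<open>H\<close> is infinite,
  \<open>real_of_ereal\<close> makes the subtracted integer 0; this only concerns a null set if
  \<open>H\<close> is a height-offset variable.
\<close>

definition offset_heights ::
  "nat \<Rightarrow> (height_config \<Rightarrow> ereal) \<Rightarrow> gradient_config \<Rightarrow> height_config" where
  "offset_heights d H \<zeta> =
     height_shift d \<lfloor>real_of_ereal (H (heights_from d tree_root 0 \<zeta>))\<rfloor> (heights_from d tree_root 0 \<zeta>)"

definition offset_measure ::
  "nat \<Rightarrow> gradient_config measure \<Rightarrow> (height_config \<Rightarrow> ereal) \<Rightarrow> height_config measure" where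
  "offset_measure d \<nu> H = distr \<nu> (height_space d) (offset_heights d H)"

definition sphere_average :: "nat \<Rightarrow> nat \<Rightarrow> height_config \<Rightarrow> real" where
  "sphere_average d r \<omega> = (\<Sum>v\<in>sphere_verts d r. real_of_int (\<omega> v)) / real (card (sphere_verts d r))"

definition limit_average :: "nat \<Rightarrow> height_config \<Rightarrow> ereal" where
  "limit_average d \<omega> =
     (if \<exists>l. (\<lambda>r. ereal (sphere_average d r \<omega>)) \<longlonglongrightarrow> l
      then lim (\<lambda>r. ereal (sphere_average d r \<omega>))
      else limsup (\<lambda>r. ereal (sphere_average d r \<omega>)))"

definition pinned_average :: "nat \<Rightarrow> nat \<Rightarrow> gradient_config \<Rightarrow> real" where
  "pinned_average d r \<zeta> = sphere_average d r (heights_from d tree_root 0 \<zeta>)"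

text \<open>Off the almost sure event where the limit exists, \<open>lim\<close> is an arbitrary constant.\<close>

definition pinned_limit :: "nat \<Rightarrow> gradient_config \<Rightarrow> real" where
  "pinned_limit d \<zeta> = lim (\<lambda>r. pinned_average d r \<zeta>)"


section \<open>Modes of convergence, smoothness, and the Markov property\<close>

definition tendsto_L2 :: "'a measure \<Rightarrow> (nat \<Rightarrow> 'a \<Rightarrow> real) \<Rightarrow> ('a \<Rightarrow> real) \<Rightarrow> bool" where
  "tendsto_L2 M X Y \<longleftrightarrow>
     (\<forall>n. X n \<in> borel_measurable M \<and> integrable M (\<lambda>\<omega>. (X n \<omega>)\<^sup>2)) \<and>
     Y \<in> borel_measurable M \<and> integrable M (\<lambda>\<omega>. (Y \<omega>)\<^sup>2) \<and>
     (\<lambda>n. \<integral>\<omega>. (X n \<omega> - Y \<omega>)\<^sup>2 \<partial>M) \<longlonglongrightarrow> 0"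

definition smooth :: "(real \<Rightarrow> real) \<Rightarrow> bool" where
  "smooth f \<longleftrightarrow> (\<forall>n x. (deriv ^^ n) f field_differentiable (at x))"

definition past :: "nat \<Rightarrow> nat list \<Rightarrow> nat list \<Rightarrow> nat list set" where
  "past d u v = {w \<in> verts d. tdist d w u < tdist d w v}"

definition tree_markov_chain :: "nat \<Rightarrow> height_config measure \<Rightarrow> bool" where
  "tree_markov_chain d \<mu> \<longleftrightarrow>
     prob_space \<mu> \<and> sets \<mu> = sets (height_space d) \<and>
     (\<forall>(u, v)\<in>arcs d. \<forall>j. AE \<omega> in \<mu>.
        real_cond_exp \<mu> (coord_algebra d (past d u v)) (indicator {\<omega>. \<omega> v = j}) \<omega> =
        real_cond_exp \<mu> (coord_algebra d {u}) (indicator {\<omega>. \<omega> v = j}) \<omega>)"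

end

theory Submission
  imports Defs
begin

text \<open>
  In terms of the independent increments \<open>\<xi>\<^sub>v\<close> (one for each vertex \<open>v\<close> other than the root,
  for the edge leading to \<open>v\<close>), the pinned average \<open>H\<^sub>r\<close> is the sum over \<open>n \<le> r\<close> of the level
  averages \<open>X\<^sub>n\<close> of the \<open>\<xi>\<^sub>v\<close>, whose variances decay geometrically; this gives convergence.
  The basic tool is resampling a single increment: the expectation of \<open>f \<xi>\<close> does not change when
  \<open>\<xi>\<^sub>v\<close> is replaced by an independent copy and averaged over. It yields quasi-invariance under finite
  changes of the increments, hence the Gibbs property, because the pinned measure is a free measure
  with unpinned height at the root, restricted to the tail event that \<open>H\<close> lies in \<open>[0, 1)\<close>.

  The characteristic function of \<open>H\<close> at \<open>t\<close> is dominated by the contribution of a single level of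
  size about \<open>|t|\<close>, so it decays exponentially and Fourier inversion gives a smooth density. For
  positivity, one increment in a deep level \<open>n\<close> spreads the mass over a lattice of mesh
  \<open>1 / |W\<^sub>n|\<close>, and the rest of the sum has a density with a Lipschitz constant and a peak height
  that do not depend on \<open>n\<close>.

  Conditioning on the tail event \<open>H < 1/2\<close> shows that the measure is not extreme. Shifting one
  branch at the root moves \<open>H\<close> and its translate by different amounts, which excludes
  translation invariance; and the Markov property would force the conditional probability of
  \<open>0 \<le> H < 1\<close> to be insensitive to such shifts.
\<close>


section \<open>The tree\<close>

text \<open>The obstacle to the Gibbs property is that the subtracted integer depends on the whole
  configuration. Giving the height at the root counting measure, which is infinite but invariant
  under shifts, removes it: changing finitely many heights, the one at the root included, then has
  an explicit density ratio. Positivity needs the decay of the characteristic function and the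
  second moment uniformly for the sum with one increment deleted, wherever that increment sits.
  Hence sums over levels are formed over an arbitrary set \<open>D\<close> of kept increments,
  constants are explicit, and the decay asks only that half of each level is kept. The decay is
  exponential because a level of size N comparable to |t| contributes N factors of size about 1 - c
  (t/N)^2. The threshold (d + 1) R in the localization comes from the first level, whose increments
  carry the largest weight in the average, 1 / (d + 1). First moments are avoided by symmetry of
  \<open>Q\<close>: linear terms cancel when an integral is added to its reflection.\<close>

definition nonroot :: "nat \<Rightarrow> nat list set" where
  "nonroot d = verts d - {[]}"

definition level :: "nat \<Rightarrow> nat \<Rightarrow> nat list set" where
  "level d n = {v \<in> verts d. length v = n}"

lemma Nil_in_verts [simp]: "[] \<in> verts d"
  by (simp add: verts_def)

lemma verts_snoc: "w @ [g] \<in> verts d \<longleftrightarrow> w \<in> verts d \<and> g \<le> d \<and> (w = [] \<or> last w \<noteq> g)"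
  by (auto simp: verts_def distinct_adj_append_iff)

lemma verts_Cons: "g # w \<in> verts d \<longleftrightarrow> w \<in> verts d \<and> g \<le> d \<and> (w = [] \<or> hd w \<noteq> g)"
  by (auto simp: verts_def distinct_adj_Cons)

lemma take_in_verts: "v \<in> verts d \<Longrightarrow> take n v \<in> verts d"
  by (metis append_take_drop_id distinct_adj_append_iff le_sup_iff mem_Collect_eq set_append verts_def)

lemma butlast_in_verts: "v \<in> verts d \<Longrightarrow> butlast v \<in> verts d"
  by (simp add: butlast_conv_take take_in_verts)

lemma finite_level [simp]: "finite (level d n)"
proof -
  have "level d n \<subseteq> {xs. set xs \<subseteq> {..d} \<and> length xs = n}"
    by (auto simp: level_def verts_def)
  then show ?thesis
    using finite_lists_length_eq[of "{..d}" n] by (rule finite_subset) simp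
qed

lemma level_0: "level d 0 = {[]}"
  by (auto simp: level_def)

text \<open>The letters of \<open>u\<close> are prepended from right to left; since \<open>u\<close>
  is reduced, a cancellation can occur only between its last letter and \<open>g\<close>.\<close>

lemma gmult_single:
  assumes "u \<in> verts d"
  shows "gmult u [g] = (if u \<noteq> [] \<and> last u = g then butlast u else u @ [g])"
  using assms
proof (induction u)
  case Nil
  then show ?case by (simp add: gmult_def)
next
  case (Cons h w)
  then have w: "w \<in> verts d" "w = [] \<or> hd w \<noteq> h" by (auto simp: verts_Cons)
  have "gmult (h # w) [g] = gen_cons h (gmult w [g])" by (simp add: gmult_def)
  also have "\<dots> = gen_cons h (if w \<noteq> [] \<and> last w = g then butlast w else w @ [g])"
    using Cons w by simp
  also have "\<dots> = (if last (h # w) = g then butlast (h # w) else (h # w) @ [g])"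
    using w(2)
    by (cases w; cases "tl w") (auto)
  finally show ?case by simp
qed

text \<open>This identifies the Cayley graph with the prefix tree on reduced words, where the parent
  of \<open>v\<close> is \<open>butlast v\<close>. Group multiplication returns only with the
  translations.\<close>

lemma arcs_iff:
  "(u, v) \<in> arcs d \<longleftrightarrow>
    u \<in> verts d \<and> v \<in> verts d \<and> (v \<noteq> [] \<and> u = butlast v \<or> u \<noteq> [] \<and> v = butlast u)"
  (is "?l \<longleftrightarrow> ?r")
proof
  assume ?l
  then obtain g where g: "u \<in> verts d" "g \<le> d" "v = gmult u [g]"
    by (auto simp: arcs_def)
  show ?r
  proof (cases "u \<noteq> [] \<and> last u = g")
    case True
    then show ?thesis using g by (auto simp: gmult_single butlast_in_verts)
  next
    case False
    then show ?thesis using g by (auto simp: gmult_single verts_snoc)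
  qed
next
  assume r: ?r
  then have uv: "u \<in> verts d" "v \<in> verts d" by auto
  from r consider "v \<noteq> []" "u = butlast v" | "u \<noteq> []" "v = butlast u" by auto
  then show ?l
  proof cases
    case 1
    then have v: "v = u @ [last v]" by simp
    then have "u @ [last v] \<in> verts d" using uv by simp
    then have "last v \<le> d" "u = [] \<or> last u \<noteq> last v" by (auto simp: verts_snoc)
    then have "v = gmult u [last v]" using uv v by (subst gmult_single) auto
    then show ?thesis using uv \<open>last v \<le> d\<close> by (auto simp: arcs_def)
  next
    case 2
    then have u: "u = v @ [last u]" by simp
    then have "v @ [last u] \<in> verts d" using uv by simp
    then have "last u \<le> d" by (auto simp: verts_snoc)
    moreover have "v = gmult u [last u]" using uv 2 by (simp add: gmult_single)
    ultimately show ?thesis using uv by (auto simp: arcs_def)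
  qed
qed

lemma arcs_sym: "(u, v) \<in> arcs d \<Longrightarrow> (v, u) \<in> arcs d"
  by (auto simp: arcs_iff)

lemma relpow_arcs_sym: "(u, v) \<in> arcs d ^^ n \<Longrightarrow> (v, u) \<in> arcs d ^^ n"
proof (induction n arbitrary: v)
  case (Suc n)
  then obtain w where "(u, w) \<in> arcs d ^^ n" "(w, v) \<in> arcs d" by auto
  then show ?case using Suc.IH arcs_sym by (meson relpow_Suc_I2)
qed simp

text \<open>The tool for lower bounds on graph distances: a function that increases by at most one
  along each arc cannot outrun the number of steps.\<close>

lemma relpow_arcs_bound:
  assumes "\<And>u v. (u, v) \<in> arcs d \<Longrightarrow> f v \<le> Suc (f u)" "(u, v) \<in> arcs d ^^ n"
  shows "f v \<le> f u + n"
  using assms(2)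
proof (induction n arbitrary: v)
  case (Suc n)
  then obtain w where "(u, w) \<in> arcs d ^^ n" "(w, v) \<in> arcs d" by auto
  then show ?case using Suc.IH[of w] assms(1)[of w v] by simp
qed simp

lemma relpow_arcs_append: "u @ v \<in> verts d \<Longrightarrow> (u, u @ v) \<in> arcs d ^^ length v"
proof (induction v rule: rev_induct)
  case Nil
  then show ?case by simp
next
  case (snoc g v)
  then have "(u @ v) @ [g] \<in> verts d" by simp
  then have "u @ v \<in> verts d" unfolding verts_snoc by simp
  then have "(u, u @ v) \<in> arcs d ^^ length v" "(u @ v, u @ v @ [g]) \<in> arcs d"
    using snoc by (auto simp: arcs_iff butlast_append)
  then show ?case by auto
qed

lemma tdist_Nil_right: "w \<in> verts d \<Longrightarrow> tdist d w [] = length w"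
  unfolding tdist_def
proof (rule Least_equality)
  assume "w \<in> verts d"
  then show "(w, []) \<in> arcs d ^^ length w"
    using relpow_arcs_append[of "[]" w d] relpow_arcs_sym by simp
next
  fix n assume "(w, []) \<in> arcs d ^^ n"
  then have "([], w) \<in> arcs d ^^ n" by (rule relpow_arcs_sym)
  moreover have "length v \<le> Suc (length u)" if "(u, v) \<in> arcs d" for u v
    using that by (auto simp: arcs_iff)
  ultimately show "length w \<le> n"
    using relpow_arcs_bound[of d length "[]" w n] by simp
qed

lemma tdist_Nil_left:
  assumes "w \<in> verts d" shows "tdist d [] w = length w"
proof -
  have "([], w) \<in> arcs d ^^ n \<longleftrightarrow> (w, []) \<in> arcs d ^^ n" for n
    using relpow_arcs_sym by blast
  then have "tdist d [] w = tdist d w []" by (simp add: tdist_def)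
  then show ?thesis using assms by (simp add: tdist_Nil_right)
qed

text \<open>Besides distances to the root, only those to its neighbours are needed, because the
  Markov property is refuted along an edge at the root. An explicit path gives the upper bound, and
  the candidate distance \<open>f\<close> grows by at most one per step.\<close>

lemma tdist_generator:
  assumes w: "w \<in> verts d" and g: "g \<le> d"
  shows "tdist d w [g] = (if w \<noteq> [] \<and> hd w = g then length w - 1 else Suc (length w))"
proof -
  define f where "f w = (if w \<noteq> [] \<and> hd w = g then length w - 1 else Suc (length w))" for w
  have f: "f v \<le> Suc (f u)" if "(u, v) \<in> arcs d" for u v
  proof -
    have *: "f (x @ [a]) \<le> Suc (f x)" "f x \<le> Suc (f (x @ [a]))" for x a
      by (cases x; force simp: f_def)+
    from that consider "v \<noteq> []" "u = butlast v" | "u \<noteq> []" "v = butlast u"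
      unfolding arcs_iff by auto
    then show ?thesis
    proof cases
      case 1
      then show ?thesis using *(1)[of "butlast v" "last v"] by simp
    next
      case 2
      then show ?thesis using *(2)[of "butlast u" "last u"] by simp
    qed
  qed
  have *: "([g], w) \<in> arcs d ^^ f w"
  proof (cases "w \<noteq> [] \<and> hd w = g")
    case True
    then have "w = [g] @ tl w" by (cases w) auto
    then show ?thesis using relpow_arcs_append[of "[g]" "tl w" d] w True by (simp add: f_def)
  next
    case False
    have "([g], []) \<in> arcs d" using g by (simp add: arcs_iff verts_def)
    moreover have "([], w) \<in> arcs d ^^ length w"
      using relpow_arcs_append[of "[]" w d] w by simp
    ultimately have "([g], w) \<in> arcs d ^^ Suc (length w)" by (rule relpow_Suc_I2)
    then show ?thesis using False unfolding f_def by (simp only: if_False)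
  qed
  show ?thesis
    unfolding f_def[symmetric] tdist_def
  proof (rule Least_equality)
    show "(w, [g]) \<in> arcs d ^^ f w" by (rule relpow_arcs_sym[OF *])
    fix n assume "(w, [g]) \<in> arcs d ^^ n"
    then show "f w \<le> n"
      using relpow_arcs_bound[of d f "[g]" w n, OF f] relpow_arcs_sym by (simp add: f_def)
  qed
qed

lemma sphere_verts_eq_level: "sphere_verts d r = level d r"
  by (auto simp: sphere_verts_def level_def tdist_Nil_left)

lemma past_generator:
  assumes "g \<le> d"
  shows "past d [] [g] = {w \<in> verts d. w = [] \<or> hd w \<noteq> g}"
  using assms by (auto simp: past_def tdist_Nil_right tdist_generator)

lemma outward_arcs_eq: "outward_arcs d = (\<lambda>v. (butlast v, v)) ` nonroot d"
proof -
  have "(u, v) \<in> outward_arcs d \<longleftrightarrow> u = butlast v \<and> v \<in> nonroot d" for u v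
    by (auto simp: outward_arcs_def arcs_iff nonroot_def butlast_in_verts tdist_Nil_left)
  then show ?thesis by auto
qed

text \<open>By induction the path consists of the prefixes of its current endpoint, so the parent of
  that endpoint has been visited already and the next vertex must be a child.\<close>

lemma self_avoiding_from_root:
  assumes "p \<noteq> []" "hd p = []" "distinct p" "successively (\<lambda>x y. (x, y) \<in> arcs d) p"
  shows "p = map (\<lambda>n. take n (last p)) [0..<Suc (length (last p))]"
  using assms
proof (induction p rule: rev_induct)
  case (snoc x p)
  show ?case
  proof (cases "p = []")
    case True
    then show ?thesis using snoc.prems by simp
  next
    case False
    define v where "v = last p"
    have p: "p = map (\<lambda>n. take n v) [0..<Suc (length v)]"
      using snoc False by (auto simp: v_def successively_append_iff)
    have "(v, x) \<in> arcs d"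
      using snoc.prems False by (auto simp: v_def successively_append_iff)
    moreover have "butlast v \<in> set p" if "v \<noteq> []"
      by (subst p) (auto simp: butlast_conv_take)
    ultimately have "x \<noteq> []" "v = butlast x"
      using snoc.prems(3) by (auto simp: arcs_iff)
    then have x: "length x = Suc (length v)" "v = take (length v) x"
      by (auto simp: butlast_conv_take)
    have "take n v = take n x" if "n \<le> length v" for n
      by (subst x(2)) (use that in simp)
    then have "map (\<lambda>n. take n v) [0..<Suc (length v)] = map (\<lambda>n. take n x) [0..<Suc (length v)]"
      by (intro map_cong) auto
    then have "p = map (\<lambda>n. take n x) [0..<Suc (length v)]"
      using p by simp
    then show ?thesis using x(1) by simp
  qed
qed simp

lemma self_avoiding_path_root:
  assumes "v \<in> verts d"
  shows "self_avoiding_path d [] v = map (\<lambda>n. take n v) [0..<Suc (length v)]"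
  unfolding self_avoiding_path_def
proof (rule the_equality)
  let ?p = "map (\<lambda>n. take n v) [0..<Suc (length v)]"
  have "hd ?p = []" by (simp add: upt_conv_Cons del: upt_Suc)
  moreover have "distinct ?p"
    by (auto simp: distinct_map inj_on_def simp del: upt_Suc)
      (metis length_take min.absorb2 less_Suc_eq_le)
  moreover have "successively (\<lambda>x y. (x, y) \<in> arcs d) ?p"
    unfolding successively_conv_nth
    using assms by (auto simp: arcs_iff take_in_verts butlast_take simp del: upt_Suc)
  ultimately show "?p \<noteq> [] \<and> hd ?p = [] \<and> last ?p = v \<and> distinct ?p \<and>
      successively (\<lambda>x y. (x, y) \<in> arcs d) ?p"
    by simp
qed (metis self_avoiding_from_root)

lemma path_arcs_root:
  assumes "v \<in> verts d"
  shows "path_arcs d [] v = (\<lambda>n. (butlast (take n v), take n v)) ` {1..length v}"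
proof -
  have "path_arcs d [] v = (\<lambda>n. (take n v, take (Suc n) v)) ` {..<length v}"
    unfolding path_arcs_def self_avoiding_path_root[OF assms] Let_def set_zip
    by (force simp del: upt_Suc simp: nth_tl image_def)
  also have "\<dots> = (\<lambda>n. (butlast (take n v), take n v)) ` Suc ` {..<length v}"
    unfolding image_image by (intro image_cong) (auto simp: butlast_take)
  also have "Suc ` {..<length v} = {1..length v}"
    by (simp add: lessThan_atLeast0 image_Suc_atLeastLessThan atLeastLessThanSuc_atLeastAtMost)
  finally show ?thesis .
qed

text \<open>Every vertex other than the root has exactly \<open>d\<close> children. The subset
  \<open>U\<close> and the weight \<open>F\<close> let the same count yield the sizes of levels, the
  sizes of branches and the averages of inherited heights.\<close>

lemma sum_level_Suc:
  fixes F :: "nat list \<Rightarrow> real"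
  assumes "n \<ge> 1" "U \<subseteq> level d n"
  shows "(\<Sum>v\<in>{v \<in> level d (Suc n). butlast v \<in> U}. F (butlast v)) = real d * (\<Sum>v\<in>U. F v)"
proof -
  have eq: "{v \<in> level d (Suc n). butlast v \<in> U} =
      (\<lambda>(u, g). u @ [g]) ` (SIGMA u:U. {..d} - {last u})" (is "?l = ?r")
  proof (intro equalityI subsetI)
    fix v assume v: "v \<in> ?l"
    then have v': "v = butlast v @ [last v]" "butlast v \<in> U"
      by (auto simp: level_def intro: append_butlast_last_id[symmetric])
    then have "butlast v \<noteq> []" using assms by (auto simp: level_def)
    moreover have "butlast v @ [last v] \<in> verts d" using v v' by (simp add: level_def)
    ultimately have "last v \<le> d" "last v \<noteq> last (butlast v)" by (auto simp: verts_snoc)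
    then show "v \<in> ?r" using v' by (intro image_eqI[of _ _ "(butlast v, last v)"]) auto
  next
    fix v assume "v \<in> ?r"
    then show "v \<in> ?l" using assms by (auto simp: level_def verts_snoc)
  qed
  have inj: "inj_on (\<lambda>(u, g). u @ [g]) (SIGMA u:U. {..d} - {last u})"
    by (auto simp: inj_on_def)
  have fin: "finite U" using assms(2) finite_level by (rule finite_subset)
  have "(\<Sum>v\<in>{v \<in> level d (Suc n). butlast v \<in> U}. F (butlast v)) =
      (\<Sum>(u, g)\<in>(SIGMA u:U. {..d} - {last u}). F u)"
    unfolding eq by (subst sum.reindex[OF inj]) (auto intro!: sum.cong)
  also have "\<dots> = (\<Sum>u\<in>U. \<Sum>g\<in>{..d} - {last u}. F u)"
    using fin by (subst sum.Sigma) auto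
  also have "\<dots> = (\<Sum>u\<in>U. real d * F u)"
  proof (rule sum.cong)
    fix u assume "u \<in> U"
    then have "u \<noteq> []" "u \<in> verts d" using assms by (auto simp: level_def)
    then have "last u \<le> d" by (metis append_butlast_last_id verts_snoc)
    then show "(\<Sum>g\<in>{..d} - {last u}. F u) = real d * F u" by (simp add: card_Diff_singleton_if)
  qed simp
  finally show ?thesis by (simp add: sum_distrib_left)
qed

lemma card_level_Suc:
  assumes "n \<ge> 1" shows "card (level d (Suc n)) = d * card (level d n)"
proof -
  have "{v \<in> level d (Suc n). butlast v \<in> level d n} = level d (Suc n)"
    by (auto simp: level_def butlast_in_verts)
  then have "real (card (level d (Suc n))) = real (d * card (level d n))"
    using sum_level_Suc[OF assms order_refl, of "\<lambda>_. 1" d] by simp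
  then show ?thesis by linarith
qed

lemma level_1: "level d 1 = (\<lambda>g. [g]) ` {..d}"
  by (auto simp: level_def verts_def length_Suc_conv)

lemma card_level: "card (level d n) = (if n = 0 then 1 else (d + 1) * d ^ (n - 1))"
proof (induction n)
  case (Suc n)
  show ?case
  proof (cases n)
    case 0
    then show ?thesis by (simp add: level_1[simplified] card_image inj_on_def)
  next
    case (Suc m)
    then show ?thesis using Suc.IH card_level_Suc[of n d] by (simp add: algebra_simps)
  qed
qed (simp add: level_0)

lemma card_level_ge: "d \<ge> 2 \<Longrightarrow> real (card (level d n)) \<ge> 2 ^ n"
proof -
  assume d: "d \<ge> 2"
  have "(d + 1) * d ^ (n - 1) \<ge> 2 ^ n" if "n > 0"
  proof -
    have "(d + 1) * d ^ (n - 1) \<ge> 2 * 2 ^ (n - 1)" by (intro mult_mono power_mono) (use d in auto)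
    then show ?thesis using that by (cases n) auto
  qed
  then have "card (level d n) \<ge> 2 ^ n" by (simp add: card_level)
  then have "real (2 ^ n) \<le> real (card (level d n))" unfolding of_nat_le_iff .
  then show ?thesis by simp
qed

lemma card_level_pos [simp]: "d \<ge> 2 \<Longrightarrow> card (level d n) > 0"
  by (simp add: card_level)

text \<open>The words starting with \<open>g\<close> form one of the \<open>d + 1\<close> branches
  at the root; this count gives the share of each branch in a level, on which the later shift
  arguments rest.\<close>

lemma card_level_hd:
  assumes "g \<le> d"
  shows "card {v \<in> level d (Suc n). hd v = g} = d ^ n"
proof (induction n)
  case 0
  have "{v \<in> level d (Suc 0). hd v = g} = {[g]}"
    using assms by (auto simp: level_1[simplified])
  then show ?case by simp
next
  case (Suc n)
  define U where "U = {v \<in> level d (Suc n). hd v = g}"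
  have "hd (butlast v) = hd v" if "length v = Suc (Suc n)" for v :: "nat list"
    using that by (auto simp: length_Suc_conv)
  then have "{v \<in> level d (Suc (Suc n)). butlast v \<in> U} = {v \<in> level d (Suc (Suc n)). hd v = g}"
    by (auto simp: U_def level_def butlast_in_verts)
  then have "real (card {v \<in> level d (Suc (Suc n)). hd v = g}) = real (d * card U)"
    using sum_level_Suc[of "Suc n" U d "\<lambda>_. 1"] by (auto simp: U_def)
  then show ?case using Suc by (simp add: U_def del: of_nat_mult)
qed

section \<open>The increments\<close>

text \<open>The moment hypothesis speaks of natural numbers only; symmetry carries it over to all
  integers.\<close>

lemma even_summable_on_int:
  fixes f :: "int \<Rightarrow> real"
  assumes "\<And>j. f j \<ge> 0" "\<And>j. f (- j) = f j" "summable (\<lambda>n. f (int n))"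
  shows "f summable_on UNIV"
proof -
  have nat: "(\<lambda>n. f (int n)) summable_on UNIV"
    using assms by (intro norm_summable_imp_summable_on) simp
  have "f summable_on range int"
    using nat by (subst summable_on_reindex) (auto simp: o_def)
  moreover have "f summable_on (uminus ` range int)"
    unfolding image_image using nat assms(2)
    by (subst summable_on_reindex) (auto simp: o_def inj_on_def)
  moreover have "UNIV = range int \<union> uminus ` range int"
  proof (intro equalityI subsetI)
    fix x :: int
    have "x = int (nat x) \<or> x = - int (nat (- x))" by linarith
    then show "x \<in> range int \<union> uminus ` range int" by blast
  qed simp
  ultimately show ?thesis by (metis summable_on_union)
qed

lemma nn_integral_count_space_summable_on:
  fixes f :: "'a \<Rightarrow> real"
  assumes "\<And>x. f x \<ge> 0" "f summable_on UNIV"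
  shows "(\<integral>\<^sup>+x. ennreal (f x) \<partial>count_space UNIV) = ennreal (infsum f UNIV)"
proof -
  have int: "integrable (count_space UNIV) f"
    using abs_summable_equivalent[of f UNIV] assms
    by (simp add: Infinite_Set_Sum.abs_summable_on_def)
  have "(\<integral>\<^sup>+x. ennreal (f x) \<partial>count_space UNIV) = ennreal (\<integral>x. f x \<partial>count_space UNIV)"
    using int assms by (intro nn_integral_eq_integral) auto
  also have "(\<integral>x. f x \<partial>count_space UNIV) = infsum f UNIV"
    using infsetsum_infsum[of f UNIV] int
    by (simp add: infsetsum_def Infinite_Set_Sum.abs_summable_on_def)
  finally show ?thesis .
qed

lemma measurable_count_space_binary:
  fixes f g :: "'a \<Rightarrow> 'b::countable"
  assumes "f \<in> M \<rightarrow>\<^sub>M count_space UNIV" "g \<in> M \<rightarrow>\<^sub>M count_space UNIV" "\<And>x y. h x y \<in> space N"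
  shows "(\<lambda>x. h (f x) (g x)) \<in> M \<rightarrow>\<^sub>M N"
proof -
  have "(\<lambda>(x, y). h x y) \<in> count_space UNIV \<Otimes>\<^sub>M count_space UNIV \<rightarrow>\<^sub>M N"
    using assms(3) by (auto simp: pair_measure_countable)
  from measurable_compose[OF measurable_Pair[OF assms(1,2)] this] show ?thesis by simp
qed

locale tree_gradient =
  fixes d :: nat and Q :: "int \<Rightarrow> real"
  assumes d_ge_2: "d \<ge> 2"
    and Q_pos: "\<And>j. Q j > 0"
    and Q_sym: "\<And>j. Q (- j) = Q j"
    and Q_moment: "summable (\<lambda>j::nat. (real j)\<^sup>2 * Q (int j))"
begin

abbreviation q :: "int measure" where "q \<equiv> increment_law Q"

definition prob :: "int \<Rightarrow> real" where "prob j = Q j / l1_norm Q"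

text \<open>A second moment about 0, which is the variance since the symmetric law is
  centred.\<close>

definition variance :: real where "variance = (\<Sum>\<^sub>\<infinity>j. (real_of_int j)\<^sup>2 * prob j)"

lemma Q_summable_on: "Q summable_on UNIV"
proof (rule even_summable_on_int)
  show "summable (\<lambda>n. Q (int n))"
  proof (rule summable_comparison_test_ev[OF _ Q_moment])
    show "\<forall>\<^sub>F n in sequentially. norm (Q (int n)) \<le> (real n)\<^sup>2 * Q (int n)"
      using eventually_ge_at_top[of 1]
    proof eventually_elim
      case (elim n)
      then have "(real n)\<^sup>2 \<ge> 1" by simp
      then show ?case using Q_pos[of "int n"] by simp
    qed
  qed
qed (use Q_pos Q_sym less_imp_le in auto)

lemma l1_norm_pos: "l1_norm Q > 0"
proof -
  have "Q 0 = infsum Q {0}" by simp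
  also have "\<dots> \<le> infsum Q UNIV"
    using Q_summable_on Q_pos less_imp_le by (intro infsum_mono_neutral) auto
  finally show ?thesis using Q_pos[of 0] by (simp add: l1_norm_def)
qed

lemma prob_pos: "prob j > 0"
  using Q_pos l1_norm_pos by (simp add: prob_def)

lemma prob_sym: "prob (- j) = prob j"
  by (simp add: prob_def Q_sym)

lemma prob_summable_on: "prob summable_on UNIV"
  using summable_on_cmult_left[OF Q_summable_on, of "1 / l1_norm Q"]
  by (simp add: prob_def[abs_def])

lemma variance_summable_on: "(\<lambda>j. (real_of_int j)\<^sup>2 * prob j) summable_on UNIV"
proof (rule even_summable_on_int)
  show "summable (\<lambda>n. (real_of_int (int n))\<^sup>2 * prob (int n))"
    using summable_divide[OF Q_moment, of "l1_norm Q"] by (simp add: prob_def)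
qed (use less_imp_le[OF prob_pos] in \<open>auto simp: prob_sym\<close>)

lemma sets_q [simp, measurable_cong]: "sets q = UNIV"
  by (simp add: increment_law_def)

lemma space_q [simp]: "space q = UNIV"
  by (simp add: increment_law_def)

lemma measurable_q [measurable (raw), simp]: "f \<in> q \<rightarrow>\<^sub>M M \<longleftrightarrow> f \<in> UNIV \<rightarrow> space M"
  by (auto simp: measurable_def)

lemma nn_integral_q: "(\<integral>\<^sup>+j. f j \<partial>q) = (\<integral>\<^sup>+j. ennreal (prob j) * f j \<partial>count_space UNIV)"
  unfolding increment_law_def by (subst nn_integral_density) (auto simp: prob_def)

lemma emeasure_q: "emeasure q A = (\<integral>\<^sup>+j. ennreal (prob j) * indicator A j \<partial>count_space UNIV)"
  using nn_integral_q[of "indicator A"] by (subst nn_integral_indicator[symmetric]) auto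

lemma prob_space_q: "prob_space q"
proof
  have "emeasure q (space q) = ennreal (infsum prob UNIV)"
    using less_imp_le[OF prob_pos] prob_summable_on
    by (simp add: emeasure_q nn_integral_count_space_summable_on)
  also have "infsum prob UNIV = infsum Q UNIV * (1 / l1_norm Q)"
    unfolding prob_def[abs_def] using infsum_cmult_left'[of Q "1 / l1_norm Q" UNIV] by simp
  finally show "emeasure q (space q) = 1" using l1_norm_pos by (simp add: l1_norm_def)
qed

sublocale q: prob_space q by (rule prob_space_q)

lemma emeasure_q_singleton: "emeasure q {j} = ennreal (prob j)"
proof -
  have "emeasure q {j} = (\<integral>\<^sup>+i. ennreal (prob i) * indicator {j} i \<partial>count_space UNIV)"
    by (rule emeasure_q)
  also have "\<dots> = ennreal (prob j)"
    by (subst nn_integral_count_space'[where A="{j}"]) (auto simp: indicator_def)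
  finally show ?thesis .
qed

text \<open>Every integer has positive mass because \<open>Q\<close> is strictly positive, so the
  only null set is empty.\<close>

lemma AE_q: "(AE j in q. P j) \<longleftrightarrow> (\<forall>j. P j)"
proof
  assume "AE j in q. P j"
  then obtain N where N: "{j \<in> space q. \<not> P j} \<subseteq> N" "emeasure q N = 0" "N \<in> sets q"
    by (rule AE_E)
  show "\<forall>j. P j"
  proof (rule ccontr)
    assume "\<not> (\<forall>j. P j)"
    then obtain j where "\<not> P j" by auto
    then have "emeasure q {j} \<le> emeasure q N" using N by (intro emeasure_mono) auto
    then show False using N prob_pos[of j] by (simp add: emeasure_q_singleton)
  qed
qed simp

lemma nn_integral_q_uminus: "(\<integral>\<^sup>+j. f (- j) \<partial>q) = (\<integral>\<^sup>+j. f j \<partial>q)"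
proof -
  have "bij (uminus :: int \<Rightarrow> int)" by (rule bij_uminus)
  then have "(\<integral>\<^sup>+j. ennreal (prob (- j)) * f (- j) \<partial>count_space UNIV) =
      (\<integral>\<^sup>+j. ennreal (prob j) * f j \<partial>count_space UNIV)"
    by (rule nn_integral_bij_count_space)
  then show ?thesis by (simp add: nn_integral_q prob_sym)
qed

lemma nn_integral_q_square: "(\<integral>\<^sup>+j. ennreal ((real_of_int j)\<^sup>2) \<partial>q) = ennreal variance"
proof -
  have "(\<integral>\<^sup>+j. ennreal ((real_of_int j)\<^sup>2) \<partial>q) =
      (\<integral>\<^sup>+j. ennreal ((real_of_int j)\<^sup>2 * prob j) \<partial>count_space UNIV)"
    unfolding nn_integral_q using less_imp_le[OF prob_pos]
    by (intro nn_integral_cong) (simp add: ennreal_mult' mult.commute)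
  also have "\<dots> = ennreal variance"
    unfolding variance_def using variance_summable_on less_imp_le[OF prob_pos]
    by (intro nn_integral_count_space_summable_on) auto
  finally show ?thesis .
qed

lemma variance_nonneg: "variance \<ge> 0"
  unfolding variance_def using less_imp_le[OF prob_pos] by (intro infsum_nonneg) auto

text \<open>Indexing the increment along the arc from \<open>butlast v\<close> to \<open>v\<close> by its endpoint \<open>v\<close>.\<close>

definition noise :: "height_config measure" where
  "noise = PiM (nonroot d) (\<lambda>_. q)"

definition increments :: "height_config \<Rightarrow> gradient_config" where
  "increments \<xi> = (\<lambda>b\<in>arcs d. if b \<in> outward_arcs d then \<xi> (snd b) else - \<xi> (fst b))"

definition heights :: "int \<Rightarrow> height_config \<Rightarrow> height_config" where
  "heights s \<xi> = (\<lambda>v\<in>verts d. s + (\<Sum>n\<in>{1..length v}. \<xi> (take n v)))"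

sublocale noise: prob_space noise
  unfolding noise_def by (intro prob_space_PiM prob_space_q)

lemma noise_component [measurable]: "v \<in> nonroot d \<Longrightarrow> (\<lambda>\<xi>. \<xi> v) \<in> noise \<rightarrow>\<^sub>M count_space UNIV"
proof -
  assume v: "v \<in> nonroot d"
  have "(\<lambda>\<xi>. \<xi> v) \<in> noise \<rightarrow>\<^sub>M q"
    unfolding noise_def by (rule measurable_component_singleton[OF v])
  then show ?thesis
    using measurable_cong_sets[OF refl, of q "count_space UNIV" noise] by simp
qed

lemma noise_update: "v \<in> nonroot d \<Longrightarrow> (\<lambda>(j, \<xi>). \<xi>(v := j)) \<in> q \<Otimes>\<^sub>M noise \<rightarrow>\<^sub>M noise"
  unfolding noise_def split_beta
  by (rule measurable_fun_upd[where J="nonroot d"]) auto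

lemma noise_update_const [measurable]: "v \<in> nonroot d \<Longrightarrow> (\<lambda>\<xi>. \<xi>(v := j)) \<in> noise \<rightarrow>\<^sub>M noise"
  using measurable_compose[OF measurable_Pair1'[of j q noise] noise_update] by simp

lemma noise_split:
  assumes v: "v \<in> nonroot d"
  shows "noise = distr (q \<Otimes>\<^sub>M PiM (nonroot d - {v}) (\<lambda>_. q)) noise (\<lambda>(j, \<xi>). \<xi>(v := j))"
    and "(\<lambda>(j, \<xi>). \<xi>(v := j)) \<in> q \<Otimes>\<^sub>M PiM (nonroot d - {v}) (\<lambda>_. q) \<rightarrow>\<^sub>M noise"
proof -
  show "noise = distr (q \<Otimes>\<^sub>M PiM (nonroot d - {v}) (\<lambda>_. q)) noise (\<lambda>(j, \<xi>). \<xi>(v := j))"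
    using distr_pair_PiM_eq_PiM[of "nonroot d - {v}" "\<lambda>_. q" v, OF prob_space_q prob_space_q] v
    by (simp add: noise_def insert_absorb)
  show "(\<lambda>(j, \<xi>). \<xi>(v := j)) \<in> q \<Otimes>\<^sub>M PiM (nonroot d - {v}) (\<lambda>_. q) \<rightarrow>\<^sub>M noise"
    unfolding noise_def split_beta
    by (rule measurable_fun_upd[where J="nonroot d - {v}"]) (use v in auto)
qed

lemma noise_update_pair:
  assumes v: "v \<in> nonroot d" and f: "f \<in> borel_measurable noise"
  shows "(\<lambda>(\<xi>, j). f (\<xi>(v := j))) \<in> borel_measurable (noise \<Otimes>\<^sub>M q)"
  using measurable_compose[OF noise_update[OF v] f]
  by (subst measurable_split_conv, subst measurable_pair_swap_iff) (simp add: split_beta)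

lemma nn_integral_q_update_measurable:
  fixes f :: "height_config \<Rightarrow> ennreal"
  assumes "v \<in> nonroot d" "f \<in> borel_measurable noise"
  shows "(\<lambda>\<xi>. \<integral>\<^sup>+j. f (\<xi>(v := j)) \<partial>q) \<in> borel_measurable noise"
  using q.borel_measurable_nn_integral[OF noise_update_pair[OF assms]] by simp

text \<open>The splitting of one factor is used twice, for \<open>f\<close> and for its average over
  the coordinate \<open>v\<close>. That average no longer depends on the coordinate, so
  \<open>noise\<close> itself can stay as the outer measure in place of the product over the other
  coordinates.\<close>

lemma nn_integral_resample:
  assumes v: "v \<in> nonroot d" and f [measurable]: "f \<in> borel_measurable noise"
  shows "(\<integral>\<^sup>+\<xi>. f \<xi> \<partial>noise) = (\<integral>\<^sup>+\<xi>. (\<integral>\<^sup>+j. f (\<xi>(v := j)) \<partial>q) \<partial>noise)"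
proof -
  let ?R = "PiM (nonroot d - {v}) (\<lambda>_. q)"
  interpret R: prob_space ?R by (intro prob_space_PiM prob_space_q)
  interpret pair_sigma_finite q ?R ..
  note [measurable] = noise_split(2)[OF v] noise_update[OF v]
  have split: "(\<integral>\<^sup>+\<xi>. g \<xi> \<partial>noise) = (\<integral>\<^sup>+\<xi>. (\<integral>\<^sup>+j. g (\<xi>(v := j)) \<partial>q) \<partial>?R)"
    if [measurable]: "g \<in> borel_measurable noise" for g
  proof -
    have "(\<integral>\<^sup>+\<xi>. g \<xi> \<partial>noise) = (\<integral>\<^sup>+x. g ((\<lambda>(j, \<xi>). \<xi>(v := j)) x) \<partial>(q \<Otimes>\<^sub>M ?R))"
      by (subst noise_split(1)[OF v]) (rule nn_integral_distr; measurable)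
    also have "\<dots> = (\<integral>\<^sup>+\<xi>. (\<integral>\<^sup>+j. g (\<xi>(v := j)) \<partial>q) \<partial>?R)"
      by (subst nn_integral_snd[symmetric]) (auto intro!: measurable_compose[OF noise_split(2)[OF v]])
    finally show ?thesis .
  qed
  from split[OF nn_integral_q_update_measurable[OF v f]] split[OF f] show ?thesis
    by (simp add: q.emeasure_space_1[simplified])
qed

text \<open>The same argument for bounded complex functions, as needed for characteristic functions;
  the bound supplies integrability.\<close>

lemma integral_resample:
  fixes f :: "height_config \<Rightarrow> complex"
  assumes v: "v \<in> nonroot d" and f [measurable]: "f \<in> borel_measurable noise"
    and bound: "\<And>\<xi>. norm (f \<xi>) \<le> B"
  shows "(\<integral>\<xi>. f \<xi> \<partial>noise) = (\<integral>\<xi>. (\<integral>j. f (\<xi>(v := j)) \<partial>q) \<partial>noise)"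
proof -
  let ?R = "PiM (nonroot d - {v}) (\<lambda>_. q)"
  interpret R: prob_space ?R by (intro prob_space_PiM prob_space_q)
  interpret qR: pair_prob_space q ?R ..
  note [measurable] = noise_split(2)[OF v] noise_update[OF v]
  have split: "(\<integral>\<xi>. g \<xi> \<partial>noise) = (\<integral>\<xi>. (\<integral>j. g (\<xi>(v := j)) \<partial>q) \<partial>?R)"
    if [measurable]: "g \<in> borel_measurable noise" and b: "\<And>\<xi>. norm (g \<xi>) \<le> B" for g :: "_ \<Rightarrow> complex"
  proof -
    have "(\<integral>\<xi>. g \<xi> \<partial>noise) = (\<integral>x. g ((\<lambda>(j, \<xi>). \<xi>(v := j)) x) \<partial>(q \<Otimes>\<^sub>M ?R))"
      by (subst noise_split(1)[OF v]) (rule integral_distr; measurable)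
    also have "\<dots> = (\<integral>x. (case x of (j, \<xi>) \<Rightarrow> g (\<xi>(v := j))) \<partial>(q \<Otimes>\<^sub>M ?R))"
      by (simp add: split_beta)
    also have "\<dots> = (\<integral>\<xi>. (\<integral>j. g (\<xi>(v := j)) \<partial>q) \<partial>?R)"
    proof (rule qR.integral_snd[symmetric])
      have "(\<lambda>x. g ((\<lambda>(j, \<xi>). \<xi>(v := j)) x)) \<in> borel_measurable (q \<Otimes>\<^sub>M ?R)"
        by (rule measurable_compose[OF noise_split(2)[OF v]]) measurable
      then show "integrable (q \<Otimes>\<^sub>M ?R) (\<lambda>(j, \<xi>). g (\<xi>(v := j)))"
        using b by (intro qR.P.integrable_const_bound[where B=B]) (auto simp: split_beta)
    qed
    finally show ?thesis .
  qed
  have m: "(\<lambda>\<xi>. \<integral>j. f (\<xi>(v := j)) \<partial>q) \<in> borel_measurable noise"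
    using q.borel_measurable_lebesgue_integral[OF noise_update_pair[OF v f]] by simp
  have "norm (\<integral>j. f (\<xi>(v := j)) \<partial>q) \<le> B" for \<xi>
  proof -
    have "norm (\<integral>j. f (\<xi>(v := j)) \<partial>q) \<le> (\<integral>j. norm (f (\<xi>(v := j))) \<partial>q)"
      by (rule integral_norm_bound)
    also have "\<dots> \<le> (\<integral>j. B \<partial>q)"
      using bound order_trans[OF norm_ge_zero bound]
      by (intro integral_mono q.integrable_const_bound[where B=B]) auto
    finally show ?thesis by (simp add: q.prob_space[simplified])
  qed
  from split[OF m this] split[OF f bound] show ?thesis
    by (simp add: q.prob_space[simplified])
qed

text \<open>Since each integer has positive mass, averaging the indicator of a null set over a
  single increment forces it to vanish for every value of that increment. An almost sure property
  thus holds simultaneously for all modifications of one increment.\<close>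

lemma AE_resample:
  assumes v: "v \<in> nonroot d" and ae: "AE \<xi> in noise. P \<xi>"
  shows "AE \<xi> in noise. \<forall>j. P (\<xi>(v := j))"
proof -
  obtain N where N: "{\<xi> \<in> space noise. \<not> P \<xi>} \<subseteq> N" "emeasure noise N = 0" "N \<in> sets noise"
    using ae by (rule AE_E)
  note [measurable] = N(3)
  have "0 = (\<integral>\<^sup>+\<xi>. indicator N \<xi> \<partial>noise)" using N by simp
  also have "\<dots> = (\<integral>\<^sup>+\<xi>. (\<integral>\<^sup>+j. indicator N (\<xi>(v := j)) \<partial>q) \<partial>noise)"
    using v by (rule nn_integral_resample) measurable
  finally have 0: "(\<integral>\<^sup>+\<xi>. (\<integral>\<^sup>+j. indicator N (\<xi>(v := j)) \<partial>q) \<partial>noise) = 0" ..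
  have "(\<lambda>\<xi>. \<integral>\<^sup>+j. indicator N (\<xi>(v := j)) \<partial>q) \<in> borel_measurable noise"
    by (rule nn_integral_q_update_measurable[OF v]) measurable
  with 0 have "AE \<xi> in noise. (\<integral>\<^sup>+j. indicator N (\<xi>(v := j)) \<partial>q) = 0"
    by (simp add: nn_integral_0_iff_AE)
  then show ?thesis
    using AE_space
  proof eventually_elim
    case (elim \<xi>)
    then have "AE j in q. (indicator N (\<xi>(v := j)) :: ennreal) = 0"
      by (subst (asm) nn_integral_0_iff_AE) auto
    then have "\<xi>(v := j) \<notin> N" for j
      by (auto simp: AE_q indicator_def split: if_splits)
    moreover have "\<xi>(v := j) \<in> space noise" for j
      using elim(2) noise_update_const[OF v, of j] by (auto simp: measurable_def)
    ultimately show ?case using N(1) by blast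
  qed
qed

end

section \<open>Sphere averages and their limit superior\<close>

lemma limit_average_eq_limsup:
  "limit_average d \<omega> = limsup (\<lambda>r. ereal (sphere_average d r \<omega>))"
  unfolding limit_average_def
  by (auto simp: limI lim_imp_Limsup)

text \<open>All vertices of a level have equally many children, \<open>d + 1\<close> at the root and
  \<open>d\<close> elsewhere, so values inherited from the parents keep their average.\<close>

lemma sum_level_butlast:
  fixes F :: "nat list \<Rightarrow> real"
  assumes "d \<ge> 2"
  shows "(\<Sum>v\<in>level d (Suc n). F (butlast v)) / real (card (level d (Suc n))) =
    (\<Sum>v\<in>level d n. F v) / real (card (level d n))"
proof (cases "n = 0")
  case True
  have "(\<Sum>v\<in>level d (Suc 0). F (butlast v)) = (\<Sum>v\<in>level d (Suc 0). F [])"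
    by (intro sum.cong) (auto simp: level_def length_Suc_conv)
  then show ?thesis using True card_level_pos[OF assms, of 1] unfolding card_gt_0_iff by (simp add: level_0)
next
  case False
  have "{v \<in> level d (Suc n). butlast v \<in> level d n} = level d (Suc n)"
    by (auto simp: level_def butlast_in_verts)
  then have "(\<Sum>v\<in>level d (Suc n). F (butlast v)) = real d * (\<Sum>v\<in>level d n. F v)"
    using sum_level_Suc[of n "level d n" d F] False by simp
  then show ?thesis using False assms by (simp add: card_level_Suc)
qed

lemma space_height_space: "space (height_space d) = verts d \<rightarrow>\<^sub>E UNIV"
  by (simp add: height_space_def space_PiM)

lemma height_space_component [measurable]:
  "v \<in> verts d \<Longrightarrow> (\<lambda>\<omega>. \<omega> v) \<in> height_space d \<rightarrow>\<^sub>M count_space UNIV"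
  unfolding height_space_def by (rule measurable_component_singleton)

lemma sphere_average_measurable [measurable]: "sphere_average d r \<in> borel_measurable (height_space d)"
proof -
  have [measurable]: "(\<lambda>\<omega>. real_of_int (\<omega> v)) \<in> borel_measurable (height_space d)"
    if "v \<in> level d r" for v
    using that by (intro measurable_compose[OF height_space_component]) (auto simp: level_def)
  show ?thesis unfolding sphere_average_def sphere_verts_eq_level by measurable
qed

lemma limit_average_measurable [measurable]: "limit_average d \<in> borel_measurable (height_space d)"
  unfolding limit_average_eq_limsup[abs_def] by measurable

lemma sphere_average_shift:
  assumes "d \<ge> 2"
  shows "sphere_average d r (height_shift d a \<omega>) = sphere_average d r \<omega> - real_of_int a"
proof -
  have "(\<Sum>v\<in>level d r. real_of_int (height_shift d a \<omega> v)) = (\<Sum>v\<in>level d r. real_of_int (\<omega> v) - real_of_int a)"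
    by (intro sum.cong) (auto simp: height_shift_def level_def)
  then show ?thesis using card_level_pos[OF assms, of r] unfolding card_gt_0_iff
    by (simp add: sphere_average_def sphere_verts_eq_level sum_subtractf diff_divide_distrib)
qed

text \<open>Stated for the limsup in the extended reals so that shift identities for
  \<open>limit_average\<close> hold for every configuration, without any convergence.\<close>

lemma limsup_add_const:
  fixes x :: "nat \<Rightarrow> real"
  assumes "\<forall>\<^sub>F r in sequentially. y r = x r + c"
  shows "limsup (\<lambda>r. ereal (y r)) = limsup (\<lambda>r. ereal (x r)) + ereal c"
proof -
  have "limsup (\<lambda>r. ereal (y r)) = limsup (\<lambda>r. ereal c + ereal (x r))"
    by (rule Limsup_eq) (use assms in eventually_elim, simp add: add.commute)
  also have "\<dots> = ereal c + limsup (\<lambda>r. ereal (x r))"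
    by (rule ereal_limsup_lim_add) auto
  finally show ?thesis by (simp add: add.commute)
qed

lemma limit_average_shift:
  assumes "d \<ge> 2"
  shows "limit_average d (height_shift d a \<omega>) = limit_average d \<omega> - ereal (real_of_int a)"
  using limsup_add_const[of "\<lambda>r. sphere_average d r (height_shift d a \<omega>)" "\<lambda>r. sphere_average d r \<omega>" "- real_of_int a"]
  unfolding limit_average_eq_limsup
  by (simp add: sphere_average_shift[OF assms] minus_ereal_def)

section \<open>The free state and the heights as images of the independent increments\<close>

context tree_gradient
begin

lemma increments_measurable [measurable]: "increments \<in> noise \<rightarrow>\<^sub>M gradient_space d"
  unfolding gradient_space_def
proof (rule measurable_restrict_space2)
  have out: "(v, u) \<in> outward_arcs d" if "(u, v) \<in> arcs d" "(u, v) \<notin> outward_arcs d" for u v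
    using that by (auto simp: outward_arcs_eq nonroot_def arcs_iff image_iff)
  have excl: "(v, u) \<notin> outward_arcs d" if "(u, v) \<in> outward_arcs d" for u v
    using that by (auto simp: outward_arcs_def)
  show "increments \<in> space noise \<rightarrow> {\<zeta>. \<forall>(u, v)\<in>arcs d. \<zeta> (u, v) = - \<zeta> (v, u)}"
  proof (rule funcsetI, rule CollectI, safe)
    fix \<xi> u v assume uv: "(u, v) \<in> arcs d"
    show "increments \<xi> (u, v) = - increments \<xi> (v, u)"
      using uv arcs_sym[OF uv] out[OF uv] excl[of u v]
      by (cases "(u, v) \<in> outward_arcs d") (auto simp: increments_def)
  qed
  show "increments \<in> noise \<rightarrow>\<^sub>M PiM (arcs d) (\<lambda>_. count_space UNIV)"
    unfolding increments_def[abs_def]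
  proof (rule measurable_restrict)
    fix b assume b: "b \<in> arcs d"
    show "(\<lambda>\<xi>. if b \<in> outward_arcs d then \<xi> (snd b) else - \<xi> (fst b)) \<in> noise \<rightarrow>\<^sub>M count_space UNIV"
    proof (cases "b \<in> outward_arcs d")
      case True
      then have "snd b \<in> nonroot d" by (auto simp: outward_arcs_eq)
      then show ?thesis using True by simp
    next
      case False
      then have "fst b \<in> nonroot d" using out[of "fst b" "snd b"] b by (auto simp: outward_arcs_eq)
      then have "(\<lambda>\<xi>. - \<xi> (fst b)) \<in> noise \<rightarrow>\<^sub>M count_space UNIV"
        by (intro measurable_compose[OF noise_component]) auto
      then show ?thesis using False by simp
    qed
  qed
qed

text \<open>An outward arc is determined by its endpoint, so the product over outward arcs is a
  reindexing of the product over vertices other than the root.\<close>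

lemma free_state_eq: "free_state d Q = distr noise (gradient_space d) increments"
proof -
  let ?O = "PiM (outward_arcs d) (\<lambda>_. q)"
  let ?r = "\<lambda>\<xi>. \<lambda>e\<in>outward_arcs d. \<xi> (snd e)"
  let ?g = "\<lambda>\<xi>::gradient_config. \<lambda>b\<in>arcs d. if b \<in> outward_arcs d then \<xi> b else - \<xi> (snd b, fst b)"
  have out: "(v, u) \<in> outward_arcs d" if "(u, v) \<in> arcs d" "(u, v) \<notin> outward_arcs d" for u v
    using that by (auto simp: outward_arcs_eq nonroot_def arcs_iff image_iff)
  have excl: "(v, u) \<notin> outward_arcs d" if "(u, v) \<in> outward_arcs d" for u v
    using that by (auto simp: outward_arcs_def)
  have O: "?O = distr noise ?O ?r"
    unfolding noise_def
    by (rule distr_PiM_reindex[OF prob_space_q, symmetric])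
      (auto simp: inj_on_def outward_arcs_eq)
  have comp: "(\<lambda>\<xi>. \<xi> e) \<in> ?O \<rightarrow>\<^sub>M count_space UNIV" if "e \<in> outward_arcs d" for e
    using measurable_component_singleton[OF that, of "\<lambda>_. q"]
      measurable_cong_sets[OF refl, of q "count_space UNIV" ?O] by simp
  have r: "?r \<in> noise \<rightarrow>\<^sub>M ?O"
    unfolding noise_def
    by (intro measurable_restrict measurable_component_singleton) (auto simp: outward_arcs_eq)
  have g: "?g \<in> ?O \<rightarrow>\<^sub>M gradient_space d"
    unfolding gradient_space_def
  proof (rule measurable_restrict_space2)
    show "?g \<in> space ?O \<rightarrow> {\<zeta>. \<forall>(u, v)\<in>arcs d. \<zeta> (u, v) = - \<zeta> (v, u)}"
    proof (rule funcsetI, rule CollectI, safe)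
      fix \<xi> u v assume uv: "(u, v) \<in> arcs d"
      show "?g \<xi> (u, v) = - ?g \<xi> (v, u)"
        using uv arcs_sym[OF uv] out[OF uv] excl[of u v]
        by (cases "(u, v) \<in> outward_arcs d") auto
    qed
    show "?g \<in> ?O \<rightarrow>\<^sub>M PiM (arcs d) (\<lambda>_. count_space UNIV)"
    proof (rule measurable_restrict)
      fix b assume b: "b \<in> arcs d"
      show "(\<lambda>\<xi>. if b \<in> outward_arcs d then \<xi> b else - \<xi> (snd b, fst b)) \<in> ?O \<rightarrow>\<^sub>M count_space UNIV"
      proof (cases "b \<in> outward_arcs d")
        case True
        then show ?thesis using comp by simp
      next
        case False
        then have "(snd b, fst b) \<in> outward_arcs d" using out[of "fst b" "snd b"] b by auto
        then have "(\<lambda>\<xi>. - \<xi> (snd b, fst b)) \<in> ?O \<rightarrow>\<^sub>M count_space UNIV"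
          by (intro measurable_compose[OF comp]) auto
        then show ?thesis using False by simp
      qed
    qed
  qed
  have "?g (?r \<xi>) = increments \<xi>" for \<xi>
    using out by (auto simp: increments_def restrict_def fun_eq_iff)
  then have "?g \<circ> ?r = increments" by auto
  then have "distr noise (gradient_space d) increments = distr (distr noise ?O ?r) (gradient_space d) ?g"
    using distr_distr[OF g r] by simp
  also have "\<dots> = free_state d Q"
    by (simp only: O[symmetric] free_state_def)
  finally show ?thesis ..
qed

sublocale free: prob_space "free_state d Q"
  unfolding free_state_eq by (rule noise.prob_space_distr) measurable

lemma heights_from_increments: "heights_from d [] s (increments \<xi>) = heights s \<xi>"
proof -
  have "(\<Sum>b\<in>path_arcs d [] v. increments \<xi> b) = (\<Sum>n\<in>{1..length v}. \<xi> (take n v))"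
    if v: "v \<in> verts d" for v
  proof -
    have inj: "inj_on (\<lambda>n. (butlast (take n v), take n v)) {1..length v}"
      by (auto simp: inj_on_def) (metis length_take min.absorb2)
    have out: "(butlast (take n v), take n v) \<in> outward_arcs d" if "n \<in> {1..length v}" for n
      using that v by (auto simp: outward_arcs_eq nonroot_def take_in_verts)
    then have "increments \<xi> (butlast (take n v), take n v) = \<xi> (take n v)" if "n \<in> {1..length v}" for n
      using that[THEN out] by (auto simp: increments_def outward_arcs_def)
    then show ?thesis
      unfolding path_arcs_root[OF v] by (subst sum.reindex[OF inj]) (auto intro!: sum.cong)
  qed
  then show ?thesis by (auto simp: heights_from_def heights_def intro!: restrict_ext)
qed

lemma heights_from_measurable [measurable]: "heights_from d [] s \<in> gradient_space d \<rightarrow>\<^sub>M height_space d"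
  unfolding heights_from_def[abs_def] height_space_def
proof (rule measurable_restrict)
  fix v assume v: "v \<in> verts d"
  have "path_arcs d [] v \<subseteq> arcs d"
    unfolding path_arcs_root[OF v] using v
    by (auto simp: arcs_iff take_in_verts butlast_in_verts)
  then have *: "(\<lambda>\<zeta>. \<zeta> b) \<in> gradient_space d \<rightarrow>\<^sub>M count_space UNIV" if "b \<in> path_arcs d [] v" for b
    unfolding gradient_space_def
    by (intro measurable_restrict_space1 measurable_component_singleton) (use that in auto)
  have "(\<lambda>\<zeta>. \<Sum>b\<in>F. \<zeta> b) \<in> gradient_space d \<rightarrow>\<^sub>M count_space UNIV"
    if "finite F" "F \<subseteq> path_arcs d [] v" for F
    using that
  proof (induction F rule: finite_induct)
    case (insert b F)
    then show ?case
      using measurable_count_space_binary[of "\<lambda>\<zeta>. \<zeta> b" "gradient_space d" "\<lambda>\<zeta>. \<Sum>b\<in>F. \<zeta> b" "(+)" "count_space UNIV"] * by simp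
  qed simp
  then have "(\<lambda>\<zeta>. \<Sum>b\<in>path_arcs d [] v. \<zeta> b) \<in> gradient_space d \<rightarrow>\<^sub>M count_space UNIV"
    unfolding path_arcs_root[OF v] by auto
  then show "(\<lambda>\<zeta>. s + (\<Sum>b\<in>path_arcs d [] v. \<zeta> b)) \<in> gradient_space d \<rightarrow>\<^sub>M count_space UNIV"
    by (rule measurable_compose[where g="\<lambda>x. s + x"]) simp
qed

lemma heights_measurable [measurable]: "heights s \<in> noise \<rightarrow>\<^sub>M height_space d"
  using measurable_compose[OF increments_measurable heights_from_measurable, of s]
  by (simp add: heights_from_increments)

lemma heights_in_space [simp]: "heights s \<xi> \<in> space (height_space d)"
  by (simp add: heights_def space_height_space)

lemma heights_root [simp]: "heights s \<xi> [] = s"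
  by (simp add: heights_def)

lemma heights_step:
  assumes "v \<in> nonroot d" shows "heights s \<xi> v = heights s \<xi> (butlast v) + \<xi> v"
proof -
  have v: "v \<in> verts d" "v \<noteq> []" using assms by (auto simp: nonroot_def)
  then obtain n where n: "length v = Suc n" by (cases v) auto
  have "(\<Sum>i\<in>{1..n}. \<xi> (take i (butlast v))) = (\<Sum>i\<in>{1..n}. \<xi> (take i v))"
    using n by (intro sum.cong) (auto simp: butlast_conv_take min_def)
  then show ?thesis using v n by (simp add: heights_def butlast_in_verts)
qed

lemma heights_shift: "heights (s - a) \<xi> = height_shift d a (heights s \<xi>)"
  by (auto simp: heights_def height_shift_def)

lemma AE_free_state_heights:
  assumes "{\<omega> \<in> space (height_space d). P \<omega>} \<in> sets (height_space d)"
  shows "(AE \<zeta> in free_state d Q. P (heights_from d [] s \<zeta>)) \<longleftrightarrow> (AE \<xi> in noise. P (heights s \<xi>))"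
proof -
  have "{\<zeta> \<in> space (gradient_space d). P (heights_from d [] s \<zeta>)} \<in> sets (gradient_space d)"
    using measurable_sets[OF heights_from_measurable assms, of s] measurable_space[OF heights_from_measurable, of _ s]
    by (auto simp: vimage_def Int_def elim!: back_subst[of "\<lambda>A. A \<in> _"])
  then show ?thesis
    unfolding free_state_eq by (subst AE_distr_iff) (auto simp: heights_from_increments)
qed

subsection \<open>Sums over levels\<close>

text \<open>The set \<open>D\<close> says which increments are kept, while the denominator remains
  the size of the full level; deleting increments from the total sum therefore amounts to shrinking
  \<open>D\<close>.\<close>

definition level_average :: "nat list set \<Rightarrow> nat \<Rightarrow> height_config \<Rightarrow> real" where
  "level_average D n \<xi> = (\<Sum>v\<in>level d n \<inter> D. real_of_int (\<xi> v)) / real (card (level d n))"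

definition level_sum :: "nat list set \<Rightarrow> height_config \<Rightarrow> real" where
  "level_sum D \<xi> = (\<Sum>n. level_average D n \<xi>)"

lemma noise_component_real [measurable]:
  "v \<in> nonroot d \<Longrightarrow> (\<lambda>\<xi>. real_of_int (\<xi> v)) \<in> borel_measurable noise"
  by (rule measurable_compose[OF noise_component]) auto

lemma level_average_measurable [measurable]:
  "D \<subseteq> nonroot d \<Longrightarrow> level_average D n \<in> borel_measurable noise"
  unfolding level_average_def[abs_def]
  by (intro borel_measurable_divide borel_measurable_sum noise_component_real) auto

lemma level_sum_measurable [measurable]: "D \<subseteq> nonroot d \<Longrightarrow> level_sum D \<in> borel_measurable noise"
  unfolding level_sum_def[abs_def] by measurable

text \<open>Each height is the height of the parent plus one increment, and passing to the children
  preserves averages; hence consecutive sphere averages differ exactly by a level average.\<close>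

lemma sphere_average_heights:
  "sphere_average d r (heights s \<xi>) = real_of_int s + (\<Sum>n\<le>r. level_average (nonroot d) n \<xi>)"
proof (induction r)
  case 0
  then show ?case
    by (simp add: sphere_average_def sphere_verts_eq_level level_0 level_average_def nonroot_def)
next
  case (Suc r)
  have lev: "level d (Suc r) \<subseteq> nonroot d" by (auto simp: level_def nonroot_def)
  have "(\<Sum>v\<in>level d (Suc r). real_of_int (heights s \<xi> v)) =
      (\<Sum>v\<in>level d (Suc r). real_of_int (heights s \<xi> (butlast v))) + (\<Sum>v\<in>level d (Suc r). real_of_int (\<xi> v))"
    unfolding sum.distrib[symmetric] using lev by (intro sum.cong) (auto simp: heights_step)
  then have "sphere_average d (Suc r) (heights s \<xi>) =
      sphere_average d r (heights s \<xi>) + level_average (nonroot d) (Suc r) \<xi>"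
    using sum_level_butlast[OF d_ge_2, where F="\<lambda>v. real_of_int (heights s \<xi> v)" and n=r] lev
    by (simp add: sphere_average_def sphere_verts_eq_level level_average_def add_divide_distrib Int_absorb2)
  then show ?case using Suc by simp
qed

text \<open>Adding the reflected copy of the integral cancels the cross term pointwise, so that only
  nonnegative integrals occur. Halving the resulting identity requires excluding an infinite value
  first.\<close>

lemma nn_integral_q_square_add:
  "(\<integral>\<^sup>+j. ennreal ((real_of_int j + a)\<^sup>2) \<partial>q) = ennreal (variance + a\<^sup>2)"
proof -
  let ?I = "\<integral>\<^sup>+j. ennreal ((real_of_int j + a)\<^sup>2) \<partial>q"
  have "?I + ?I = ?I + (\<integral>\<^sup>+j. ennreal ((real_of_int (- j) + a)\<^sup>2) \<partial>q)"
    by (subst (2) nn_integral_q_uminus[symmetric]) simp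
  also have "\<dots> = (\<integral>\<^sup>+j. ennreal ((real_of_int j + a)\<^sup>2) + ennreal ((real_of_int (- j) + a)\<^sup>2) \<partial>q)"
    by (rule nn_integral_add[symmetric]) auto
  also have "\<dots> = (\<integral>\<^sup>+j. 2 * ennreal ((real_of_int j)\<^sup>2) + ennreal (2 * a\<^sup>2) \<partial>q)"
  proof (rule nn_integral_cong)
    fix j :: int
    have "(real_of_int j + a)\<^sup>2 + (real_of_int (- j) + a)\<^sup>2 = 2 * (real_of_int j)\<^sup>2 + 2 * a\<^sup>2"
      by (simp add: power2_eq_square algebra_simps)
    then have "ennreal ((real_of_int j + a)\<^sup>2) + ennreal ((real_of_int (- j) + a)\<^sup>2) =
        ennreal (2 * (real_of_int j)\<^sup>2 + 2 * a\<^sup>2)"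
      by (subst ennreal_plus[symmetric]) auto
    then show "ennreal ((real_of_int j + a)\<^sup>2) + ennreal ((real_of_int (- j) + a)\<^sup>2) =
        2 * ennreal ((real_of_int j)\<^sup>2) + ennreal (2 * a\<^sup>2)"
      by (simp add: ennreal_mult)
  qed
  also have "\<dots> = 2 * ennreal variance + ennreal (2 * a\<^sup>2)"
    by (subst nn_integral_add, simp, simp, subst nn_integral_cmult)
      (auto simp: nn_integral_q_square q.emeasure_space_1[simplified])
  also have "\<dots> = ennreal (2 * (variance + a\<^sup>2))"
    using variance_nonneg by (simp add: ennreal_mult ring_distribs)
  finally have *: "?I + ?I = ennreal (2 * (variance + a\<^sup>2))" .
  show ?thesis
  proof (cases ?I rule: ennreal_cases)
    case (real r)
    have "ennreal (r + r) = ennreal r + ennreal r" using real(1) by (rule ennreal_plus[OF _ real(1)])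
    also have "\<dots> = ennreal (2 * (variance + a\<^sup>2))" using * by (simp only: real(2))
    finally have "ennreal (r + r) = ennreal (2 * (variance + a\<^sup>2))" .
    then have "r + r = 2 * (variance + a\<^sup>2)"
      using real(1) variance_nonneg by (subst (asm) ennreal_inj) auto
    then show ?thesis using real by simp
  next
    case top
    then have False using * by simp
    then show ?thesis ..
  qed
qed

lemma nn_integral_sum_square:
  assumes "finite F" "F \<subseteq> nonroot d"
  shows "(\<integral>\<^sup>+\<xi>. ennreal ((\<Sum>v\<in>F. real_of_int (\<xi> v))\<^sup>2) \<partial>noise) = ennreal (real (card F) * variance)"
  using assms
proof (induction F rule: finite_induct)
  case (insert v F)
  let ?S = "\<lambda>\<xi>. \<Sum>v\<in>F. real_of_int (\<xi> v)"
  have v: "v \<in> nonroot d" and F: "F \<subseteq> nonroot d" using insert by auto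
  have [measurable]: "?S \<in> borel_measurable noise"
    using F by (intro borel_measurable_sum noise_component_real) auto
  have "(\<integral>\<^sup>+\<xi>. ennreal ((\<Sum>v\<in>insert v F. real_of_int (\<xi> v))\<^sup>2) \<partial>noise) =
      (\<integral>\<^sup>+\<xi>. ennreal ((real_of_int (\<xi> v) + ?S \<xi>)\<^sup>2) \<partial>noise)"
    using insert.hyps by simp
  also have "\<dots> = (\<integral>\<^sup>+\<xi>. (\<integral>\<^sup>+j. ennreal ((real_of_int ((\<xi>(v := j)) v) + ?S (\<xi>(v := j)))\<^sup>2) \<partial>q) \<partial>noise)"
    using v by (intro nn_integral_resample) measurable
  also have "\<dots> = (\<integral>\<^sup>+\<xi>. (\<integral>\<^sup>+j. ennreal ((real_of_int j + ?S \<xi>)\<^sup>2) \<partial>q) \<partial>noise)"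
  proof -
    have "?S (\<xi>(v := j)) = ?S \<xi>" for \<xi> j using insert.hyps by (intro sum.cong) auto
    then show ?thesis by simp
  qed
  also have "\<dots> = (\<integral>\<^sup>+\<xi>. ennreal variance + ennreal ((?S \<xi>)\<^sup>2) \<partial>noise)"
    using variance_nonneg by (simp add: nn_integral_q_square_add)
  also have "\<dots> = ennreal variance + ennreal (real (card F) * variance)"
    using insert.IH[OF F] by (subst nn_integral_add) (auto simp: noise.emeasure_space_1)
  also have "\<dots> = ennreal (real (card (insert v F)) * variance)"
    using insert.hyps variance_nonneg by (simp add: ring_distribs)
  finally show ?case .
qed simp

text \<open>At most N increments, each weighted by 1 / N, have total variance at most
  \<open>variance\<close> / N, and N is at least 2^n.\<close>

lemma nn_integral_level_average_square:
  assumes "D \<subseteq> nonroot d"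
  shows "(\<integral>\<^sup>+\<xi>. ennreal ((level_average D n \<xi>)\<^sup>2) \<partial>noise) \<le> ennreal (variance / 2 ^ n)"
proof -
  let ?N = "real (card (level d n))"
  have N: "?N \<ge> 2 ^ n" by (rule card_level_ge[OF d_ge_2])
  then have Npos: "?N > 0" by (meson less_le_trans zero_less_numeral zero_less_power)
  have "(\<integral>\<^sup>+\<xi>. ennreal ((level_average D n \<xi>)\<^sup>2) \<partial>noise) =
      (\<integral>\<^sup>+\<xi>. ennreal (1 / ?N\<^sup>2) * ennreal ((\<Sum>v\<in>level d n \<inter> D. real_of_int (\<xi> v))\<^sup>2) \<partial>noise)"
    by (intro nn_integral_cong) (simp add: level_average_def power_divide ennreal_mult[symmetric])
  also have "\<dots> = ennreal (1 / ?N\<^sup>2) * ennreal (real (card (level d n \<inter> D)) * variance)"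
    using assms
    by (subst nn_integral_cmult, intro measurable_compose[OF _ measurable_ennreal] borel_measurable_power borel_measurable_sum noise_component_real)
      (auto simp: nn_integral_sum_square le_infI2)
  also have "\<dots> = ennreal (real (card (level d n \<inter> D)) * variance / ?N\<^sup>2)"
    using variance_nonneg by (subst ennreal_mult[symmetric]) auto
  also have "\<dots> \<le> ennreal (variance / 2 ^ n)"
  proof (rule ennreal_leI)
    have "real (card (level d n \<inter> D)) \<le> ?N" by (simp add: card_mono)
    then have "real (card (level d n \<inter> D)) * variance / ?N\<^sup>2 \<le> ?N * variance / ?N\<^sup>2"
      using variance_nonneg by (intro divide_right_mono mult_right_mono) auto
    also have "\<dots> = variance / ?N" using Npos by (simp add: power2_eq_square)
    also have "\<dots> \<le> variance / 2 ^ n" using N Npos variance_nonneg by (intro divide_left_mono) auto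
    finally show "real (card (level d n \<inter> D)) * variance / ?N\<^sup>2 \<le> variance / 2 ^ n" .
  qed
  finally show ?thesis .
qed

text \<open>The weights \<open>(4/3)\<^sup>n\<close> grow slower than the variances decay, but fast enough that
  finiteness of the weighted sum of squares forces absolute convergence.\<close>

definition energy :: "nat list set \<Rightarrow> height_config \<Rightarrow> ennreal" where
  "energy D \<xi> = (\<Sum>n. ennreal ((4/3) ^ n * (level_average D n \<xi>)\<^sup>2))"

lemma energy_measurable [measurable]: "D \<subseteq> nonroot d \<Longrightarrow> energy D \<in> borel_measurable noise"
  unfolding energy_def[abs_def] by measurable

text \<open>The weights (4/3)^n against variances of order 2^(-n) leave a geometric series with
  ratio 2/3, whose sum is the factor 3.\<close>

lemma nn_integral_energy:
  assumes D: "D \<subseteq> nonroot d"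
  shows "(\<integral>\<^sup>+\<xi>. energy D \<xi> \<partial>noise) \<le> ennreal (3 * variance)"
proof -
  note [measurable] = level_average_measurable[OF D]
  have "(\<integral>\<^sup>+\<xi>. energy D \<xi> \<partial>noise) = (\<Sum>n. \<integral>\<^sup>+\<xi>. ennreal ((4/3) ^ n * (level_average D n \<xi>)\<^sup>2) \<partial>noise)"
    unfolding energy_def by (rule nn_integral_suminf) measurable
  also have "\<dots> \<le> (\<Sum>n. ennreal (variance * (2/3) ^ n))"
  proof (intro suminf_le allI)
    fix n
    have "(\<integral>\<^sup>+\<xi>. ennreal ((4/3) ^ n * (level_average D n \<xi>)\<^sup>2) \<partial>noise) =
        ennreal ((4/3) ^ n) * (\<integral>\<^sup>+\<xi>. ennreal ((level_average D n \<xi>)\<^sup>2) \<partial>noise)"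
      by (subst nn_integral_cmult[symmetric]) (auto simp: ennreal_mult)
    also have "\<dots> \<le> ennreal ((4/3) ^ n) * ennreal (variance / 2 ^ n)"
      by (intro mult_left_mono nn_integral_level_average_square D) simp
    also have "\<dots> = ennreal (variance * (2/3) ^ n)"
      using variance_nonneg
      by (subst ennreal_mult[symmetric]) (auto simp: power_divide power_mult_distrib[symmetric] field_simps)
    finally show "(\<integral>\<^sup>+\<xi>. ennreal ((4/3) ^ n * (level_average D n \<xi>)\<^sup>2) \<partial>noise) \<le> ennreal (variance * (2/3) ^ n)" .
  qed auto
  also have "\<dots> = ennreal (3 * variance)"
  proof (rule suminf_ennreal_eq)
    show "(\<lambda>n. variance * (2/3) ^ n) sums (3 * variance)"
      using sums_mult[OF geometric_sums[of "2/3 :: real"], of variance] by (simp add: mult.commute)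
  qed (use variance_nonneg in auto)
  finally show ?thesis .
qed

lemma AE_energy_finite:
  assumes "D \<subseteq> nonroot d" shows "AE \<xi> in noise. energy D \<xi> < top"
proof -
  have "(\<integral>\<^sup>+\<xi>. energy D \<xi> \<partial>noise) \<noteq> \<infinity>"
    using nn_integral_energy[OF assms] by (auto simp: top_unique)
  then have "AE \<xi> in noise. energy D \<xi> \<noteq> \<infinity>"
    by (intro nn_integral_PInf_AE energy_measurable assms)
  then show ?thesis by (simp add: less_top)
qed

lemma energy_bound:
  assumes "energy D \<xi> < top"
  shows "summable (\<lambda>n. \<bar>level_average D n \<xi>\<bar>)"
    and "(\<Sum>n. \<bar>level_average D n \<xi>\<bar>) \<le> 8 * sqrt (enn2real (energy D \<xi>))"
proof -
  define b where "b = enn2real (energy D \<xi>)"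
  have b: "energy D \<xi> = ennreal b" "b \<ge> 0" using assms by (auto simp: b_def)
  define \<rho> :: real where "\<rho> = sqrt (3/4)"
  have \<rho>: "0 < \<rho>" "\<rho> < 1" "\<rho> ^ 2 = 3/4" by (auto simp: \<rho>_def)
  have bnd: "\<bar>level_average D n \<xi>\<bar> \<le> sqrt b * \<rho> ^ n" for n
  proof -
    have "(\<Sum>n\<in>{n}. ennreal ((4/3) ^ n * (level_average D n \<xi>)\<^sup>2)) \<le> energy D \<xi>"
      unfolding energy_def by (rule sum_le_suminf) auto
    then have "ennreal ((4/3) ^ n * (level_average D n \<xi>)\<^sup>2) \<le> energy D \<xi>" by simp
    then have "(4/3) ^ n * (level_average D n \<xi>)\<^sup>2 \<le> b" using b by simp
    then have "(level_average D n \<xi>)\<^sup>2 \<le> b * (3/4) ^ n"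
      by (simp add: power_divide field_simps)
    also have "\<dots> = (sqrt b * \<rho> ^ n)\<^sup>2"
    proof -
      have "(\<rho> ^ n)\<^sup>2 = (\<rho>\<^sup>2) ^ n" by (simp add: power_mult[symmetric] mult.commute)
      then show ?thesis using b \<rho>(3) by (simp add: power_mult_distrib)
    qed
    finally show ?thesis
      using b \<rho> by (metis abs_le_square_iff abs_of_nonneg mult_nonneg_nonneg less_imp_le real_sqrt_ge_zero zero_le_power)
  qed
  have s: "(\<lambda>n. sqrt b * \<rho> ^ n) sums (sqrt b * (1 / (1 - \<rho>)))"
    using \<rho> by (intro sums_mult geometric_sums) auto
  show sm: "summable (\<lambda>n. \<bar>level_average D n \<xi>\<bar>)"
    using bnd by (intro summable_comparison_test'[OF sums_summable[OF s]]) auto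
  \<comment> \<open>A rational upper bound for the square root of 3/4, because 3/4 is at most 49/64;
    it turns the geometric sum into the factor 8.\<close>
  have "\<rho> \<le> 7/8" unfolding \<rho>_def by (rule real_le_lsqrt) (auto simp: power2_eq_square)
  then have "1 / (1 - \<rho>) \<le> 8" using \<rho> by (simp add: field_simps)
  have "(\<Sum>n. \<bar>level_average D n \<xi>\<bar>) \<le> sqrt b * (1 / (1 - \<rho>))"
    using suminf_le[OF bnd sm sums_summable[OF s]] sums_unique[OF s] by simp
  also have "\<dots> \<le> sqrt b * 8" using \<open>1 / (1 - \<rho>) \<le> 8\<close> b by (intro mult_left_mono) auto
  finally show "(\<Sum>n. \<bar>level_average D n \<xi>\<bar>) \<le> 8 * sqrt (enn2real (energy D \<xi>))" by (simp add: b_def)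
qed

lemma level_average_sums:
  assumes "energy D \<xi> < top" shows "(\<lambda>n. level_average D n \<xi>) sums level_sum D \<xi>"
  unfolding level_sum_def by (rule summable_sums[OF summable_rabs_cancel[OF energy_bound(1)[OF assms]]])

text \<open>The bound does not depend on \<open>r\<close>, and the energy is integrable: this is the
  dominating function for convergence in mean square. The factor 64 is the square of 8.\<close>

lemma partial_sum_bound:
  assumes "energy D \<xi> < top"
  shows "(\<Sum>n\<le>r. level_average D n \<xi>)\<^sup>2 \<le> 64 * enn2real (energy D \<xi>)"
    and "(level_sum D \<xi>)\<^sup>2 \<le> 64 * enn2real (energy D \<xi>)"
proof -
  let ?b = "8 * sqrt (enn2real (energy D \<xi>))"
  note e = energy_bound[OF assms]
  have "\<bar>\<Sum>n\<le>r. level_average D n \<xi>\<bar> \<le> (\<Sum>n\<le>r. \<bar>level_average D n \<xi>\<bar>)" by (rule sum_abs)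
  also have "\<dots> \<le> (\<Sum>n. \<bar>level_average D n \<xi>\<bar>)" using e(1) by (intro sum_le_suminf) auto
  also note e(2)
  finally have "\<bar>\<Sum>n\<le>r. level_average D n \<xi>\<bar>\<^sup>2 \<le> ?b\<^sup>2" by (intro power_mono) auto
  then show "(\<Sum>n\<le>r. level_average D n \<xi>)\<^sup>2 \<le> 64 * enn2real (energy D \<xi>)"
    by (simp add: power_mult_distrib)
  have "\<bar>level_sum D \<xi>\<bar> \<le> ?b"
    unfolding level_sum_def using summable_rabs[OF e(1)] e(2) by simp
  then have "\<bar>level_sum D \<xi>\<bar>\<^sup>2 \<le> ?b\<^sup>2" by (intro power_mono) auto
  then show "(level_sum D \<xi>)\<^sup>2 \<le> 64 * enn2real (energy D \<xi>)"
    by (simp add: power_mult_distrib)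
qed

lemma energy_integrable:
  assumes "D \<subseteq> nonroot d"
  shows "integrable noise (\<lambda>\<xi>. enn2real (energy D \<xi>))"
    and "(\<integral>\<xi>. enn2real (energy D \<xi>) \<partial>noise) \<le> 3 * variance"
proof -
  note [measurable] = energy_measurable[OF assms]
  have "(\<integral>\<^sup>+\<xi>. ennreal (enn2real (energy D \<xi>)) \<partial>noise) = (\<integral>\<^sup>+\<xi>. energy D \<xi> \<partial>noise)"
    using AE_energy_finite[OF assms] by (intro nn_integral_cong_AE) auto
  then have *: "(\<integral>\<^sup>+\<xi>. ennreal (enn2real (energy D \<xi>)) \<partial>noise) \<le> ennreal (3 * variance)"
    using nn_integral_energy[OF assms] by simp
  show i: "integrable noise (\<lambda>\<xi>. enn2real (energy D \<xi>))"
    using le_less_trans[OF *] by (intro integrableI_nonneg) auto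
  show "(\<integral>\<xi>. enn2real (energy D \<xi>) \<partial>noise) \<le> 3 * variance"
    using * variance_nonneg by (subst (asm) nn_integral_eq_integral[OF i]) auto
qed

lemma limit_average_heights:
  assumes "energy (nonroot d) \<xi> < top"
  shows "(\<lambda>r. sphere_average d r (heights s \<xi>)) \<longlonglongrightarrow> real_of_int s + level_sum (nonroot d) \<xi>"
    and "limit_average d (heights s \<xi>) = ereal (real_of_int s + level_sum (nonroot d) \<xi>)"
proof -
  show 1: "(\<lambda>r. sphere_average d r (heights s \<xi>)) \<longlonglongrightarrow> real_of_int s + level_sum (nonroot d) \<xi>"
    unfolding sphere_average_heights
    using level_average_sums[OF assms] by (intro tendsto_add tendsto_const) (simp add: sums_def_le)
  then show "limit_average d (heights s \<xi>) = ereal (real_of_int s + level_sum (nonroot d) \<xi>)"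
    unfolding limit_average_eq_limsup by (intro lim_imp_Limsup) auto
qed

lemma AE_limit_average:
  "AE \<xi> in noise. \<forall>s. limit_average d (heights s \<xi>) = ereal (real_of_int s + level_sum (nonroot d) \<xi>)"
  using AE_energy_finite[OF order_refl] by eventually_elim (simp add: limit_average_heights)

end

section \<open>Coordinate algebras and tail measurability of the limiting average\<close>

lemma space_coord_algebra [simp]: "space (coord_algebra d \<Lambda>) = space (height_space d)"
  by (simp add: coord_algebra_def space_measure_of_conv)

lemma sets_coord_algebra:
  "sets (coord_algebra d \<Lambda>) =
    sigma_sets (space (height_space d)) {{\<omega> \<in> space (height_space d). \<omega> x \<in> A} | x A. x \<in> \<Lambda>}"
  unfolding coord_algebra_def by (rule sets_measure_of) auto

lemma coord_algebra_component: "x \<in> \<Lambda> \<Longrightarrow> (\<lambda>\<omega>. \<omega> x) \<in> coord_algebra d \<Lambda> \<rightarrow>\<^sub>M count_space UNIV"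
proof (rule measurableI)
  fix A assume "x \<in> \<Lambda>"
  then have "{\<omega> \<in> space (height_space d). \<omega> x \<in> A} \<in> sets (coord_algebra d \<Lambda>)"
    unfolding sets_coord_algebra by (intro sigma_sets.Basic) auto
  then show "(\<lambda>\<omega>. \<omega> x) -` A \<inter> space (coord_algebra d \<Lambda>) \<in> sets (coord_algebra d \<Lambda>)"
    by (auto simp: vimage_def Int_def conj_commute elim!: back_subst[of "\<lambda>A. A \<in> _"])
qed auto

lemma sets_coord_algebra_subset:
  "\<Lambda> \<subseteq> verts d \<Longrightarrow> sets (coord_algebra d \<Lambda>) \<subseteq> sets (height_space d)"
  unfolding sets_coord_algebra
proof (rule sets.sigma_sets_subset, safe)
  fix x A assume "\<Lambda> \<subseteq> verts d" "x \<in> \<Lambda>"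
  then have "(\<lambda>\<omega>. \<omega> x) \<in> height_space d \<rightarrow>\<^sub>M count_space UNIV" by auto
  from measurable_sets[OF this, of A]
  show "{\<omega> \<in> space (height_space d). \<omega> x \<in> A} \<in> sets (height_space d)"
    by (auto simp: vimage_def Int_def conj_commute elim!: back_subst[of "\<lambda>A. A \<in> _"])
qed

lemma sphere_average_tail_measurable:
  assumes "level d r \<inter> \<Lambda> = {}"
  shows "sphere_average d r \<in> borel_measurable (coord_algebra d (verts d - \<Lambda>))"
proof -
  have "(\<lambda>\<omega>. real_of_int (\<omega> v)) \<in> borel_measurable (coord_algebra d (verts d - \<Lambda>))"
    if "v \<in> level d r" for v
    using that assms
    by (intro measurable_compose[OF coord_algebra_component]) (auto simp: level_def)
  then show ?thesis unfolding sphere_average_def[abs_def] sphere_verts_eq_level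
    by (intro borel_measurable_divide borel_measurable_sum) auto
qed

lemma finite_subset_levels:
  assumes "finite \<Lambda>"
  obtains N where "\<And>r. level d (r + N) \<inter> \<Lambda> = {}"
proof
  fix r
  have "length v < Suc (Max (length ` \<Lambda>))" if "v \<in> \<Lambda>" for v
    using assms that by (intro le_imp_less_Suc Max_ge) auto
  then show "level d (r + Suc (Max (length ` \<Lambda>))) \<inter> \<Lambda> = {}"
    by (force simp: level_def)
qed

text \<open>A limsup may start at any index, and beyond some level the spheres avoid a given finite
  set, so the limiting average does not look at the coordinates in that set.\<close>

lemma limit_average_tail_measurable: "limit_average d \<in> borel_measurable (tail_algebra d)"
proof (rule measurableI)
  let ?S = "\<Inter>\<Lambda>\<in>{\<Lambda>. finite \<Lambda> \<and> \<Lambda> \<subseteq> verts d}. sets (coord_algebra d (verts d - \<Lambda>))"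
  have "?S \<subseteq> sets (coord_algebra d (verts d - {}))" by blast
  also have "\<dots> \<subseteq> Pow (space (height_space d))"
    using sets.space_closed[of "coord_algebra d (verts d - {})"] by simp
  finally have sub: "?S \<subseteq> Pow (space (height_space d))" .
  then have sets: "sets (tail_algebra d) = sigma_sets (space (height_space d)) ?S"
    unfolding tail_algebra_def by (rule sets_measure_of)
  have sp: "space (tail_algebra d) = space (height_space d)"
    by (simp add: tail_algebra_def space_measure_of_conv)
  fix A :: "ereal set" assume A: "A \<in> sets borel"
  have "limit_average d -` A \<inter> space (height_space d) \<in> sets (coord_algebra d (verts d - \<Lambda>))"
    if "finite \<Lambda>" for \<Lambda>
  proof -
    obtain N where N: "\<And>r. level d (r + N) \<inter> \<Lambda> = {}"
      by (rule finite_subset_levels[OF \<open>finite \<Lambda>\<close>]) blast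
    have [measurable]: "sphere_average d (r + N) \<in> borel_measurable (coord_algebra d (verts d - \<Lambda>))" for r
      by (rule sphere_average_tail_measurable[OF N])
    have "limit_average d = (\<lambda>\<omega>. limsup (\<lambda>r. ereal (sphere_average d (r + N) \<omega>)))"
      unfolding limit_average_eq_limsup[abs_def]
      by (intro ext limsup_shift_k[symmetric])
    also have "\<dots> \<in> borel_measurable (coord_algebra d (verts d - \<Lambda>))" by measurable
    finally have "limit_average d \<in> borel_measurable (coord_algebra d (verts d - \<Lambda>))" .
    from measurable_sets[OF this A] show ?thesis by simp
  qed
  then show "limit_average d -` A \<inter> space (tail_algebra d) \<in> sets (tail_algebra d)"
    unfolding sets sp by (intro sigma_sets.Basic) auto
qed auto

section \<open>Almost sure and mean-square convergence, and the height-offset property\<close>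

context tree_gradient
begin

lemma distr_heights_from:
  "distr (free_state d Q) (height_space d) (heights_from d [] s) = distr noise (height_space d) (heights s)"
  unfolding free_state_eq
  by (subst distr_distr) (auto simp: o_def heights_from_increments)

lemma AE_distr_heights_limit:
  "AE \<omega> in distr noise (height_space d) (heights 0). \<bar>limit_average d \<omega>\<bar> \<noteq> \<infinity> \<and>
     (\<lambda>r. sphere_average d r \<omega>) \<longlonglongrightarrow> real_of_ereal (limit_average d \<omega>)"
proof -
  \<comment> \<open>Convergence is rephrased as equality of the liminf with the limsup. This is
    visibly a measurable event, as the transfer along the image measure requires.\<close>
  let ?P = "\<lambda>\<omega>. \<bar>limit_average d \<omega>\<bar> \<noteq> \<infinity> \<and>
    liminf (\<lambda>r. ereal (sphere_average d r \<omega>)) = limit_average d \<omega>"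
  have "AE \<xi> in noise. ?P (heights 0 \<xi>)"
    using AE_energy_finite[OF order_refl]
  proof eventually_elim
    case (elim \<xi>)
    note l = limit_average_heights[OF elim, of 0]
    have "liminf (\<lambda>r. ereal (sphere_average d r (heights 0 \<xi>))) = ereal (real_of_int 0 + level_sum (nonroot d) \<xi>)"
      using l(1) by (intro lim_imp_Liminf) auto
    then show ?case using l(2) by simp
  qed
  moreover have "{\<omega> \<in> space (height_space d). ?P \<omega>} \<in> sets (height_space d)"
  proof -
    have "?P \<omega> \<longleftrightarrow> (limit_average d \<omega> < \<infinity> \<and> - \<infinity> < limit_average d \<omega>) \<and>
        liminf (\<lambda>r. ereal (sphere_average d r \<omega>)) \<le> limit_average d \<omega> \<and>
        limit_average d \<omega> \<le> liminf (\<lambda>r. ereal (sphere_average d r \<omega>))" for \<omega>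
      by (cases "limit_average d \<omega>") auto
    moreover have [measurable]: "(\<lambda>\<omega>. liminf (\<lambda>r. ereal (sphere_average d r \<omega>))) \<in> borel_measurable (height_space d)"
      by measurable
    then have [measurable]:
      "Measurable.pred (height_space d) (\<lambda>\<omega>. liminf (\<lambda>r. ereal (sphere_average d r \<omega>)) \<le> limit_average d \<omega>)"
      "Measurable.pred (height_space d) (\<lambda>\<omega>. limit_average d \<omega> \<le> liminf (\<lambda>r. ereal (sphere_average d r \<omega>)))"
      unfolding pred_def by (intro borel_measurable_le limit_average_measurable; assumption)+
    ultimately show ?thesis by (simp only:) measurable
  qed
  ultimately have "AE \<omega> in distr noise (height_space d) (heights 0). ?P \<omega>"
    by (subst AE_distr_iff) auto
  then show ?thesis
  proof eventually_elim
    case (elim \<omega>)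
    then obtain l where l: "limit_average d \<omega> = ereal l" by (cases "limit_average d \<omega>") auto
    then have "(\<lambda>r. ereal (sphere_average d r \<omega>)) \<longlonglongrightarrow> ereal l"
      using elim by (intro Liminf_eq_Limsup) (auto simp: limit_average_eq_limsup)
    then show ?case using l by simp
  qed
qed

lemma L2_limit_average:
  "tendsto_L2 (distr noise (height_space d) (heights 0)) (sphere_average d)
     (\<lambda>\<omega>. real_of_ereal (limit_average d \<omega>))"
proof -
  let ?e = "\<lambda>\<xi>. 64 * enn2real (energy (nonroot d) \<xi>)"
  let ?L = "\<lambda>\<xi>. real_of_ereal (limit_average d (heights 0 \<xi>))"
  let ?S = "\<lambda>r \<xi>. sphere_average d r (heights 0 \<xi>)"
  have e: "integrable noise ?e" using energy_integrable(1)[OF order_refl] by simp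
  have meas [measurable]: "?S r \<in> borel_measurable noise" "?L \<in> borel_measurable noise" for r
    by measurable
  have bound: "AE \<xi> in noise. (?L \<xi>)\<^sup>2 \<le> ?e \<xi> \<and> (\<forall>r. (?S r \<xi>)\<^sup>2 \<le> ?e \<xi>) \<and> (\<lambda>r. ?S r \<xi>) \<longlonglongrightarrow> ?L \<xi>"
    using AE_energy_finite[OF order_refl]
  proof eventually_elim
    case (elim \<xi>)
    show ?case
      using limit_average_heights[OF elim, of 0] partial_sum_bound[OF elim]
      by (simp add: sphere_average_heights)
  qed
  have "(\<lambda>r. \<integral>\<xi>. (?S r \<xi> - ?L \<xi>)\<^sup>2 \<partial>noise) \<longlonglongrightarrow> (\<integral>\<xi>. 0 \<partial>noise)"
  proof (rule integral_dominated_convergence)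
    show "integrable noise (\<lambda>\<xi>. 4 * ?e \<xi>)" using e by simp
    show "AE \<xi> in noise. (\<lambda>r. (?S r \<xi> - ?L \<xi>)\<^sup>2) \<longlonglongrightarrow> 0"
      using bound
    proof eventually_elim
      case (elim \<xi>)
      then have "(\<lambda>r. (?S r \<xi> - ?L \<xi>)\<^sup>2) \<longlonglongrightarrow> (?L \<xi> - ?L \<xi>)\<^sup>2" by (intro tendsto_intros) auto
      then show ?case by simp
    qed
    show "AE \<xi> in noise. norm ((?S r \<xi> - ?L \<xi>)\<^sup>2) \<le> 4 * ?e \<xi>" for r
      using bound
    proof eventually_elim
      case (elim \<xi>)
      have "(?S r \<xi> - ?L \<xi>)\<^sup>2 \<le> 2 * (?S r \<xi>)\<^sup>2 + 2 * (?L \<xi>)\<^sup>2"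
        using zero_le_power2[of "?S r \<xi> + ?L \<xi>"] by (simp add: power2_eq_square algebra_simps)
      also have "\<dots> \<le> 2 * ?e \<xi> + 2 * ?e \<xi>" using elim by (intro add_mono mult_left_mono) auto
      finally show ?case by simp
    qed
  qed auto
  moreover have "integrable noise (\<lambda>\<xi>. (?S r \<xi>)\<^sup>2)" for r
  proof (rule Bochner_Integration.integrable_bound[OF e])
    show "AE \<xi> in noise. norm ((?S r \<xi>)\<^sup>2) \<le> norm (?e \<xi>)"
      using bound by eventually_elim auto
  qed measurable
  moreover have "integrable noise (\<lambda>\<xi>. (?L \<xi>)\<^sup>2)"
  proof (rule Bochner_Integration.integrable_bound[OF e])
    show "AE \<xi> in noise. norm ((?L \<xi>)\<^sup>2) \<le> norm (?e \<xi>)"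
      using bound by eventually_elim auto
  qed measurable
  ultimately show ?thesis
    unfolding tendsto_L2_def by (auto simp: integrable_distr_eq integral_distr)
qed

lemma height_offset_limit_average: "height_offset d (free_state d Q) (limit_average d)"
  unfolding height_offset_def
proof (intro conjI allI ballI)
  fix a :: int and \<omega>
  show "limit_average d (height_shift d (- a) \<omega>) = limit_average d \<omega> + ereal (of_int a)"
    using limit_average_shift[OF d_ge_2, of "- a" \<omega>] by (simp add: minus_ereal_def)
next
  have "AE \<zeta> in free_state d Q. \<bar>limit_average d (heights_from d [] 0 \<zeta>)\<bar> \<noteq> \<infinity>"
    by (subst AE_free_state_heights) (use AE_limit_average in auto)
  then show "\<exists>x\<in>verts d. \<exists>s. AE \<zeta> in free_state d Q. \<bar>limit_average d (heights_from d x s \<zeta>)\<bar> \<noteq> \<infinity>"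
    using Nil_in_verts by blast
qed (rule limit_average_tail_measurable)

subsection \<open>The pinned measure\<close>

definition mu :: "height_config measure" where
  "mu = offset_measure d (free_state d Q) (limit_average d)"

text \<open>The range to which subtracting the integer part confines the limiting average.
  Membership is unaffected by changing finitely many heights.\<close>

definition window :: "height_config set" where
  "window = {\<omega> \<in> space (height_space d). 0 \<le> limit_average d \<omega> \<and> limit_average d \<omega> < 1}"

lemma window_sets [measurable]: "window \<in> sets (height_space d)"
  unfolding window_def by measurable

lemma sets_mu [measurable_cong, simp]: "sets mu = sets (height_space d)"
  by (simp add: mu_def offset_measure_def)

lemma space_mu [simp]: "space mu = space (height_space d)"
  by (simp add: mu_def offset_measure_def)

lemma offset_heights_measurable [measurable]:
  "offset_heights d (limit_average d) \<in> gradient_space d \<rightarrow>\<^sub>M height_space d"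
proof -
  let ?k = "\<lambda>\<zeta>. \<lfloor>real_of_ereal (limit_average d (heights_from d [] 0 \<zeta>))\<rfloor>"
  have "(\<lambda>\<zeta>. \<lambda>x\<in>verts d. heights_from d [] 0 \<zeta> x - ?k \<zeta>) \<in> gradient_space d \<rightarrow>\<^sub>M height_space d"
    unfolding height_space_def
  proof (rule measurable_restrict)
    fix x assume x: "x \<in> verts d"
    show "(\<lambda>\<zeta>. heights_from d [] 0 \<zeta> x - ?k \<zeta>) \<in> gradient_space d \<rightarrow>\<^sub>M count_space UNIV"
      by (rule measurable_count_space_binary[OF measurable_compose[OF heights_from_measurable height_space_component[OF x]]])
        auto
  qed
  then show ?thesis by (simp add: offset_heights_def[abs_def] height_shift_def)
qed

sublocale mu: prob_space mu
  unfolding mu_def offset_measure_def by (rule free.prob_space_distr) (simp add: free_state_eq)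

lemma floor_in_window:
  assumes "\<And>s. limit_average d (heights s \<xi>) = ereal (real_of_int s + l)"
  shows "heights s \<xi> \<in> window \<longleftrightarrow> s = - \<lfloor>l\<rfloor>"
  unfolding window_def using assms[of s] floor_eq_iff[of l "- s"]
  by (auto simp: one_ereal_def zero_ereal_def)

lemma mu_eq_distr: "mu = distr noise (height_space d) (\<lambda>\<xi>. offset_heights d (limit_average d) (increments \<xi>))"
  unfolding mu_def offset_measure_def free_state_eq by (subst distr_distr) (auto simp: o_def)

lemma AE_offset_heights:
  "AE \<xi> in noise. offset_heights d (limit_average d) (increments \<xi>) = heights (- \<lfloor>level_sum (nonroot d) \<xi>\<rfloor>) \<xi>"
  using AE_limit_average
proof eventually_elim
  case (elim \<xi>)
  then show ?case
    using heights_shift[of 0 "\<lfloor>level_sum (nonroot d) \<xi>\<rfloor>" \<xi>] spec[OF elim, of 0]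
    by (simp add: offset_heights_def heights_from_increments)
qed

lemma nn_integral_mu_offset:
  assumes [measurable]: "f \<in> borel_measurable (height_space d)"
  shows "(\<integral>\<^sup>+\<omega>. f \<omega> \<partial>mu) = (\<integral>\<^sup>+\<xi>. f (heights (- \<lfloor>level_sum (nonroot d) \<xi>\<rfloor>) \<xi>) \<partial>noise)"
proof -
  have "(\<integral>\<^sup>+\<omega>. f \<omega> \<partial>mu) = (\<integral>\<^sup>+\<xi>. f (offset_heights d (limit_average d) (increments \<xi>)) \<partial>noise)"
    unfolding mu_eq_distr by (simp add: nn_integral_distr)
  also have "\<dots> = (\<integral>\<^sup>+\<xi>. f (heights (- \<lfloor>level_sum (nonroot d) \<xi>\<rfloor>) \<xi>) \<partial>noise)"
    using AE_offset_heights by (intro nn_integral_cong_AE) (auto elim: eventually_mono)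
  finally show ?thesis .
qed

lemma AE_mu_iff:
  assumes [measurable]: "Measurable.pred (height_space d) P"
  shows "(AE \<omega> in mu. P \<omega>) \<longleftrightarrow> (AE \<xi> in noise. P (heights (- \<lfloor>level_sum (nonroot d) \<xi>\<rfloor>) \<xi>))"
proof -
  have "(AE \<omega> in mu. P \<omega>) \<longleftrightarrow> (AE \<xi> in noise. P (offset_heights d (limit_average d) (increments \<xi>)))"
    unfolding mu_eq_distr by (subst AE_distr_iff) auto
  also have "\<dots> \<longleftrightarrow> (AE \<xi> in noise. P (heights (- \<lfloor>level_sum (nonroot d) \<xi>\<rfloor>) \<xi>))"
    using AE_offset_heights by (intro eventually_subst) (auto elim: eventually_mono)
  finally show ?thesis .
qed

text \<open>Summing over all heights at the root, exactly one of which puts the configuration into the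
  window, turns the random offset into conditioning on a tail event.\<close>

lemma nn_integral_mu:
  assumes [measurable]: "f \<in> borel_measurable (height_space d)"
  shows "(\<integral>\<^sup>+\<omega>. f \<omega> \<partial>mu) =
    (\<integral>\<^sup>+s. (\<integral>\<^sup>+\<xi>. f (heights s \<xi>) * indicator window (heights s \<xi>) \<partial>noise) \<partial>count_space UNIV)"
proof -
  have "(\<integral>\<^sup>+\<omega>. f \<omega> \<partial>mu) = (\<integral>\<^sup>+\<xi>. (\<integral>\<^sup>+s. f (heights s \<xi>) * indicator window (heights s \<xi>) \<partial>count_space UNIV) \<partial>noise)"
    unfolding nn_integral_mu_offset[OF assms]
    using AE_limit_average
  proof (intro nn_integral_cong_AE, eventually_elim)
    case (elim \<xi>)
    let ?s = "- \<lfloor>level_sum (nonroot d) \<xi>\<rfloor>"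
    have win: "heights s \<xi> \<in> window \<longleftrightarrow> s = ?s" for s
      using elim by (intro floor_in_window) simp
    have "(\<integral>\<^sup>+s. f (heights s \<xi>) * indicator window (heights s \<xi>) \<partial>count_space UNIV) =
        (\<Sum>s\<in>{?s}. f (heights s \<xi>) * indicator window (heights s \<xi>))"
      by (rule nn_integral_count_space') (auto simp: indicator_def win)
    then show ?case using win[of ?s] by simp
  qed
  also have "\<dots> = (\<integral>\<^sup>+s. (\<integral>\<^sup>+\<xi>. f (heights s \<xi>) * indicator window (heights s \<xi>) \<partial>noise) \<partial>count_space UNIV)"
    by (rule nn_integral_count_space_nn_integral) auto
  finally show ?thesis .
qed

end

section \<open>Finite changes of a configuration and local weights\<close>

lemma nn_integral_count_space_measurable:
  assumes "countable C" "\<And>i. i \<in> C \<Longrightarrow> f i \<in> borel_measurable M"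
  shows "(\<lambda>x. \<integral>\<^sup>+i. f i x \<partial>count_space C) \<in> borel_measurable M"
proof -
  interpret C: sigma_finite_measure "count_space C"
    by (rule sigma_finite_measure_count_space_countable[OF assms(1)])
  have "(\<lambda>x. f (fst x) (snd x)) \<in> borel_measurable (count_space C \<Otimes>\<^sub>M M)"
    using assms by (intro measurable_pair_measure_countable1) auto
  then have "(\<lambda>(x, i). f i x) \<in> borel_measurable (M \<Otimes>\<^sub>M count_space C)"
    by (subst measurable_split_conv, subst measurable_pair_swap_iff) (simp add: split_beta)
  then show ?thesis by (rule C.borel_measurable_nn_integral)
qed

definition glue :: "nat \<Rightarrow> nat list set \<Rightarrow> height_config \<Rightarrow> height_config \<Rightarrow> height_config" where
  "glue d \<Lambda> \<omega> \<eta> = (\<lambda>x\<in>verts d. if x \<in> \<Lambda> then \<eta> x else \<omega> x)"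

text \<open>New heights inside \<open>\<Lambda>\<close> are described by displacements
  \<open>\<theta>\<close> from the old ones. A fixed displacement is a map of configurations that
  can be moved through the integral by quasi-invariance, which prescribing absolute heights would
  not allow.\<close>

definition local_shift :: "nat \<Rightarrow> nat list set \<Rightarrow> height_config \<Rightarrow> height_config \<Rightarrow> height_config" where
  "local_shift d \<Lambda> \<theta> \<omega> = (\<lambda>x\<in>verts d. if x \<in> \<Lambda> then \<omega> x + \<theta> x else \<omega> x)"

text \<open>The edges with at least one endpoint in \<open>\<Lambda>\<close>, each named by its
  endpoint farther from the root.\<close>

definition touching :: "nat \<Rightarrow> nat list set \<Rightarrow> nat list set" where
  "touching d \<Lambda> = {v \<in> nonroot d. v \<in> \<Lambda> \<or> butlast v \<in> \<Lambda>}"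

definition local_weight :: "nat \<Rightarrow> (int \<Rightarrow> real) \<Rightarrow> nat list set \<Rightarrow> height_config \<Rightarrow> real" where
  "local_weight d Q \<Lambda> \<omega> = (\<Prod>v\<in>touching d \<Lambda>. Q (\<omega> v - \<omega> (butlast v)))"

lemma finite_touching: "finite \<Lambda> \<Longrightarrow> finite (touching d \<Lambda>)"
proof (rule finite_subset)
  show "touching d \<Lambda> \<subseteq> \<Lambda> \<union> (\<lambda>(u, g). u @ [g]) ` (\<Lambda> \<times> {..d})"
  proof
    fix v assume v: "v \<in> touching d \<Lambda>"
    show "v \<in> \<Lambda> \<union> (\<lambda>(u, g). u @ [g]) ` (\<Lambda> \<times> {..d})"
    proof (cases "v \<in> \<Lambda>")
      case False
      then have "v \<noteq> []" "v \<in> verts d" "butlast v \<in> \<Lambda>" using v by (auto simp: touching_def nonroot_def)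
      moreover from this have "butlast v @ [last v] \<in> verts d" by simp
      then have "last v \<le> d" by (simp only: verts_snoc)
      ultimately show ?thesis by (intro UnI2 image_eqI[of _ _ "(butlast v, last v)"]) auto
    qed simp
  qed
qed auto

lemma local_shift_in_space [simp]: "local_shift d \<Lambda> \<theta> \<omega> \<in> space (height_space d)"
  by (simp add: local_shift_def space_height_space)

lemma local_shift_measurable [measurable]: "local_shift d \<Lambda> \<theta> \<in> height_space d \<rightarrow>\<^sub>M height_space d"
  unfolding local_shift_def[abs_def]
proof (subst (2) height_space_def, rule measurable_restrict)
  fix x assume x: "x \<in> verts d"
  show "(\<lambda>\<omega>. if x \<in> \<Lambda> then \<omega> x + \<theta> x else \<omega> x) \<in> height_space d \<rightarrow>\<^sub>M count_space UNIV"
    by (rule measurable_compose[OF height_space_component[OF x], of "\<lambda>i. if x \<in> \<Lambda> then i + \<theta> x else i"]) simp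
qed

lemma limit_average_finite_change:
  assumes "finite \<Lambda>" "\<And>x. x \<in> verts d \<Longrightarrow> x \<notin> \<Lambda> \<Longrightarrow> \<omega>' x = \<omega> x"
  shows "limit_average d \<omega>' = limit_average d \<omega>"
proof -
  obtain N where N: "\<And>r. level d (r + N) \<inter> \<Lambda> = {}"
    by (rule finite_subset_levels[OF assms(1)]) blast
  have "sphere_average d (r + N) \<omega>' = sphere_average d (r + N) \<omega>" for r
    unfolding sphere_average_def sphere_verts_eq_level
    by (intro arg_cong2[where f="(/)"] sum.cong refl arg_cong[where f=real_of_int] assms(2))
      (use N[of r] in \<open>auto simp: level_def\<close>)
  then show ?thesis
    using limsup_shift_k[of "\<lambda>r. ereal (sphere_average d r \<omega>')" N]
      limsup_shift_k[of "\<lambda>r. ereal (sphere_average d r \<omega>)" N]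
    by (simp add: limit_average_eq_limsup)
qed

lemma limit_average_local_shift:
  "finite \<Lambda> \<Longrightarrow> limit_average d (local_shift d \<Lambda> \<theta> \<omega>) = limit_average d \<omega>"
  by (rule limit_average_finite_change) (auto simp: local_shift_def)

text \<open>Inner edges and edges across the boundary are merged into one product over
  \<open>touching\<close>, as a function of the single glued configuration; symmetry of
  \<open>Q\<close> makes the orientations agree.\<close>

lemma (in tree_gradient) boltzmann_weight_eq:
  assumes \<Lambda>: "finite \<Lambda>" "\<Lambda> \<subseteq> verts d"
  shows "boltzmann_weight d Q \<Lambda> \<omega> \<eta> = local_weight d Q \<Lambda> (glue d \<Lambda> \<omega> \<eta>)"
proof -
  let ?g = "glue d \<Lambda> \<omega> \<eta>"
  define E1 where "E1 = {v \<in> nonroot d. v \<in> \<Lambda> \<and> butlast v \<in> \<Lambda>}"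
  define E2 where "E2 = {v \<in> nonroot d. (v \<in> \<Lambda>) \<noteq> (butlast v \<in> \<Lambda>)}"
  \<comment> \<open>For an edge crossing the boundary this lists the endpoint outside
    \<open>\<Lambda>\<close> before the one inside, as in the boundary product.\<close>
  define e where "e v = (if v \<in> \<Lambda> then (butlast v, v) else (v, butlast v))" for v
  have E: "touching d \<Lambda> = E1 \<union> E2" "E1 \<inter> E2 = {}" by (auto simp: touching_def E1_def E2_def)
  have fin: "finite E1" "finite E2" using finite_touching[OF \<Lambda>(1), of d] E(1) by auto
  have Qs: "Q (a - b) = Q (b - a)" for a b using Q_sym[of "a - b"] by simp
  have "{(x, y) \<in> outward_arcs d. x \<in> \<Lambda> \<and> y \<in> \<Lambda>} = (\<lambda>v. (butlast v, v)) ` E1"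
    by (auto simp: outward_arcs_eq E1_def)
  then have "(\<Prod>(x, y)\<in>{(x, y) \<in> outward_arcs d. x \<in> \<Lambda> \<and> y \<in> \<Lambda>}. Q (\<eta> x - \<eta> y)) =
      (\<Prod>v\<in>E1. Q (\<eta> (butlast v) - \<eta> v))"
    by (simp add: prod.reindex inj_on_def)
  also have "\<dots> = (\<Prod>v\<in>E1. Q (?g v - ?g (butlast v)))"
    using \<Lambda>(2) by (intro prod.cong) (auto simp: glue_def E1_def Qs[of "\<eta> (butlast _)"] subset_iff)
  finally have 1: "(\<Prod>(x, y)\<in>{(x, y) \<in> outward_arcs d. x \<in> \<Lambda> \<and> y \<in> \<Lambda>}. Q (\<eta> x - \<eta> y)) =
      (\<Prod>v\<in>E1. Q (?g v - ?g (butlast v)))" .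
  have "{(x, y) \<in> arcs d. x \<in> outer_boundary d \<Lambda> \<and> y \<in> \<Lambda>} = e ` E2"
  proof (intro equalityI subsetI)
    fix b assume "b \<in> {(x, y) \<in> arcs d. x \<in> outer_boundary d \<Lambda> \<and> y \<in> \<Lambda>}"
    then obtain x y where b: "b = (x, y)" "(x, y) \<in> arcs d" "x \<notin> \<Lambda>" "y \<in> \<Lambda>"
      by (auto simp: outer_boundary_def)
    from b(2) consider "y \<noteq> []" "x = butlast y" "y \<in> verts d" | "x \<noteq> []" "y = butlast x" "x \<in> verts d"
      unfolding arcs_iff by auto
    then show "b \<in> e ` E2"
    proof cases
      case 1
      then show ?thesis using b by (intro image_eqI[of _ _ y]) (auto simp: e_def E2_def nonroot_def)
    next
      case 2
      then show ?thesis using b by (intro image_eqI[of _ _ x]) (auto simp: e_def E2_def nonroot_def)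
    qed
  next
    fix b assume "b \<in> e ` E2"
    then obtain v where v: "v \<in> verts d" "v \<noteq> []" "(v \<in> \<Lambda>) \<noteq> (butlast v \<in> \<Lambda>)" "b = e v"
      by (auto simp: E2_def nonroot_def)
    have "(butlast v, v) \<in> arcs d" "(v, butlast v) \<in> arcs d" "butlast v \<in> verts d"
      using v by (auto simp: arcs_iff butlast_in_verts)
    then show "b \<in> {(x, y) \<in> arcs d. x \<in> outer_boundary d \<Lambda> \<and> y \<in> \<Lambda>}"
      using v by (auto simp: e_def outer_boundary_def)
  qed
  moreover have "inj_on e E2"
  proof (rule inj_onI)
    fix v w assume *: "v \<in> E2" "w \<in> E2" "e v = e w"
    then have "v \<noteq> []" "w \<noteq> []" by (auto simp: E2_def nonroot_def)
    then have "length v > length (butlast v)" "length w > length (butlast w)" by auto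
    moreover have "{butlast v, v} = {butlast w, w}" using *(3) by (auto simp: e_def split: if_splits)
    ultimately show "v = w" by (metis doubleton_eq_iff less_asym)
  qed
  ultimately have "(\<Prod>(x, y)\<in>{(x, y) \<in> arcs d. x \<in> outer_boundary d \<Lambda> \<and> y \<in> \<Lambda>}. Q (\<omega> x - \<eta> y)) =
      (\<Prod>v\<in>E2. case e v of (x, y) \<Rightarrow> Q (\<omega> x - \<eta> y))"
    by (simp add: prod.reindex)
  also have "\<dots> = (\<Prod>v\<in>E2. Q (?g v - ?g (butlast v)))"
  proof (rule prod.cong[OF refl])
    fix v assume "v \<in> E2"
    then have "v \<in> verts d" "butlast v \<in> verts d" "(v \<in> \<Lambda>) \<noteq> (butlast v \<in> \<Lambda>)"
      by (auto simp: E2_def nonroot_def butlast_in_verts)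
    then show "(case e v of (x, y) \<Rightarrow> Q (\<omega> x - \<eta> y)) = Q (?g v - ?g (butlast v))"
      by (auto simp: e_def glue_def Qs[of "\<omega> (butlast v)"])
  qed
  finally have 2: "(\<Prod>(x, y)\<in>{(x, y) \<in> arcs d. x \<in> outer_boundary d \<Lambda> \<and> y \<in> \<Lambda>}. Q (\<omega> x - \<eta> y)) =
      (\<Prod>v\<in>E2. Q (?g v - ?g (butlast v)))" .
  show ?thesis
    unfolding boltzmann_weight_def 1 2 local_weight_def E(1)
    using fin E(2) by (rule prod.union_disjoint[symmetric])
qed

context tree_gradient
begin

lemma Q_nonneg [simp]: "Q j \<ge> 0"
  using Q_pos[of j] by simp

lemma local_weight_pos: "local_weight d Q \<Lambda> \<omega> > 0"
  unfolding local_weight_def using Q_pos by (intro prod_pos) auto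

lemma bij_betw_local: "bij_betw (\<lambda>\<theta>. \<lambda>x\<in>\<Lambda>. \<omega> x + \<theta> x) (\<Lambda> \<rightarrow>\<^sub>E (UNIV :: int set)) (\<Lambda> \<rightarrow>\<^sub>E UNIV)"
  by (rule bij_betw_byWitness[where f'="\<lambda>\<eta>. \<lambda>x\<in>\<Lambda>. \<eta> x - \<omega> x"])
    (auto simp: fun_eq_iff PiE_def extensional_def)

lemma bij_betw_local_uminus:
  "bij_betw (\<lambda>\<theta>. \<lambda>x\<in>\<Lambda>. - \<theta> x) (\<Lambda> \<rightarrow>\<^sub>E (UNIV :: int set)) (\<Lambda> \<rightarrow>\<^sub>E UNIV)"
  by (rule bij_betw_byWitness[where f'="\<lambda>\<theta>. \<lambda>x\<in>\<Lambda>. - \<theta> x"])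
    (auto simp: fun_eq_iff PiE_def extensional_def)

definition local_partition :: "nat list set \<Rightarrow> height_config \<Rightarrow> ennreal" where
  "local_partition \<Lambda> \<omega> =
    (\<integral>\<^sup>+\<theta>. ennreal (local_weight d Q \<Lambda> (local_shift d \<Lambda> \<theta> \<omega>)) \<partial>count_space (\<Lambda> \<rightarrow>\<^sub>E UNIV))"

lemma glue_shifted:
  "\<omega> \<in> space (height_space d) \<Longrightarrow> glue d \<Lambda> \<omega> (\<lambda>x\<in>\<Lambda>. \<omega> x + \<theta> x) = local_shift d \<Lambda> \<theta> \<omega>"
  by (auto simp: glue_def local_shift_def)

lemma partition_function_eq:
  assumes "finite \<Lambda>" "\<Lambda> \<subseteq> verts d" "\<omega> \<in> space (height_space d)"
  shows "partition_function d Q \<Lambda> \<omega> = local_partition \<Lambda> \<omega>"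
proof -
  have "partition_function d Q \<Lambda> \<omega> =
      (\<integral>\<^sup>+\<theta>. ennreal (boltzmann_weight d Q \<Lambda> \<omega> (\<lambda>x\<in>\<Lambda>. \<omega> x + \<theta> x)) \<partial>count_space (\<Lambda> \<rightarrow>\<^sub>E UNIV))"
    unfolding partition_function_def by (rule nn_integral_bij_count_space[OF bij_betw_local, symmetric])
  then show ?thesis
    using assms by (simp add: local_partition_def boltzmann_weight_eq glue_shifted)
qed

lemma emeasure_gibbs_kernel:
  assumes \<Lambda>: "finite \<Lambda>" "\<Lambda> \<subseteq> verts d" and \<omega>: "\<omega> \<in> space (height_space d)"
    and A [measurable]: "A \<in> sets (height_space d)"
  shows "emeasure (gibbs_kernel d Q \<Lambda> \<omega>) A =
    (\<integral>\<^sup>+\<theta>. ennreal (local_weight d Q \<Lambda> (local_shift d \<Lambda> \<theta> \<omega>)) / local_partition \<Lambda> \<omega> *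
      indicator A (local_shift d \<Lambda> \<theta> \<omega>) \<partial>count_space (\<Lambda> \<rightarrow>\<^sub>E UNIV))"
proof -
  let ?C = "count_space (\<Lambda> \<rightarrow>\<^sub>E (UNIV :: int set))"
  let ?w = "\<lambda>\<eta>. ennreal (boltzmann_weight d Q \<Lambda> \<omega> \<eta>) / partition_function d Q \<Lambda> \<omega>"
  have g: "glue d \<Lambda> \<omega> \<in> density ?C ?w \<rightarrow>\<^sub>M height_space d"
    by (auto simp: measurable_def glue_def space_height_space)
  have "emeasure (gibbs_kernel d Q \<Lambda> \<omega>) A = emeasure (density ?C ?w) (glue d \<Lambda> \<omega> -` A \<inter> space ?C)"
    unfolding gibbs_kernel_def glue_def[symmetric, abs_def]
    by (subst emeasure_distr[OF g A]) simp
  also have "\<dots> = (\<integral>\<^sup>+\<eta>. ?w \<eta> * indicator A (glue d \<Lambda> \<omega> \<eta>) \<partial>?C)"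
    by (subst emeasure_density) (auto intro!: nn_integral_cong simp: indicator_def)
  also have "\<dots> = (\<integral>\<^sup>+\<theta>. ?w (\<lambda>x\<in>\<Lambda>. \<omega> x + \<theta> x) * indicator A (glue d \<Lambda> \<omega> (\<lambda>x\<in>\<Lambda>. \<omega> x + \<theta> x)) \<partial>?C)"
    by (rule nn_integral_bij_count_space[OF bij_betw_local, symmetric])
  finally show ?thesis
    using \<Lambda> \<omega> by (simp add: boltzmann_weight_eq glue_shifted partition_function_eq)
qed

text \<open>The kernel charges only local shifts of \<open>\<omega>\<close>, all of which agree with
  \<open>\<omega>\<close> about membership in \<open>B\<close>; so the indicator of \<open>B\<close>
  comes out as a factor.\<close>

lemma emeasure_gibbs_kernel_Int:
  assumes \<Lambda>: "finite \<Lambda>" "\<Lambda> \<subseteq> verts d" and \<omega>: "\<omega> \<in> space (height_space d)"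
    and A [measurable]: "A \<in> sets (height_space d)" and B [measurable]: "B \<in> sets (height_space d)"
    and B': "\<And>\<theta>. local_shift d \<Lambda> \<theta> \<omega> \<in> B \<longleftrightarrow> \<omega> \<in> B"
  shows "emeasure (gibbs_kernel d Q \<Lambda> \<omega>) (A \<inter> B) = emeasure (gibbs_kernel d Q \<Lambda> \<omega>) A * indicator B \<omega>"
  using assms
  by (simp add: emeasure_gibbs_kernel nn_integral_multc[symmetric] indicator_inter_arith B' mult.assoc
      indicator_def cong: nn_integral_cong)

subsection \<open>Finiteness of the partition function\<close>

text \<open>The appended generator differs from the last letter, so the word stays reduced and is
  one particular child of \<open>x\<close>.\<close>

definition child :: "nat list \<Rightarrow> nat list" where
  "child x = x @ [if x \<noteq> [] \<and> last x = 0 then 1 else 0]"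

lemma Q_le_l1_norm: "Q j \<le> l1_norm Q"
proof -
  have "Q j = infsum Q {j}" by simp
  also have "\<dots> \<le> infsum Q UNIV"
    using Q_summable_on Q_pos less_imp_le by (intro infsum_mono_neutral) auto
  finally show ?thesis by (simp add: l1_norm_def)
qed

lemma nn_integral_Q: "(\<integral>\<^sup>+y. ennreal (Q (a - (b + y))) \<partial>count_space UNIV) = ennreal (l1_norm Q)"
proof -
  have "bij (\<lambda>y. a - (b + y))"
    by (rule bij_betw_byWitness[where f'="\<lambda>y. a - b - y"]) auto
  from nn_integral_bij_count_space[OF this, of "\<lambda>j. ennreal (Q j)"] show ?thesis
    using Q_summable_on by (simp add: nn_integral_count_space_summable_on l1_norm_def)
qed

text \<open>A chain of edges leading outwards from each site suffices: summing over the sites in the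
  order of increasing length, each new height enters only one of the factors.\<close>

lemma nn_integral_child_weights:
  assumes "finite \<Lambda>" "\<Lambda> \<subseteq> verts d"
  shows "(\<integral>\<^sup>+\<theta>. (\<Prod>x\<in>\<Lambda>. ennreal (Q (local_shift d \<Lambda> \<theta> \<omega> (child x) - local_shift d \<Lambda> \<theta> \<omega> x)))
     \<partial>count_space (\<Lambda> \<rightarrow>\<^sub>E UNIV)) = ennreal (l1_norm Q) ^ card \<Lambda>"
  using assms
\<comment> \<open>With the negated length as rank, the inserted \<open>x\<close> is a shortest site.
  It is then no child of any site in the set, and its displacement enters only the factor of its own
  edge.\<close>
proof (induction rule: finite_ranking_induct[where f="\<lambda>x. - int (length x)"])
  case empty
  then show ?case by (simp add: nn_integral_count_space_finite)
next
  case (insert x \<Lambda>)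
  note 2 = insert
  show ?case
  proof (cases "x \<in> \<Lambda>")
    case True
    then show ?thesis using 2 by (simp add: insert_absorb)
  next
    case False
    interpret product_sigma_finite "\<lambda>_::nat list. count_space (UNIV :: int set)"
      by (intro product_sigma_finite.intro sigma_finite_measure_count_space)
    let ?F = "\<lambda>\<theta>. \<Prod>y\<in>insert x \<Lambda>. ennreal (Q (local_shift d (insert x \<Lambda>) \<theta> \<omega> (child y) - local_shift d (insert x \<Lambda>) \<theta> \<omega> y))"
    let ?G = "\<lambda>\<theta>. \<Prod>y\<in>\<Lambda>. ennreal (Q (local_shift d \<Lambda> \<theta> \<omega> (child y) - local_shift d \<Lambda> \<theta> \<omega> y))"
    have P: "PiM S (\<lambda>_. count_space (UNIV :: int set)) = count_space (S \<rightarrow>\<^sub>E UNIV)"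
      if "finite S" for S :: "nat list set"
      using that by (rule count_space_PiM_finite) simp
    have child: "child y \<noteq> x" if "y \<in> insert x \<Lambda>" for y
      using 2(2)[of y] that by (auto simp: child_def)
    have ls: "local_shift d (insert x \<Lambda>) (\<theta>(x := y)) \<omega> z = local_shift d \<Lambda> \<theta> \<omega> z" if "z \<noteq> x" for \<theta> y z
      using that by (auto simp: local_shift_def)
    have F: "?F (\<theta>(x := y)) = ennreal (Q (local_shift d \<Lambda> \<theta> \<omega> (child x) - (\<omega> x + y))) * ?G \<theta>" for \<theta> y
    proof -
      have "(\<Prod>z\<in>\<Lambda>. ennreal (Q (local_shift d (insert x \<Lambda>) (\<theta>(x := y)) \<omega> (child z) - local_shift d (insert x \<Lambda>) (\<theta>(x := y)) \<omega> z))) = ?G \<theta>"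
      proof (rule prod.cong[OF refl])
        fix z assume "z \<in> \<Lambda>"
        then have "z \<noteq> x" "child z \<noteq> x" using False child[of z] by auto
        then show "ennreal (Q (local_shift d (insert x \<Lambda>) (\<theta>(x := y)) \<omega> (child z) - local_shift d (insert x \<Lambda>) (\<theta>(x := y)) \<omega> z)) =
            ennreal (Q (local_shift d \<Lambda> \<theta> \<omega> (child z) - local_shift d \<Lambda> \<theta> \<omega> z))"
          by (simp add: ls)
      qed
      moreover have "local_shift d (insert x \<Lambda>) (\<theta>(x := y)) \<omega> x = \<omega> x + y"
        using 2 by (simp add: local_shift_def)
      ultimately show ?thesis using 2(1) False child[of x] by (simp add: ls)
    qed
    have "(\<integral>\<^sup>+\<theta>. ?F \<theta> \<partial>count_space (insert x \<Lambda> \<rightarrow>\<^sub>E UNIV)) =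
        (\<integral>\<^sup>+\<theta>. (\<integral>\<^sup>+y. ?F (\<theta>(x := y)) \<partial>count_space UNIV) \<partial>count_space (\<Lambda> \<rightarrow>\<^sub>E UNIV))"
      using 2(1) False product_nn_integral_insert[of \<Lambda> x ?F] by (simp add: P)
    also have "\<dots> = (\<integral>\<^sup>+\<theta>. ennreal (l1_norm Q) * ?G \<theta> \<partial>count_space (\<Lambda> \<rightarrow>\<^sub>E UNIV))"
      unfolding F by (simp add: nn_integral_multc nn_integral_Q)
    also have "\<dots> = ennreal (l1_norm Q) * ennreal (l1_norm Q) ^ card \<Lambda>"
      using 2 by (simp add: nn_integral_cmult)
    finally show ?thesis using 2(1) False by simp
  qed
qed

text \<open>All factors except those of the edges from \<open>x\<close> to \<open>child x\<close>
  are bounded by \<open>l1_norm Q\<close>; the remaining chain of factors can be summed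
  exactly.\<close>

lemma local_partition_finite:
  assumes \<Lambda>: "finite \<Lambda>" "\<Lambda> \<subseteq> verts d"
  shows "local_partition \<Lambda> \<omega> < top"
proof -
  have inj: "inj_on child \<Lambda>" by (auto simp: inj_on_def child_def)
  have bl: "butlast (child x) = x" for x by (simp add: child_def)
  have sub: "child ` \<Lambda> \<subseteq> touching d \<Lambda>"
    using \<Lambda>(2) d_ge_2 by (auto simp: touching_def nonroot_def child_def verts_snoc subset_iff)
  have fin: "finite (touching d \<Lambda>)" by (rule finite_touching[OF \<Lambda>(1)])
  let ?c = "ennreal (l1_norm Q ^ card (touching d \<Lambda> - child ` \<Lambda>))"
  have "ennreal (local_weight d Q \<Lambda> \<omega>) \<le> ?c * (\<Prod>x\<in>\<Lambda>. ennreal (Q (\<omega> (child x) - \<omega> x)))" for \<omega>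
  proof -
    have "local_weight d Q \<Lambda> \<omega> = (\<Prod>v\<in>touching d \<Lambda> - child ` \<Lambda>. Q (\<omega> v - \<omega> (butlast v))) *
        (\<Prod>v\<in>child ` \<Lambda>. Q (\<omega> v - \<omega> (butlast v)))"
      unfolding local_weight_def by (rule prod.subset_diff[OF sub fin])
    also have "\<dots> \<le> (\<Prod>v\<in>touching d \<Lambda> - child ` \<Lambda>. l1_norm Q) * (\<Prod>v\<in>child ` \<Lambda>. Q (\<omega> v - \<omega> (butlast v)))"
      by (intro mult_right_mono prod_mono) (auto intro!: Q_le_l1_norm prod_nonneg)
    also have "(\<Prod>v\<in>child ` \<Lambda>. Q (\<omega> v - \<omega> (butlast v))) = (\<Prod>x\<in>\<Lambda>. Q (\<omega> (child x) - \<omega> x))"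
      by (subst prod.reindex[OF inj]) (simp add: bl)
    finally have "ennreal (local_weight d Q \<Lambda> \<omega>) \<le>
        ennreal (l1_norm Q ^ card (touching d \<Lambda> - child ` \<Lambda>) * (\<Prod>x\<in>\<Lambda>. Q (\<omega> (child x) - \<omega> x)))"
      by (intro ennreal_leI) simp
    also have "\<dots> = ?c * (\<Prod>x\<in>\<Lambda>. ennreal (Q (\<omega> (child x) - \<omega> x)))"
      using l1_norm_pos by (subst prod_ennreal) (auto simp: ennreal_mult prod_nonneg)
    finally show ?thesis .
  qed
  then have "local_partition \<Lambda> \<omega> \<le> (\<integral>\<^sup>+\<theta>. ?c * (\<Prod>x\<in>\<Lambda>. ennreal (Q (local_shift d \<Lambda> \<theta> \<omega> (child x) - local_shift d \<Lambda> \<theta> \<omega> x))) \<partial>count_space (\<Lambda> \<rightarrow>\<^sub>E UNIV))"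
    unfolding local_partition_def by (intro nn_integral_mono)
  also have "\<dots> = ?c * ennreal (l1_norm Q) ^ card \<Lambda>"
    using nn_integral_child_weights[OF \<Lambda>, of \<omega>] by (simp add: nn_integral_cmult)
  also have "\<dots> < top"
    using l1_norm_pos by (simp add: ennreal_power ennreal_mult[symmetric])
  finally show ?thesis .
qed

lemma local_partition_pos: "local_partition \<Lambda> \<omega> > 0"
proof (rule ccontr)
  assume "\<not> local_partition \<Lambda> \<omega> > 0"
  then have "\<forall>\<theta>\<in>\<Lambda> \<rightarrow>\<^sub>E UNIV. ennreal (local_weight d Q \<Lambda> (local_shift d \<Lambda> \<theta> \<omega>)) = 0"
    unfolding local_partition_def by (simp add: nn_integral_0_iff_AE AE_count_space)
  moreover have "(\<lambda>x\<in>\<Lambda>. 0) \<in> \<Lambda> \<rightarrow>\<^sub>E (UNIV :: int set)" by simp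
  ultimately show False using local_weight_pos[of \<Lambda>] by (metis ennreal_eq_0_iff not_le)
qed

lemma local_shift_local_shift:
  "local_shift d \<Lambda> \<theta> (local_shift d \<Lambda> \<theta>' \<omega>) = local_shift d \<Lambda> (\<lambda>x\<in>\<Lambda>. \<theta>' x + \<theta> x) \<omega>"
  by (auto simp: local_shift_def fun_eq_iff)

text \<open>The sum runs over all displacements, so a shift of the starting configuration inside
  \<open>\<Lambda>\<close> merely relabels them.\<close>

lemma local_partition_local_shift:
  "local_partition \<Lambda> (local_shift d \<Lambda> \<theta> \<omega>) = local_partition \<Lambda> \<omega>"
  unfolding local_partition_def local_shift_local_shift
  by (rule nn_integral_bij_count_space[OF bij_betw_local])

subsection \<open>Quasi-invariance\<close>

definition noise_shift :: "nat list set \<Rightarrow> height_config \<Rightarrow> height_config \<Rightarrow> height_config" where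
  "noise_shift E a \<xi> = (\<lambda>v. if v \<in> E then \<xi> v + a v else \<xi> v)"

lemma noise_shift_measurable [measurable]:
  assumes "E \<subseteq> nonroot d" shows "noise_shift E a \<in> noise \<rightarrow>\<^sub>M noise"
  unfolding noise_shift_def[abs_def]
proof (subst (2) noise_def, rule measurable_PiM_single')
  show "(\<lambda>\<xi>. if v \<in> E then \<xi> v + a v else \<xi> v) \<in> noise \<rightarrow>\<^sub>M q" if "v \<in> nonroot d" for v
  proof -
    have "(\<lambda>\<xi>. if v \<in> E then \<xi> v + a v else \<xi> v) \<in> noise \<rightarrow>\<^sub>M count_space UNIV"
      by (rule measurable_compose[OF noise_component[OF that], of "\<lambda>i. if v \<in> E then i + a v else i"]) simp
    then show ?thesis using measurable_cong_sets[OF refl, of q "count_space UNIV" noise] by simp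
  qed
  show "(\<lambda>\<xi> v. if v \<in> E then \<xi> v + a v else \<xi> v) \<in> space noise \<rightarrow> (\<Pi>\<^sub>E i\<in>nonroot d. space q)"
    using assms by (auto simp: noise_def space_PiM PiE_def extensional_def)
qed

lemma Q_measurable [measurable]:
  assumes "v \<in> nonroot d"
  shows "(\<lambda>\<xi>. ennreal (Q (\<xi> v + c))) \<in> borel_measurable noise"
    "(\<lambda>\<xi>. ennreal (Q (\<xi> v - c))) \<in> borel_measurable noise"
  by (rule measurable_compose[OF noise_component[OF assms]]; simp)+

text \<open>The law is proportional to \<open>Q\<close>, so the density ratio of the shifted law at
  \<open>j\<close> is \<open>Q (j - c)\<close> over \<open>Q j\<close>. With the denominator
  cleared, the change of variables needs no division.\<close>

lemma nn_integral_q_shift: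
  "(\<integral>\<^sup>+j. f (j + c) * ennreal (Q (j + c)) \<partial>q) = (\<integral>\<^sup>+j. f j * ennreal (Q (j - c)) \<partial>q)"
proof -
  have "bij (\<lambda>j::int. j + c)" by (rule bij_betw_byWitness[where f'="\<lambda>j. j - c"]) auto
  then have "(\<integral>\<^sup>+j. ennreal (prob (j + c - c)) * (f (j + c) * ennreal (Q (j + c))) \<partial>count_space UNIV) =
      (\<integral>\<^sup>+j. ennreal (prob (j - c)) * (f j * ennreal (Q j)) \<partial>count_space UNIV)"
    by (rule nn_integral_bij_count_space[where f="\<lambda>i. ennreal (prob (i - c)) * (f i * ennreal (Q i))"])
  moreover have "ennreal (prob (j - c)) * (f j * ennreal (Q j)) = ennreal (prob j) * (f j * ennreal (Q (j - c)))" for j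
  proof -
    have "ennreal (prob (j - c)) * ennreal (Q j) = ennreal (prob j) * ennreal (Q (j - c))"
      using l1_norm_pos by (simp add: prob_def ennreal_mult[symmetric] mult.commute)
    then show ?thesis by (simp only: mult.left_commute[of _ "f j"])
  qed
  ultimately show ?thesis by (simp add: nn_integral_q)
qed

lemma nn_integral_noise_shift_single:
  assumes v: "v \<in> nonroot d" and [measurable]: "k \<in> borel_measurable noise"
  shows "(\<integral>\<^sup>+\<xi>. k (\<xi>(v := \<xi> v + c)) * ennreal (Q (\<xi> v + c)) \<partial>noise) =
    (\<integral>\<^sup>+\<xi>. k \<xi> * ennreal (Q (\<xi> v - c)) \<partial>noise)"
proof -
  have "noise_shift {v} (\<lambda>_. c) \<xi> = \<xi>(v := \<xi> v + c)" for \<xi> by (auto simp: noise_shift_def)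
  then have [measurable]: "(\<lambda>\<xi>. \<xi>(v := \<xi> v + c)) \<in> noise \<rightarrow>\<^sub>M noise"
    using noise_shift_measurable[of "{v}" "\<lambda>_. c"] v by simp
  have "(\<integral>\<^sup>+\<xi>. k (\<xi>(v := \<xi> v + c)) * ennreal (Q (\<xi> v + c)) \<partial>noise) =
      (\<integral>\<^sup>+\<xi>. (\<integral>\<^sup>+j. k ((\<xi>(v := j))(v := (\<xi>(v := j)) v + c)) * ennreal (Q ((\<xi>(v := j)) v + c)) \<partial>q) \<partial>noise)"
    using v by (intro nn_integral_resample) measurable
  also have "\<dots> = (\<integral>\<^sup>+\<xi>. (\<integral>\<^sup>+j. k (\<xi>(v := j + c)) * ennreal (Q (j + c)) \<partial>q) \<partial>noise)" by simp
  also have "\<dots> = (\<integral>\<^sup>+\<xi>. (\<integral>\<^sup>+j. k (\<xi>(v := j)) * ennreal (Q ((\<xi>(v := j)) v - c)) \<partial>q) \<partial>noise)"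
    using nn_integral_q_shift[of "\<lambda>j. k (_(v := j))" c] by simp
  also have "\<dots> = (\<integral>\<^sup>+\<xi>. k \<xi> * ennreal (Q (\<xi> v - c)) \<partial>noise)"
    using v by (intro nn_integral_resample[symmetric]) measurable
  finally show ?thesis .
qed

lemma nn_integral_noise_shift:
  assumes "finite E" "E \<subseteq> nonroot d" "k \<in> borel_measurable noise"
  shows "(\<integral>\<^sup>+\<xi>. k (noise_shift E a \<xi>) * (\<Prod>v\<in>E. ennreal (Q (\<xi> v + a v))) \<partial>noise) =
    (\<integral>\<^sup>+\<xi>. k \<xi> * (\<Prod>v\<in>E. ennreal (Q (\<xi> v - a v))) \<partial>noise)"
  using assms
proof (induction E arbitrary: k rule: finite_induct)
  case empty
  then show ?case by (simp add: noise_shift_def)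
next
  case (insert v E)
  have v: "v \<in> nonroot d" and E: "E \<subseteq> nonroot d" using insert.prems by auto
  note [measurable] = insert.prems(2) noise_shift_measurable[OF E]
  have [measurable]: "(\<lambda>\<xi>. \<Prod>u\<in>E. ennreal (Q (\<xi> u + a u))) \<in> borel_measurable noise"
    using E by (intro borel_measurable_prod_ennreal Q_measurable) auto
  let ?k = "\<lambda>\<xi>. k (noise_shift E a \<xi>) * (\<Prod>u\<in>E. ennreal (Q (\<xi> u + a u)))"
  have [measurable]: "?k \<in> borel_measurable noise" by measurable
  have "?k (\<xi>(v := \<xi> v + a v)) * ennreal (Q (\<xi> v + a v)) =
      k (noise_shift (insert v E) a \<xi>) * (\<Prod>u\<in>insert v E. ennreal (Q (\<xi> u + a u)))" for \<xi>
  proof -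
    have "noise_shift E a (\<xi>(v := \<xi> v + a v)) = noise_shift (insert v E) a \<xi>"
      using insert.hyps by (auto simp: noise_shift_def fun_eq_iff)
    moreover have "(\<Prod>u\<in>E. ennreal (Q ((\<xi>(v := \<xi> v + a v)) u + a u))) = (\<Prod>u\<in>E. ennreal (Q (\<xi> u + a u)))"
      using insert.hyps by (intro prod.cong) auto
    ultimately show ?thesis using insert.hyps by (simp add: ac_simps)
  qed
  then have "(\<integral>\<^sup>+\<xi>. k (noise_shift (insert v E) a \<xi>) * (\<Prod>u\<in>insert v E. ennreal (Q (\<xi> u + a u))) \<partial>noise) =
      (\<integral>\<^sup>+\<xi>. ?k (\<xi>(v := \<xi> v + a v)) * ennreal (Q (\<xi> v + a v)) \<partial>noise)" by simp
  also have "\<dots> = (\<integral>\<^sup>+\<xi>. ?k \<xi> * ennreal (Q (\<xi> v - a v)) \<partial>noise)"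
    by (rule nn_integral_noise_shift_single[OF v]) measurable
  also have "\<dots> = (\<integral>\<^sup>+\<xi>. (\<lambda>\<xi>. k \<xi> * ennreal (Q (\<xi> v - a v))) (noise_shift E a \<xi>) * (\<Prod>u\<in>E. ennreal (Q (\<xi> u + a u))) \<partial>noise)"
    using insert.hyps by (simp add: noise_shift_def ac_simps)
  also have "\<dots> = (\<integral>\<^sup>+\<xi>. k \<xi> * ennreal (Q (\<xi> v - a v)) * (\<Prod>u\<in>E. ennreal (Q (\<xi> u - a u))) \<partial>noise)"
    using v E by (intro insert.IH) measurable
  finally show ?case using insert.hyps by (simp add: ac_simps)
qed

text \<open>Here \<open>a\<close> is the discrete gradient of the displacement
  \<open>\<theta>\<close>, extended by zero outside \<open>\<Lambda>\<close>. It is supported on the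
  edges touching \<open>\<Lambda>\<close>; the displacement of the root itself is carried by the
  starting height.\<close>

lemma heights_noise_shift:
  fixes \<theta> :: height_config
  assumes \<Lambda>: "\<Lambda> \<subseteq> verts d"
  defines "a \<equiv> \<lambda>v. (if v \<in> \<Lambda> then \<theta> v else 0) - (if butlast v \<in> \<Lambda> then \<theta> (butlast v) else 0)"
  shows "heights (s + (if [] \<in> \<Lambda> then \<theta> [] else 0)) (noise_shift (touching d \<Lambda>) a \<xi>) =
    local_shift d \<Lambda> \<theta> (heights s \<xi>)"
proof
  fix v
  let ?s = "s + (if [] \<in> \<Lambda> then \<theta> [] else 0)" and ?\<xi> = "noise_shift (touching d \<Lambda>) a \<xi>"
  have "v \<in> verts d \<Longrightarrow> heights ?s ?\<xi> v = local_shift d \<Lambda> \<theta> (heights s \<xi>) v"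
  proof (induction v rule: rev_induct)
    case Nil
    then show ?case by (simp add: local_shift_def)
  next
    case (snoc g v)
    then have v: "v \<in> verts d" and vg: "v @ [g] \<in> nonroot d" by (auto simp: verts_snoc nonroot_def)
    have "?\<xi> (v @ [g]) = \<xi> (v @ [g]) + a (v @ [g])"
      using vg by (auto simp: noise_shift_def touching_def a_def)
    then show ?case
      using snoc.IH[OF v] v vg heights_step[OF vg, of ?s ?\<xi>] heights_step[OF vg, of s \<xi>]
      by (auto simp: local_shift_def a_def nonroot_def)
  qed
  moreover have "heights ?s ?\<xi> v = local_shift d \<Lambda> \<theta> (heights s \<xi>) v" if "v \<notin> verts d"
    using that by (simp add: heights_def local_shift_def)
  ultimately show "heights ?s ?\<xi> v = local_shift d \<Lambda> \<theta> (heights s \<xi>) v" by blast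
qed

lemma local_weight_heights: "local_weight d Q \<Lambda> (heights s \<xi>) = (\<Prod>v\<in>touching d \<Lambda>. Q (\<xi> v))"
  unfolding local_weight_def
  by (intro prod.cong refl arg_cong[where f=Q]) (auto simp: touching_def heights_step)

text \<open>Quasi-invariance of the free measure with counting measure at the root: the increments
  change by a gradient at the cost of the local weights, and the change \<open>c\<close> of the root
  height is absorbed by shift invariance of counting measure.\<close>

lemma nn_integral_local_shift:
  assumes \<Lambda>: "finite \<Lambda>" "\<Lambda> \<subseteq> verts d" and h [measurable]: "h \<in> borel_measurable (height_space d)"
  shows "(\<integral>\<^sup>+s. (\<integral>\<^sup>+\<xi>. h (local_shift d \<Lambda> \<theta> (heights s \<xi>)) *
        ennreal (local_weight d Q \<Lambda> (local_shift d \<Lambda> \<theta> (heights s \<xi>))) \<partial>noise) \<partial>count_space UNIV) =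
    (\<integral>\<^sup>+s. (\<integral>\<^sup>+\<xi>. h (heights s \<xi>) *
        ennreal (local_weight d Q \<Lambda> (local_shift d \<Lambda> (\<lambda>x\<in>\<Lambda>. - \<theta> x) (heights s \<xi>))) \<partial>noise) \<partial>count_space UNIV)"
proof -
  let ?E = "touching d \<Lambda>"
  define a where "a v = (if v \<in> \<Lambda> then \<theta> v else 0) - (if butlast v \<in> \<Lambda> then \<theta> (butlast v) else 0)" for v
  define c where "c = (if [] \<in> \<Lambda> then \<theta> [] else 0)"
  have E: "finite ?E" "?E \<subseteq> nonroot d" using finite_touching[OF \<Lambda>(1)] by (auto simp: touching_def)
  have up: "local_shift d \<Lambda> \<theta> (heights s \<xi>) = heights (s + c) (noise_shift ?E a \<xi>)" for s \<xi>
    using heights_noise_shift[OF \<Lambda>(2), of s \<theta> \<xi>] by (simp add: a_def[abs_def] c_def)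
  have down: "local_shift d \<Lambda> (\<lambda>x\<in>\<Lambda>. - \<theta> x) (heights s \<xi>) = heights (s - c) (noise_shift ?E (\<lambda>v. - a v) \<xi>)" for s \<xi>
  proof -
    have "(\<lambda>v. (if v \<in> \<Lambda> then (\<lambda>x\<in>\<Lambda>. - \<theta> x) v else 0) - (if butlast v \<in> \<Lambda> then (\<lambda>x\<in>\<Lambda>. - \<theta> x) (butlast v) else 0)) = (\<lambda>v. - a v)"
      by (auto simp: a_def)
    then show ?thesis
      using heights_noise_shift[OF \<Lambda>(2), of s "\<lambda>x\<in>\<Lambda>. - \<theta> x" \<xi>] by (auto simp: c_def)
  qed
  have Qn: "ennreal (\<Prod>v\<in>?E. Q (noise_shift ?E b \<xi> v)) = (\<Prod>v\<in>?E. ennreal (Q (\<xi> v + b v)))" for b \<xi>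
    by (subst prod_ennreal) (auto simp: noise_shift_def intro!: prod.cong)
  have "(\<integral>\<^sup>+\<xi>. h (local_shift d \<Lambda> \<theta> (heights s \<xi>)) *
        ennreal (local_weight d Q \<Lambda> (local_shift d \<Lambda> \<theta> (heights s \<xi>))) \<partial>noise) =
      (\<integral>\<^sup>+\<xi>. h (heights (s + c) \<xi>) * (\<Prod>v\<in>?E. ennreal (Q (\<xi> v - a v))) \<partial>noise)" for s
    using nn_integral_noise_shift[OF E, of "\<lambda>\<xi>. h (heights (s + c) \<xi>)" a]
    by (simp add: up local_weight_heights Qn)
  moreover have "(\<integral>\<^sup>+s. (\<integral>\<^sup>+\<xi>. h (heights (s + c) \<xi>) * (\<Prod>v\<in>?E. ennreal (Q (\<xi> v - a v))) \<partial>noise) \<partial>count_space UNIV) =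
      (\<integral>\<^sup>+s. (\<integral>\<^sup>+\<xi>. h (heights s \<xi>) * (\<Prod>v\<in>?E. ennreal (Q (\<xi> v - a v))) \<partial>noise) \<partial>count_space UNIV)"
  proof (rule nn_integral_bij_count_space)
    show "bij (\<lambda>s. s + c)" by (rule bij_betw_byWitness[where f'="\<lambda>j. j - c"]) auto
  qed
  ultimately show ?thesis
    using Qn[of "\<lambda>v. - a v"] by (simp add: down local_weight_heights)
qed

subsection \<open>The Gibbs property\<close>

lemma window_local_shift:
  assumes "finite \<Lambda>" "\<omega> \<in> space (height_space d)"
  shows "local_shift d \<Lambda> \<theta> \<omega> \<in> window \<longleftrightarrow> \<omega> \<in> window"
  using assms by (simp add: window_def limit_average_local_shift)

lemma local_weight_measurable [measurable]:
  assumes "\<Lambda> \<subseteq> verts d"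
  shows "(\<lambda>\<omega>. ennreal (local_weight d Q \<Lambda> \<omega>)) \<in> borel_measurable (height_space d)"
proof -
  have "(\<lambda>\<omega>. Q (\<omega> v - \<omega> (butlast v))) \<in> borel_measurable (height_space d)" if "v \<in> touching d \<Lambda>" for v
  proof -
    have v: "v \<in> verts d" "butlast v \<in> verts d" using that by (auto simp: touching_def nonroot_def butlast_in_verts)
    show ?thesis
      by (rule measurable_count_space_binary[OF height_space_component[OF v(1)] height_space_component[OF v(2)]]) simp
  qed
  then show ?thesis unfolding local_weight_def
    by (intro measurable_compose[OF _ measurable_ennreal] borel_measurable_prod)
qed

lemma local_partition_measurable [measurable]:
  assumes "finite \<Lambda>" "\<Lambda> \<subseteq> verts d"
  shows "local_partition \<Lambda> \<in> borel_measurable (height_space d)"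
proof -
  note [measurable] = local_weight_measurable[OF assms(2)]
  show ?thesis
    unfolding local_partition_def[abs_def] using assms
    by (intro nn_integral_count_space_measurable countable_PiE) auto
qed

text \<open>A form of reversibility: for each displacement \<open>\<theta>\<close> the shift is
  moved from the test set to the weight, where it becomes its negative. Summing over
  \<open>\<theta>\<close> then rebuilds the partition function, which cancels the
  denominator.\<close>

theorem gibbs_measure_mu: "gibbs_measure d Q mu"
  unfolding gibbs_measure_def
proof (intro conjI allI impI)
  show "prob_space mu" by (rule mu.prob_space_axioms)
next
  show "sets mu = sets (height_space d)" by simp
next
  fix \<Lambda> A assume asm: "finite \<Lambda> \<and> \<Lambda> \<subseteq> verts d \<and> A \<in> sets (height_space d)"
  then have \<Lambda>: "finite \<Lambda>" "\<Lambda> \<subseteq> verts d" and A [measurable]: "A \<in> sets (height_space d)" by auto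
  note [measurable] = local_partition_measurable[OF \<Lambda>] local_weight_measurable[OF \<Lambda>(2)]
  let ?C = "\<Lambda> \<rightarrow>\<^sub>E (UNIV :: int set)"
  let ?Z = "local_partition \<Lambda>"
  let ?w = "\<lambda>\<omega>. ennreal (local_weight d Q \<Lambda> \<omega>)"
  let ?T = "local_shift d \<Lambda>"
  have C: "countable ?C" using \<Lambda> by (intro countable_PiE) auto
  have "(\<integral>\<^sup>+\<omega>. emeasure (gibbs_kernel d Q \<Lambda> \<omega>) A \<partial>mu) =
      (\<integral>\<^sup>+\<omega>. (\<integral>\<^sup>+\<theta>. ?w (?T \<theta> \<omega>) / ?Z \<omega> * indicator A (?T \<theta> \<omega>) \<partial>count_space ?C) \<partial>mu)"
    using \<Lambda> by (intro nn_integral_cong) (simp add: emeasure_gibbs_kernel)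
  also have "\<dots> = (\<integral>\<^sup>+\<theta>. (\<integral>\<^sup>+\<omega>. ?w (?T \<theta> \<omega>) / ?Z \<omega> * indicator A (?T \<theta> \<omega>) \<partial>mu) \<partial>count_space ?C)"
    by (rule nn_integral_count_space_nn_integral[OF C]) measurable
  also have "\<dots> = (\<integral>\<^sup>+\<theta>. (\<integral>\<^sup>+\<omega>. indicator A \<omega> / ?Z \<omega> * ?w (?T (\<lambda>x\<in>\<Lambda>. - \<theta> x) \<omega>) \<partial>mu) \<partial>count_space ?C)"
  proof (rule nn_integral_cong)
    fix \<theta>
    \<comment> \<open>The window and the partition function are both invariant under local shifts,
      so they may be included in the function to which quasi-invariance is applied.\<close>
    let ?h = "\<lambda>\<omega>. indicator A \<omega> * indicator window \<omega> / ?Z \<omega> :: ennreal"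
    have "(\<integral>\<^sup>+\<omega>. ?w (?T \<theta> \<omega>) / ?Z \<omega> * indicator A (?T \<theta> \<omega>) \<partial>mu) =
        (\<integral>\<^sup>+s. (\<integral>\<^sup>+\<xi>. ?h (?T \<theta> (heights s \<xi>)) * ?w (?T \<theta> (heights s \<xi>)) \<partial>noise) \<partial>count_space UNIV)"
      using \<Lambda> by (subst nn_integral_mu)
        (auto intro!: nn_integral_cong simp: window_local_shift local_partition_local_shift indicator_def
          divide_ennreal_def mult.commute)
    also have "\<dots> = (\<integral>\<^sup>+s. (\<integral>\<^sup>+\<xi>. ?h (heights s \<xi>) * ?w (?T (\<lambda>x\<in>\<Lambda>. - \<theta> x) (heights s \<xi>)) \<partial>noise) \<partial>count_space UNIV)"
      by (rule nn_integral_local_shift[OF \<Lambda>]) measurable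
    also have "\<dots> = (\<integral>\<^sup>+\<omega>. indicator A \<omega> / ?Z \<omega> * ?w (?T (\<lambda>x\<in>\<Lambda>. - \<theta> x) \<omega>) \<partial>mu)"
      by (subst nn_integral_mu) (auto intro!: nn_integral_cong simp: indicator_def)
    finally show "(\<integral>\<^sup>+\<omega>. ?w (?T \<theta> \<omega>) / ?Z \<omega> * indicator A (?T \<theta> \<omega>) \<partial>mu) =
      (\<integral>\<^sup>+\<omega>. indicator A \<omega> / ?Z \<omega> * ?w (?T (\<lambda>x\<in>\<Lambda>. - \<theta> x) \<omega>) \<partial>mu)" .
  qed
  also have "\<dots> = (\<integral>\<^sup>+\<omega>. (\<integral>\<^sup>+\<theta>. indicator A \<omega> / ?Z \<omega> * ?w (?T (\<lambda>x\<in>\<Lambda>. - \<theta> x) \<omega>) \<partial>count_space ?C) \<partial>mu)"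
    by (rule nn_integral_count_space_nn_integral[OF C, symmetric]) measurable
  also have "\<dots> = (\<integral>\<^sup>+\<omega>. indicator A \<omega> / ?Z \<omega> * ?Z \<omega> \<partial>mu)"
  proof (rule nn_integral_cong)
    fix \<omega>
    have "(\<integral>\<^sup>+\<theta>. ?w (?T (\<lambda>x\<in>\<Lambda>. - \<theta> x) \<omega>) \<partial>count_space ?C) = ?Z \<omega>"
      unfolding local_partition_def by (rule nn_integral_bij_count_space[OF bij_betw_local_uminus])
    then show "(\<integral>\<^sup>+\<theta>. indicator A \<omega> / ?Z \<omega> * ?w (?T (\<lambda>x\<in>\<Lambda>. - \<theta> x) \<omega>) \<partial>count_space ?C) = indicator A \<omega> / ?Z \<omega> * ?Z \<omega>"
      by (simp add: nn_integral_cmult)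
  qed
  also have "\<dots> = (\<integral>\<^sup>+\<omega>. indicator A \<omega> \<partial>mu)"
  proof (rule nn_integral_cong)
    fix \<omega>
    have "?Z \<omega> \<noteq> 0" "?Z \<omega> \<noteq> top"
      using local_partition_pos[of \<Lambda> \<omega>] local_partition_finite[OF \<Lambda>, of \<omega>] by auto
    then show "indicator A \<omega> / ?Z \<omega> * ?Z \<omega> = (indicator A \<omega> :: ennreal)"
      by (simp add: ennreal_divide_times ennreal_divide_self less_top)
  qed
  finally show "(\<integral>\<^sup>+\<omega>. emeasure (gibbs_kernel d Q \<Lambda> \<omega>) A \<partial>mu) = emeasure mu A" by simp
qed

end

section \<open>Densities from exponentially decaying characteristic functions\<close>

text \<open>An Erlang density and its reflection together dominate the function up to a constant,
  which reduces integrability to known moments.\<close>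

lemma integrable_power_exp_abs:
  assumes "\<kappa> > 0"
  shows "integrable lborel (\<lambda>t::real. \<bar>t\<bar> ^ n * exp (- \<kappa> * \<bar>t\<bar>))"
proof -
  let ?e = "erlang_density n \<kappa>" and ?c = "fact n / \<kappa> ^ Suc n :: real"
  have e: "integrable lborel ?e"
  proof (rule integrableI_nonneg)
    show "(\<integral>\<^sup>+t. ennreal (?e t) \<partial>lborel) < \<infinity>"
      using nn_integral_erlang_ith_moment[OF assms, of n 0] by simp
  qed (use assms in auto)
  have e': "integrable lborel (\<lambda>t. ?e (- t))"
    using lborel_integrable_real_affine[OF e, of "-1" 0] by simp
  show ?thesis
  proof (rule Bochner_Integration.integrable_bound)
    show "integrable lborel (\<lambda>t. ?c * (?e t + ?e (- t)))"
      using e e' by (intro integrable_mult_right Bochner_Integration.integrable_add)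
    show "AE t in lborel. norm (\<bar>t\<bar> ^ n * exp (- \<kappa> * \<bar>t\<bar>)) \<le> norm (?c * (?e t + ?e (- t)))"
    proof (rule AE_I2)
      fix t :: real
      have 1: "?c * ?e \<bar>t\<bar> = \<bar>t\<bar> ^ n * exp (- \<kappa> * \<bar>t\<bar>)"
        using assms by (simp add: erlang_density_def)
      have "?e \<bar>t\<bar> \<le> ?e t + ?e (- t)"
        using assms by (cases "t \<ge> 0") auto
      then have "?c * ?e \<bar>t\<bar> \<le> ?c * (?e t + ?e (- t))"
        using assms by (intro mult_left_mono) auto
      then show "norm (\<bar>t\<bar> ^ n * exp (- \<kappa> * \<bar>t\<bar>)) \<le> norm (?c * (?e t + ?e (- t)))"
        unfolding 1[symmetric] using assms by (simp add: abs_of_nonneg)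
    qed
  qed measurable
qed

lemma DERIV_quadratic_bound:
  fixes f :: "real \<Rightarrow> real"
  assumes "\<And>h. \<bar>f (x + h) - f x - h * D\<bar> \<le> M * h\<^sup>2"
  shows "(f has_real_derivative D) (at x)"
  unfolding DERIV_def
proof (rule LIM_zero_cancel, rule Lim_null_comparison)
  show "\<forall>\<^sub>F h in at 0. norm ((f (x + h) - f x) / h - D) \<le> M * \<bar>h\<bar>"
    unfolding eventually_at_filter
  proof (rule always_eventually, safe)
    fix h :: real assume h: "h \<noteq> 0"
    have "norm ((f (x + h) - f x) / h - D) = \<bar>f (x + h) - f x - h * D\<bar> / \<bar>h\<bar>"
      using h by (simp add: field_simps flip: abs_divide)
    also have "\<dots> \<le> M * h\<^sup>2 / \<bar>h\<bar>" using assms[of h] by (intro divide_right_mono) auto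
    also have "\<dots> = M * \<bar>h\<bar>"
      using h by (simp add: field_simps power2_eq_square)
    finally show "norm ((f (x + h) - f x) / h - D) \<le> M * \<bar>h\<bar>" .
  qed
  have "((\<lambda>h. M * \<bar>h\<bar>) \<longlongrightarrow> M * \<bar>0\<bar>) (at (0::real))" by (intro tendsto_intros)
  then show "((\<lambda>h. M * \<bar>h\<bar>) \<longlongrightarrow> 0) (at (0::real))" by simp
qed

text \<open>A remainder that is quadratic in \<open>h\<close> with an integrable coefficient allows
  differentiation under the integral without a limit theorem; the exponentially decaying integrands
  below provide such bounds at every order.\<close>

lemma DERIV_Re_integral:
  fixes u u' :: "real \<Rightarrow> real \<Rightarrow> complex"
  assumes u: "\<And>x. integrable M (\<lambda>t. u x t)" and u': "integrable M (\<lambda>t. u' x t)"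
    and B: "integrable M B"
    and bnd: "\<And>h. AE t in M. norm (u (x + h) t - u x t - of_real h * u' x t) \<le> B t * h\<^sup>2"
  shows "((\<lambda>x. Re (\<integral>t. u x t \<partial>M)) has_real_derivative Re (\<integral>t. u' x t \<partial>M)) (at x)"
proof (rule DERIV_quadratic_bound)
  fix h :: real
  have "Re (\<integral>t. u (x + h) t \<partial>M) - Re (\<integral>t. u x t \<partial>M) - h * Re (\<integral>t. u' x t \<partial>M) =
      Re (\<integral>t. u (x + h) t - u x t - of_real h * u' x t \<partial>M)"
    using u u' by simp
  also have "\<bar>\<dots>\<bar> \<le> norm (\<integral>t. u (x + h) t - u x t - of_real h * u' x t \<partial>M)"
    by (rule abs_Re_le_cmod)
  also have "\<dots> \<le> (\<integral>t. norm (u (x + h) t - u x t - of_real h * u' x t) \<partial>M)"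
    by (rule integral_norm_bound)
  also have "\<dots> \<le> (\<integral>t. B t * h\<^sup>2 \<partial>M)"
    using bnd u u' B by (intro integral_mono_AE) auto
  also have "\<dots> = (\<integral>t. B t \<partial>M) * h\<^sup>2" by simp
  finally show "\<bar>Re (\<integral>t. u (x + h) t \<partial>M) - Re (\<integral>t. u x t \<partial>M) - h * Re (\<integral>t. u' x t \<partial>M)\<bar> \<le>
    (\<integral>t. B t \<partial>M) * h\<^sup>2" .
qed

lemma iexp_linear_bound: "norm (iexp u - 1 - \<i> * of_real u) \<le> u\<^sup>2"
proof -
  have "norm (iexp u - (\<Sum>k\<le>1. (\<i> * u) ^ k / fact k)) \<le> \<bar>u\<bar> ^ Suc 1 / fact (Suc 1)"
    by (rule iexp_approx1)
  also have "\<dots> \<le> u\<^sup>2" by (simp add: power2_eq_square)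
  finally show ?thesis by (simp add: diff_diff_eq)
qed

lemma iexp_lipschitz: "norm (iexp u - iexp v) \<le> \<bar>u - v\<bar>"
proof -
  have "iexp u - iexp v = iexp v * (iexp (u - v) - 1)"
    by (simp add: right_diff_distrib exp_add[symmetric])
  also have "norm \<dots> = norm (iexp (u - v) - 1)" by (simp add: norm_mult)
  also have "\<dots> \<le> \<bar>u - v\<bar>" using iexp_approx1[of "u - v" 0] by simp
  finally show ?thesis .
qed

text \<open>Half-open intervals form the generator for which the inversion formula computes the
  measure.\<close>

lemma Ioc_measure_eqI:
  fixes M N :: "real measure"
  assumes "sets M = sets borel" "sets N = sets borel" "finite_measure M"
    and "\<And>a b. a \<le> b \<Longrightarrow> emeasure M {a<..b} = emeasure N {a<..b}"
  shows "M = N"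
proof (rule measure_eqI_generator_eq[where E="range (\<lambda>(a, b). {a<..b})" and \<Omega>=UNIV and A="\<lambda>i. {- real i<..real i}"])
  interpret finite_measure M by fact
  show "Int_stable (range (\<lambda>(a, b). {a<..b::real}))"
  proof (rule Int_stableI)
    fix A B assume "A \<in> range (\<lambda>(a, b). {a<..b::real})" "B \<in> range (\<lambda>(a, b). {a<..b::real})"
    then obtain a b a' b' where "A = {a<..b}" "B = {a'<..b'}" by auto
    then have "A \<inter> B = {max a a'<..min b b'}" by auto
    then show "A \<inter> B \<in> range (\<lambda>(a, b). {a<..b::real})" by (auto intro!: image_eqI[of _ _ "(max a a', min b b')"])
  qed
  show "emeasure M X = emeasure N X" if X: "X \<in> range (\<lambda>(a, b). {a<..b::real})" for X
  proof -
    obtain p where "X = (case p of (a, b) \<Rightarrow> {a<..b})" using X by blast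
    then obtain a b where "X = {a<..b}" by (cases p) simp
    then show ?thesis using assms(4)[of a b] by (cases "a \<le> b") auto
  qed
  show "sets M = sigma_sets UNIV (range (\<lambda>(a, b). {a<..b::real}))"
    "sets N = sigma_sets UNIV (range (\<lambda>(a, b). {a<..b::real}))"
    using assms(1,2) by (simp_all add: borel_sigma_sets_Ioc)
  show "(\<Union>i. {- real i<..real i}) = UNIV"
  proof (intro equalityI subsetI UNIV_I)
    fix x :: real
    obtain n where "\<bar>x\<bar> < real n" using reals_Archimedean2 by blast
    then show "x \<in> (\<Union>i. {- real i<..real i})" by (intro UN_I[of n]) auto
  qed
  show "emeasure M {- real i<..real i} \<noteq> \<infinity>" for i using emeasure_finite by simp
qed auto

text \<open>Fourier inversion with an explicit Lipschitz constant, which depends on the law only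
  through \<open>K\<close> and \<open>\<kappa>\<close>. This uniformity is what the positivity
  argument uses.\<close>

proposition (in real_distribution) smooth_density:
  assumes \<kappa>: "\<kappa> > 0" and decay: "\<And>t. norm (char M t) \<le> K * exp (- \<kappa> * \<bar>t\<bar>)"
  obtains f where "M = density lborel (\<lambda>x. ennreal (f x))" "\<And>x. f x \<ge> 0" "smooth f"
    "\<And>x y. \<bar>f x - f y\<bar> \<le> (\<integral>t. \<bar>t\<bar> * (K * exp (- \<kappa> * \<bar>t\<bar>)) \<partial>lborel) * \<bar>x - y\<bar>"
proof -
  let ?\<phi> = "char M"
  \<comment> \<open>The integrand of the inversion integral, differentiated \<open>n\<close> times
    with respect to \<open>x\<close>; accordingly \<open>F n\<close> will be the \<open>n\<close>-th
    derivative of the density \<open>F 0\<close>.\<close>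
  define u where "u n x t = (- \<i> * of_real t) ^ n * iexp (- (t * x)) * ?\<phi> t" for n and x t :: real
  define F where "F n x = Re (\<integral>t. u n x t \<partial>lborel) / (2 * pi)" for n x
  have K: "K \<ge> 0" using decay[of 0] order_trans[OF norm_ge_zero] by fastforce
  have B: "integrable lborel (\<lambda>t. \<bar>t\<bar> ^ n * (K * exp (- \<kappa> * \<bar>t\<bar>)))" for n
    using integrable_mult_right[OF integrable_power_exp_abs[OF \<kappa>, of n], of K] by (simp add: ac_simps)
  have [measurable]: "u n x \<in> borel_measurable lborel" for n x unfolding u_def by measurable
  have norm_u: "norm (u n x t) = \<bar>t\<bar> ^ n * norm (?\<phi> t)" for n x t
    by (simp add: u_def norm_mult norm_power)
  have int_u: "integrable lborel (u n x)" for n x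
  proof (rule Bochner_Integration.integrable_bound[OF B[of n]])
    have "norm (u n x t) \<le> norm (\<bar>t\<bar> ^ n * (K * exp (- \<kappa> * \<bar>t\<bar>)))" for t
      using mult_left_mono[OF decay[of t], of "\<bar>t\<bar> ^ n"] K by (simp add: norm_u abs_mult)
    then show "AE t in lborel. norm (u n x t) \<le> norm (\<bar>t\<bar> ^ n * (K * exp (- \<kappa> * \<bar>t\<bar>)))" by simp
  qed measurable
  have F_deriv: "(F n has_real_derivative F (Suc n) x) (at x)" for n x
  proof -
    have "((\<lambda>x. Re (\<integral>t. u n x t \<partial>lborel)) has_real_derivative Re (\<integral>t. u (Suc n) x t \<partial>lborel)) (at x)"
    proof (rule DERIV_Re_integral[OF int_u int_u B[of "n + 2"]], rule AE_I2)
      fix h t :: real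
      have "u n (x + h) t - u n x t - of_real h * u (Suc n) x t =
          u n x t * (iexp (- (t * h)) - 1 - \<i> * of_real (- (t * h)))"
        by (simp add: u_def algebra_simps exp_add[symmetric])
      then have "norm (u n (x + h) t - u n x t - of_real h * u (Suc n) x t) =
          \<bar>t\<bar> ^ n * norm (?\<phi> t) * norm (iexp (- (t * h)) - 1 - \<i> * of_real (- (t * h)))"
        by (simp only: norm_mult norm_u)
      also have "\<dots> \<le> \<bar>t\<bar> ^ n * (K * exp (- \<kappa> * \<bar>t\<bar>)) * (- (t * h))\<^sup>2"
        using K by (intro mult_mono mult_left_mono decay iexp_linear_bound) auto
      also have "\<dots> = \<bar>t\<bar> ^ (n + 2) * (K * exp (- \<kappa> * \<bar>t\<bar>)) * h\<^sup>2"
        by (simp add: power_mult_distrib power_add power2_eq_square)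
      finally show "norm (u n (x + h) t - u n x t - of_real h * u (Suc n) x t) \<le>
          \<bar>t\<bar> ^ (n + 2) * (K * exp (- \<kappa> * \<bar>t\<bar>)) * h\<^sup>2" .
    qed
    from DERIV_cdivide[OF this, of "2 * pi"] show ?thesis by (simp add: F_def[abs_def])
  qed
  have "(deriv ^^ n) (F 0) = F n" for n
  proof (induction n)
    case (Suc n)
    then show ?case using DERIV_imp_deriv[OF F_deriv[of n]] by auto
  qed simp
  then have smooth: "smooth (F 0)"
    unfolding smooth_def field_differentiable_def using F_deriv by metis
  have lip: "\<bar>F 0 x - F 0 y\<bar> \<le> (\<integral>t. \<bar>t\<bar> * (K * exp (- \<kappa> * \<bar>t\<bar>)) \<partial>lborel) * \<bar>x - y\<bar>" for x y
  proof -
    have "\<bar>Re (\<integral>t. u 0 x t \<partial>lborel) - Re (\<integral>t. u 0 y t \<partial>lborel)\<bar> \<le> norm (\<integral>t. u 0 x t - u 0 y t \<partial>lborel)"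
      using int_u abs_Re_le_cmod[of "\<integral>t. u 0 x t - u 0 y t \<partial>lborel"]
      by (subst (asm) Bochner_Integration.integral_diff) auto
    also have "\<dots> \<le> (\<integral>t. norm (u 0 x t - u 0 y t) \<partial>lborel)"
      by (rule integral_norm_bound)
    also have "\<dots> \<le> (\<integral>t. \<bar>t\<bar> * (K * exp (- \<kappa> * \<bar>t\<bar>)) * \<bar>x - y\<bar> \<partial>lborel)"
    proof (rule integral_mono)
      fix t
      have "u 0 x t - u 0 y t = (iexp (- (t * x)) - iexp (- (t * y))) * ?\<phi> t"
        by (simp add: u_def algebra_simps)
      also have "norm \<dots> \<le> \<bar>- (t * x) - (- (t * y))\<bar> * (K * exp (- \<kappa> * \<bar>t\<bar>))"
        unfolding norm_mult by (intro mult_mono iexp_lipschitz decay) auto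
      also have "- (t * x) - (- (t * y)) = t * (y - x)" by (simp add: algebra_simps)
      finally show "norm (u 0 x t - u 0 y t) \<le> \<bar>t\<bar> * (K * exp (- \<kappa> * \<bar>t\<bar>)) * \<bar>x - y\<bar>"
        by (simp add: abs_mult abs_minus_commute ac_simps)
    qed (use int_u B[of 1] in auto)
    also have "\<dots> = (\<integral>t. \<bar>t\<bar> * (K * exp (- \<kappa> * \<bar>t\<bar>)) \<partial>lborel) * \<bar>x - y\<bar>" by simp
    finally have *: "\<bar>Re (\<integral>t. u 0 x t \<partial>lborel) - Re (\<integral>t. u 0 y t \<partial>lborel)\<bar> \<le>
      (\<integral>t. \<bar>t\<bar> * (K * exp (- \<kappa> * \<bar>t\<bar>)) \<partial>lborel) * \<bar>x - y\<bar>" .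
    have "\<bar>F 0 x - F 0 y\<bar> = \<bar>Re (\<integral>t. u 0 x t \<partial>lborel) - Re (\<integral>t. u 0 y t \<partial>lborel)\<bar> / (2 * pi)"
      by (simp add: F_def diff_divide_distrib[symmetric])
    \<comment> \<open>The factor 1 / (2 pi) is below one and is dropped to keep the constant
      simple.\<close>
    also have "\<dots> \<le> \<bar>Re (\<integral>t. u 0 x t \<partial>lborel) - Re (\<integral>t. u 0 y t \<partial>lborel)\<bar> / 1"
      using pi_gt3 by (intro divide_left_mono) auto
    finally show ?thesis using * by simp
  qed

  \<comment> \<open>The integrand of the inversion formula for an interval; \<open>G\<close> will be
    the distribution function up to an additive constant, with derivative
    \<open>F 0\<close>.\<close>
  define w where "w a x t = (iexp (- (t * a)) - iexp (- (t * x))) / (\<i> * of_real t) * ?\<phi> t" for a x t :: real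
  define G where "G x = Re (\<integral>t. w 0 x t \<partial>lborel) / (2 * pi)" for x
  have [measurable]: "w a x \<in> borel_measurable lborel" for a x unfolding w_def by measurable
  have norm_w: "norm (w a x t) \<le> \<bar>a - x\<bar> * norm (?\<phi> t)" for a x t
  proof (cases "t = 0")
    case False
    have "norm (iexp (- (t * a)) - iexp (- (t * x))) \<le> \<bar>- (t * a) - (- (t * x))\<bar>" by (rule iexp_lipschitz)
    also have "- (t * a) - (- (t * x)) = t * (x - a)" by (simp add: algebra_simps)
    finally have "norm ((iexp (- (t * a)) - iexp (- (t * x))) / (\<i> * of_real t)) \<le> \<bar>a - x\<bar>"
      using False by (simp add: norm_divide norm_mult abs_mult divide_le_eq abs_minus_commute mult.commute)
    then show ?thesis unfolding w_def norm_mult by (intro mult_right_mono) auto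
  qed (simp add: w_def)
  have int_\<phi>: "integrable lborel ?\<phi>"
    using int_u[of 0 0] by (simp add: u_def[abs_def])
  have int_w: "integrable lborel (w a x)" for a x
    by (rule Bochner_Integration.integrable_bound[of _ "\<lambda>t. \<bar>a - x\<bar> * norm (?\<phi> t)"])
      (use norm_w int_\<phi> in \<open>auto intro!: AE_I2 simp: abs_mult\<close>)
  have G_deriv: "(G has_real_derivative F 0 x) (at x)" for x
  proof -
    have "((\<lambda>x. Re (\<integral>t. w 0 x t \<partial>lborel)) has_real_derivative Re (\<integral>t. u 0 x t \<partial>lborel)) (at x)"
    proof (rule DERIV_Re_integral[OF int_w int_u B[of 1]])
      fix h :: real
      show "AE t in lborel. norm (w 0 (x + h) t - w 0 x t - of_real h * u 0 x t) \<le> \<bar>t\<bar> ^ 1 * (K * exp (- \<kappa> * \<bar>t\<bar>)) * h\<^sup>2"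
        using AE_lborel_singleton[of 0]
      proof eventually_elim
        case (elim t)
        have "w 0 (x + h) t - w 0 x t - of_real h * u 0 x t =
            - (iexp (- (t * x)) * (iexp (- (t * h)) - 1 - \<i> * of_real (- (t * h))) / (\<i> * of_real t) * ?\<phi> t)"
          using elim by (simp add: w_def u_def field_simps exp_add[symmetric])
        then have "norm (w 0 (x + h) t - w 0 x t - of_real h * u 0 x t) =
            norm (iexp (- (t * h)) - 1 - \<i> * of_real (- (t * h))) / \<bar>t\<bar> * norm (?\<phi> t)"
          by (simp only: norm_minus_cancel norm_mult norm_divide norm_exp_i_times norm_of_real norm_ii mult_1)
        also have "\<dots> \<le> (- (t * h))\<^sup>2 / \<bar>t\<bar> * (K * exp (- \<kappa> * \<bar>t\<bar>))"
          by (intro mult_mono divide_right_mono iexp_linear_bound decay) auto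
        also have "(- (t * h))\<^sup>2 / \<bar>t\<bar> = \<bar>t\<bar> * h\<^sup>2"
        proof -
          have "(- (t * h))\<^sup>2 = \<bar>t\<bar> * (\<bar>t\<bar> * h\<^sup>2)"
            by (simp add: power_mult_distrib power2_eq_square)
          then show ?thesis using elim by simp
        qed
        finally show ?case by (simp add: ac_simps)
      qed
    qed
    from DERIV_cdivide[OF this, of "2 * pi"] show ?thesis by (simp add: F_def[abs_def] G_def[abs_def])
  qed
  then have G_cont: "isCont G x" for x by (rule DERIV_isCont)
  have w_G: "Re (\<integral>t. w a b t \<partial>lborel) / (2 * pi) = G b - G a" for a b
  proof -
    have "w a b t = w 0 b t - w 0 a t" for t by (simp add: w_def diff_divide_distrib algebra_simps)
    then show ?thesis using int_w by (simp add: G_def diff_divide_distrib)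
  qed
  have inv: "measure M {a<..b} = G b - G a" if "a \<le> b" "measure M {a} = 0" "measure M {b} = 0" for a b
  proof -
    have "(\<lambda>T. \<integral>t. indicator {- real T<..<real T} t *\<^sub>R w a b t \<partial>lborel) \<longlonglongrightarrow> (\<integral>t. w a b t \<partial>lborel)"
    proof (rule integral_dominated_convergence[where w="\<lambda>t. norm (w a b t)"])
      show "AE t in lborel. (\<lambda>T. indicator {- real T<..<real T} t *\<^sub>R w a b t) \<longlonglongrightarrow> w a b t"
      proof (rule AE_I2, rule tendsto_eventually)
        fix t :: real
        obtain N where N: "\<bar>t\<bar> < real N" using reals_Archimedean2 by blast
        show "\<forall>\<^sub>F T in sequentially. indicator {- real T<..<real T} t *\<^sub>R w a b t = w a b t"
          using eventually_ge_at_top[of N]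
        proof eventually_elim
          case (elim T)
          then have "real N \<le> real T" by simp
          then have "t \<in> {- real T<..<real T}" using N by auto
          then show ?case by simp
        qed
      qed
    qed (use int_w in \<open>auto simp: indicator_def\<close>)
    moreover have "(CLBINT t=- real T..real T. w a b t) = (\<integral>t. indicator {- real T<..<real T} t *\<^sub>R w a b t \<partial>lborel)" for T
      by (simp add: interval_lebesgue_integral_def set_lebesgue_integral_def)
    ultimately have "(\<lambda>T. 1 / (2 * pi) * (CLBINT t=- real T..real T. w a b t)) \<longlonglongrightarrow> 1 / (2 * pi) * (\<integral>t. w a b t \<partial>lborel)"
      by (intro tendsto_mult tendsto_const) simp
    moreover have "(\<lambda>T. 1 / (2 * pi) * (CLBINT t=- real T..real T. w a b t)) \<longlonglongrightarrow> measure M {a<..b}"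
      using Levy_Inversion[OF that] unfolding w_def by simp
    ultimately have "of_real (measure M {a<..b}) = 1 / (2 * pi) * (\<integral>t. w a b t \<partial>lborel)"
      by (rule LIMSEQ_unique[rotated])
    then have "measure M {a<..b} = Re (1 / (2 * pi) * (\<integral>t. w a b t \<partial>lborel))"
      by (metis Re_complex_of_real)
    then show ?thesis using w_G[of a b] by (simp add: Re_divide_of_real)
  qed
  \<comment> \<open>The inversion formula holds for endpoints without mass. Atoms are countable, so
    such endpoints lie on both sides of any point and arbitrarily close to it; continuity of
    \<open>G\<close> then excludes atoms altogether.\<close>
  have good: "\<exists>x\<in>{a<..<b}. measure M {x} = 0" if "a < b" for a b
    using real_interval_avoid_countable_set[OF that countable_support] by auto
  have no_atom: "measure M {x} = 0" for x
  proof (rule ccontr)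
    assume "measure M {x} \<noteq> 0"
    then have pos: "measure M {x} > 0" by (simp add: zero_less_measure_iff)
    then obtain \<delta> where \<delta>: "\<delta> > 0" "\<And>y. \<bar>y - x\<bar> < \<delta> \<Longrightarrow> \<bar>G y - G x\<bar> < measure M {x} / 2"
      using G_cont[of x] unfolding continuous_at_eps_delta by (metis dist_real_def half_gt_zero)
    obtain a where a: "x - \<delta> < a" "a < x" "measure M {a} = 0" using good[of "x - \<delta>" x] \<delta>(1) by auto
    obtain b where b: "x < b" "b < x + \<delta>" "measure M {b} = 0" using good[of x "x + \<delta>"] \<delta>(1) by auto
    have "measure M {x} \<le> measure M {a<..b}" using a b by (intro finite_measure_mono) auto
    also have "\<dots> = G b - G a" using a b by (intro inv) auto
    also have "\<dots> < measure M {x}" using \<delta>(2)[of a] \<delta>(2)[of b] a b by linarith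
    finally show False by simp
  qed
  have inv': "measure M {a<..b} = G b - G a" if "a \<le> b" for a b
    using inv that no_atom by blast
  have F_nonneg: "F 0 x \<ge> 0" for x
  proof (rule ccontr)
    assume "\<not> F 0 x \<ge> 0"
    then obtain \<delta> where \<delta>: "\<delta> > 0" "\<And>h. 0 < h \<Longrightarrow> h < \<delta> \<Longrightarrow> G (x + h) < G x"
      using DERIV_neg_dec_right[OF G_deriv[of x]] by auto
    then have "G (x + \<delta> / 2) < G x" by simp
    then show False using inv'[of x "x + \<delta> / 2"] \<delta>(1) measure_nonneg[of M "{x<..x + \<delta> / 2}"] by simp
  qed
  have [measurable]: "F 0 \<in> borel_measurable borel"
    by (intro borel_measurable_continuous_onI continuous_at_imp_continuous_on ballI DERIV_isCont[OF F_deriv])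
  have "M = density lborel (\<lambda>x. ennreal (F 0 x))"
  proof (rule Ioc_measure_eqI)
    fix a b :: real assume ab: "a \<le> b"
    have "emeasure (density lborel (\<lambda>x. ennreal (F 0 x))) {a<..b} = (\<integral>\<^sup>+x. ennreal (F 0 x) * indicator {a<..b} x \<partial>lborel)"
      by (rule emeasure_density) auto
    also have "\<dots> = (\<integral>\<^sup>+x. ennreal (F 0 x) * indicator {a..b} x \<partial>lborel)"
      using AE_lborel_singleton[of a] by (intro nn_integral_cong_AE, eventually_elim) (auto simp: indicator_def)
    also have "\<dots> = ennreal (G b - G a)"
      using ab F_nonneg G_deriv
      by (intro nn_integral_FTC_Icc) (auto intro: has_field_derivative_at_within simp: has_real_derivative_iff_has_vector_derivative[symmetric])
    also have "\<dots> = emeasure M {a<..b}" using inv'[OF ab] by (simp add: emeasure_eq_measure)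
    finally show "emeasure M {a<..b} = emeasure (density lborel (\<lambda>x. ennreal (F 0 x))) {a<..b}" ..
  qed (use finite_measure_axioms in auto)
  then show ?thesis using F_nonneg smooth lip by (rule that)
qed

section \<open>Decay of the characteristic function, uniformly in the kept increments\<close>

lemma cos_le_quadratic:
  fixes u :: real
  assumes "\<bar>u\<bar> \<le> 1" shows "cos u \<le> 1 - u\<^sup>2 / 3"
proof -
  have "Re (iexp u - (\<Sum>k\<le>2. (\<i> * u) ^ k / fact k)) \<le> \<bar>u\<bar> ^ Suc 2 / fact (Suc 2)"
    by (rule order_trans[OF complex_Re_le_cmod iexp_approx1])
  then have "cos u - (1 - u\<^sup>2 / 2) \<le> \<bar>u\<bar> ^ 3 / 6"
    by (simp add: numeral_2_eq_2 numeral_3_eq_3 Re_exp power2_eq_square)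
  also have "\<bar>u\<bar> ^ 3 \<le> u\<^sup>2"
    using assms power_decreasing[of 2 3 "\<bar>u\<bar>"] by simp
  finally show ?thesis by simp
qed

text \<open>The square of the norm is 2 + 2 cos u, at most 4 - 2 u^2 / 3, and this is the square of
  the right-hand side without its fourth-order term.\<close>

lemma norm_one_plus_iexp_le:
  assumes "\<bar>u\<bar> \<le> 1" shows "norm (1 + iexp u) \<le> 2 - u\<^sup>2 / 6"
proof -
  have u2: "u\<^sup>2 \<le> 1" using assms by (simp add: abs_square_le_1)
  have "(norm (1 + iexp u))\<^sup>2 = (1 + cos u)\<^sup>2 + (sin u)\<^sup>2"
    by (simp add: cmod_power2 Re_exp Im_exp)
  also have "\<dots> = 2 + 2 * cos u"
    using sin_cos_squared_add[of u] by (simp add: power2_sum)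
  also have "\<dots> \<le> 4 - 2 * u\<^sup>2 / 3" using cos_le_quadratic[OF assms] by simp
  also have "\<dots> \<le> (2 - u\<^sup>2 / 6)\<^sup>2" by (simp add: power2_diff)
  finally show ?thesis by (rule power2_le_imp_le) (use u2 in simp)
qed

lemma density_interval_ge:
  assumes "f \<in> borel_measurable borel" "\<And>y. y \<in> {l<..<u} \<Longrightarrow> a \<le> f y" "a \<ge> 0" "l \<le> u"
  shows "ennreal (a * (u - l)) \<le> emeasure (density lborel (\<lambda>x. ennreal (f x))) {l<..<u}"
proof -
  have "ennreal (a * (u - l)) = (\<integral>\<^sup>+x. ennreal a * indicator {l<..<u} x \<partial>lborel)"
    using assms by (simp add: nn_integral_cmult ennreal_mult)
  also have "\<dots> \<le> (\<integral>\<^sup>+x. ennreal (f x) * indicator {l<..<u} x \<partial>lborel)"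
    using assms(2) by (intro nn_integral_mono) (auto simp: indicator_def intro!: ennreal_leI)
  also have "\<dots> = emeasure (density lborel (\<lambda>x. ennreal (f x))) {l<..<u}"
    using assms by (subst emeasure_density) auto
  finally show ?thesis .
qed

lemma density_interval_le:
  assumes "f \<in> borel_measurable borel" "\<And>y. y \<in> {l<..<u} \<Longrightarrow> f y \<le> a" "a \<ge> 0" "l \<le> u"
  shows "emeasure (density lborel (\<lambda>x. ennreal (f x))) {l<..<u} \<le> ennreal (a * (u - l))"
proof -
  have "emeasure (density lborel (\<lambda>x. ennreal (f x))) {l<..<u} = (\<integral>\<^sup>+x. ennreal (f x) * indicator {l<..<u} x \<partial>lborel)"
    using assms by (subst emeasure_density) auto
  also have "\<dots> \<le> (\<integral>\<^sup>+x. ennreal a * indicator {l<..<u} x \<partial>lborel)"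
    using assms(2) by (intro nn_integral_mono) (auto simp: indicator_def intro!: ennreal_leI)
  also have "\<dots> = ennreal (a * (u - l))"
    using assms by (simp add: nn_integral_cmult ennreal_mult)
  finally show ?thesis .
qed

context tree_gradient
begin

definition char_q :: "real \<Rightarrow> complex" where
  "char_q u = (\<integral>j. iexp (u * real_of_int j) \<partial>q)"

text \<open>If mass m is split off at both 0 and 1, the bound 1 - 2 m + m (2 - u^2 / 6) results; its
  quadratic coefficient m / 6 is the rate.\<close>

definition char_rate :: real where
  "char_rate = min (prob 0) (prob 1) / 6"

lemma char_rate_pos: "char_rate > 0"
  using prob_pos by (simp add: char_rate_def)

lemma measure_q_singleton: "measure q {j} = prob j"
  using emeasure_q_singleton[of j] less_imp_le[OF prob_pos[of j]] by (simp add: measure_def)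

text \<open>Splitting off an equal amount of mass at \<open>0\<close> and at \<open>1\<close>.\<close>

lemma norm_char_q_le:
  assumes u: "\<bar>u\<bar> \<le> 1"
  shows "norm (char_q u) \<le> exp (- char_rate * u\<^sup>2)"
proof -
  define m where "m = min (prob 0) (prob 1)"
  have m: "0 < m" "m \<le> prob 0" "m \<le> prob 1" using prob_pos by (auto simp: m_def)
  \<comment> \<open>The fraction of the mass at \<open>j\<close> that is split off, chosen so that
    exactly \<open>m\<close> is taken at 0 and at 1.\<close>
  define w :: "int \<Rightarrow> real" where "w j = (if j = 0 then m / prob 0 else if j = 1 then m / prob 1 else 0)" for j
  have w: "0 \<le> w j" "w j \<le> 1" for j
    using m prob_pos[of 0] prob_pos[of 1] by (auto simp: w_def)
  have int: "integrable q g" if "\<And>j. norm (g j) \<le> 1" for g :: "int \<Rightarrow> 'b::{banach, second_countable_topology}"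
    using that by (intro q.integrable_const_bound[where B=1]) auto
  have i1: "integrable q (\<lambda>j. (1 - w j) *\<^sub>R iexp (u * real_of_int j))"
    and i2: "integrable q (\<lambda>j. w j *\<^sub>R iexp (u * real_of_int j))"
    and iw: "integrable q (\<lambda>j. 1 - w j)" "integrable q w"
    using w by (auto intro!: int)
  have two: "(\<integral>j. w j *\<^sub>R g j \<partial>q) = m *\<^sub>R (g 0 + g 1)" for g :: "int \<Rightarrow> 'b::{banach, second_countable_topology}"
  proof -
    define a b where "a = (m / prob 0) *\<^sub>R g 0" and "b = (m / prob 1) *\<^sub>R g 1"
    have "(\<integral>j. w j *\<^sub>R g j \<partial>q) = (\<integral>j. indicator {0} j *\<^sub>R a + indicator {1} j *\<^sub>R b \<partial>q)"
      by (intro Bochner_Integration.integral_cong) (auto simp: w_def indicator_def a_def b_def)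
    also have "\<dots> = measure q {0} *\<^sub>R a + measure q {1} *\<^sub>R b"
      by (subst Bochner_Integration.integral_add) (auto simp: q.emeasure_eq_measure)
    also have "\<dots> = m *\<^sub>R (g 0 + g 1)"
      using prob_pos[of 0] prob_pos[of 1]
      by (simp add: measure_q_singleton scaleR_add_right a_def b_def)
    finally show ?thesis .
  qed
  have "char_q u = (\<integral>j. (1 - w j) *\<^sub>R iexp (u * real_of_int j) + w j *\<^sub>R iexp (u * real_of_int j) \<partial>q)"
    unfolding char_q_def by (intro Bochner_Integration.integral_cong) (auto simp: scaleR_left_distrib[symmetric])
  also have "\<dots> = (\<integral>j. (1 - w j) *\<^sub>R iexp (u * real_of_int j) \<partial>q) + m *\<^sub>R (1 + iexp u)"
    unfolding Bochner_Integration.integral_add[OF i1 i2] two by simp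
  finally have "norm (char_q u) \<le> norm (\<integral>j. (1 - w j) *\<^sub>R iexp (u * real_of_int j) \<partial>q) + norm (m *\<^sub>R (1 + iexp u))"
    by (simp only: norm_triangle_ineq)
  also have "\<dots> \<le> (1 - 2 * m) + m * (2 - u\<^sup>2 / 6)"
  proof (rule add_mono)
    have "norm (\<integral>j. (1 - w j) *\<^sub>R iexp (u * real_of_int j) \<partial>q) \<le> (\<integral>j. norm ((1 - w j) *\<^sub>R iexp (u * real_of_int j)) \<partial>q)"
      by (rule integral_norm_bound)
    also have "\<dots> = (\<integral>j. 1 - w j \<partial>q)"
      using w by (intro Bochner_Integration.integral_cong) auto
    also have "\<dots> = 1 - 2 * m"
      using iw two[of "\<lambda>_. 1 :: real"] by (simp add: q.prob_space[simplified])
    finally show "norm (\<integral>j. (1 - w j) *\<^sub>R iexp (u * real_of_int j) \<partial>q) \<le> 1 - 2 * m" .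
    show "norm (m *\<^sub>R (1 + iexp u)) \<le> m * (2 - u\<^sup>2 / 6)"
      using m norm_one_plus_iexp_le[OF u] by (simp add: mult_left_mono)
  qed
  also have "\<dots> = 1 + (- char_rate * u\<^sup>2)" by (simp add: char_rate_def m_def algebra_simps)
  also have "\<dots> \<le> exp (- char_rate * u\<^sup>2)" by (rule exp_ge_add_one_self)
  finally show ?thesis .
qed

text \<open>Here \<open>G\<close> stands for the contribution of all other increments; resampling
  the coordinates of \<open>F\<close> one by one extracts a factor \<open>char_q u\<close> each
  time.\<close>

lemma integral_char_prod:
  assumes "finite F" "F \<subseteq> nonroot d" and G: "G \<in> borel_measurable noise" "\<And>\<xi>. norm (G \<xi>) \<le> 1"
    and ind: "\<And>\<xi> v j. v \<in> F \<Longrightarrow> G (\<xi>(v := j)) = G \<xi>"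
  shows "(\<integral>\<xi>. (\<Prod>v\<in>F. iexp (u * real_of_int (\<xi> v))) * G \<xi> \<partial>noise) = char_q u ^ card F * (\<integral>\<xi>. G \<xi> \<partial>noise)"
  using assms(1,2) ind
proof (induction F rule: finite_induct)
  case (insert v F)
  have v: "v \<in> nonroot d" and F: "F \<subseteq> nonroot d" using insert by auto
  note [measurable] = G(1)
  let ?R = "\<lambda>\<xi>. (\<Prod>v\<in>F. iexp (u * real_of_int (\<xi> v))) * G \<xi>"
  have [measurable]: "(\<lambda>\<xi>. iexp (u * real_of_int (\<xi> v))) \<in> borel_measurable noise" if "v \<in> nonroot d" for v
    using noise_component_real[OF that] by measurable
  have [measurable]: "?R \<in> borel_measurable noise"
    using F by (intro borel_measurable_times borel_measurable_prod G) auto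
  have R: "?R (\<xi>(v := j)) = ?R \<xi>" for \<xi> j
  proof -
    have "G (\<xi>(v := j)) = G \<xi>" by (rule insert.prems(2)) simp
    moreover have "(\<Prod>u'\<in>F. iexp (u * real_of_int ((\<xi>(v := j)) u'))) = (\<Prod>u'\<in>F. iexp (u * real_of_int (\<xi> u')))"
      using insert.hyps by (intro prod.cong) auto
    ultimately show ?thesis by (simp only:)
  qed
  have "(\<integral>\<xi>. (\<Prod>v\<in>insert v F. iexp (u * real_of_int (\<xi> v))) * G \<xi> \<partial>noise) =
      (\<integral>\<xi>. iexp (u * real_of_int (\<xi> v)) * ?R \<xi> \<partial>noise)"
    using insert.hyps by (simp add: mult.assoc)
  also have "\<dots> = (\<integral>\<xi>. (\<integral>j. iexp (u * real_of_int ((\<xi>(v := j)) v)) * ?R (\<xi>(v := j)) \<partial>q) \<partial>noise)"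
  proof (rule integral_resample[OF v, where B=1])
    show "(\<lambda>\<xi>. iexp (u * real_of_int (\<xi> v)) * ?R \<xi>) \<in> borel_measurable noise"
      using v by measurable
    show "norm (iexp (u * real_of_int (\<xi> v)) * ?R \<xi>) \<le> 1" for \<xi>
      using G(2)[of \<xi>] by (simp only: norm_mult norm_exp_i_times prod_norm[symmetric] mult_1 prod.neutral_const)
  qed
  also have "\<dots> = (\<integral>\<xi>. char_q u * ?R \<xi> \<partial>noise)"
    unfolding R by (simp add: char_q_def)
  also have "\<dots> = char_q u * (char_q u ^ card F * (\<integral>\<xi>. G \<xi> \<partial>noise))"
    using insert F by simp
  finally show ?case using insert.hyps by simp
qed simp

text \<open>Deleting \<open>F\<close> alters a single term of a convergent series. The finite energy
  is used to know that the series converges.\<close>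

lemma level_average_remove:
  assumes "energy D \<xi> < top" "F \<subseteq> level d m \<inter> D"
  shows "level_sum D \<xi> = (\<Sum>v\<in>F. real_of_int (\<xi> v)) / real (card (level d m)) + level_sum (D - F) \<xi>"
proof -
  let ?a = "(\<Sum>v\<in>F. real_of_int (\<xi> v)) / real (card (level d m))"
  have "level_average (D - F) n \<xi> = level_average D n \<xi> - (if n = m then ?a else 0)" for n
  proof (cases "n = m")
    case True
    have "level d m \<inter> (D - F) = (level d m \<inter> D) - F" by auto
    then have "(\<Sum>v\<in>level d m \<inter> (D - F). real_of_int (\<xi> v)) =
        (\<Sum>v\<in>level d m \<inter> D. real_of_int (\<xi> v)) - (\<Sum>v\<in>F. real_of_int (\<xi> v))"
      using assms(2) by (simp add: sum_diff)
    then show ?thesis using True by (simp add: level_average_def diff_divide_distrib)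
  next
    case False
    then have "level d n \<inter> (D - F) = level d n \<inter> D" using assms(2) by (auto simp: level_def)
    then show ?thesis using False by (simp add: level_average_def)
  qed
  then have "(\<lambda>n. level_average (D - F) n \<xi>) sums (level_sum D \<xi> - ?a)"
    using sums_diff[OF level_average_sums[OF assms(1)] sums_single[of m "\<lambda>_. ?a"]] by simp
  then have "level_sum (D - F) \<xi> = level_sum D \<xi> - ?a" by (simp add: level_sum_def sums_iff)
  then show ?thesis by simp
qed

lemma level_sum_cong: "(\<And>v. v \<in> D \<Longrightarrow> \<xi> v = \<xi>' v) \<Longrightarrow> level_sum D \<xi> = level_sum D \<xi>'"
  unfolding level_sum_def level_average_def
  by (intro suminf_cong arg_cong2[where f="(/)"] sum.cong) auto

definition level_law :: "nat list set \<Rightarrow> real measure" where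
  "level_law D = distr noise borel (level_sum D)"

lemma real_distribution_level_law: "D \<subseteq> nonroot d \<Longrightarrow> real_distribution (level_law D)"
  unfolding level_law_def by (rule noise.real_distribution_distr) simp

text \<open>The increments of one level \<open>m\<close> factor out of the characteristic function,
  and the contribution of everything else has norm at most one. The restriction on \<open>t\<close>
  puts the argument of \<open>char_q\<close> into the range of the quadratic bound.\<close>

lemma char_level_law:
  assumes D: "D \<subseteq> nonroot d" and t: "\<bar>t\<bar> \<le> real (card (level d m))"
  shows "norm (char (level_law D) t) \<le>
    exp (- char_rate * t\<^sup>2 * real (card (level d m \<inter> D)) / (real (card (level d m)))\<^sup>2)"
proof -
  let ?N = "real (card (level d m))" and ?F = "level d m \<inter> D"
  note [measurable] = level_sum_measurable[OF D]
  have N: "?N > 0" using card_level_pos[OF d_ge_2] by simp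
  let ?G = "\<lambda>\<xi>. iexp (t * level_sum (D - ?F) \<xi>)"
  have [measurable]: "level_sum (D - ?F) \<in> borel_measurable noise"
    using D by (intro level_sum_measurable) auto
  have G: "?G \<in> borel_measurable noise" by measurable
  have "char (level_law D) t = (\<integral>\<xi>. iexp (t * level_sum D \<xi>) \<partial>noise)"
    unfolding char_def level_law_def by (subst integral_distr) auto
  also have "\<dots> = (\<integral>\<xi>. (\<Prod>v\<in>?F. iexp ((t / ?N) * real_of_int (\<xi> v))) * ?G \<xi> \<partial>noise)"
  proof (rule integral_cong_AE)
    show "AE \<xi> in noise. iexp (t * level_sum D \<xi>) = (\<Prod>v\<in>?F. iexp ((t / ?N) * real_of_int (\<xi> v))) * ?G \<xi>"
      using AE_energy_finite[OF D]
    proof eventually_elim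
      case (elim \<xi>)
      have "(\<Prod>v\<in>?F. iexp ((t / ?N) * real_of_int (\<xi> v))) = iexp (\<Sum>v\<in>?F. (t / ?N) * real_of_int (\<xi> v))"
        by (simp add: exp_sum sum_distrib_left)
      moreover have "t * level_sum D \<xi> = (\<Sum>v\<in>?F. (t / ?N) * real_of_int (\<xi> v)) + t * level_sum (D - ?F) \<xi>"
        using level_average_remove[OF elim order_refl, of m]
        by (simp add: sum_distrib_left sum_divide_distrib distrib_left)
      ultimately show ?case by (simp only: of_real_add distrib_left exp_add)
    qed
    have "(\<lambda>\<xi>. iexp ((t / ?N) * real_of_int (\<xi> v))) \<in> borel_measurable noise" if "v \<in> ?F" for v
    proof -
      have [measurable]: "(\<lambda>\<xi>. real_of_int (\<xi> v)) \<in> borel_measurable noise"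
        using that D by (intro noise_component_real) auto
      show ?thesis by measurable
    qed
    then show "(\<lambda>\<xi>. (\<Prod>v\<in>?F. iexp ((t / ?N) * real_of_int (\<xi> v))) * ?G \<xi>) \<in> borel_measurable noise"
      using G by (intro borel_measurable_times borel_measurable_prod)
  qed measurable
  also have "\<dots> = char_q (t / ?N) ^ card ?F * (\<integral>\<xi>. ?G \<xi> \<partial>noise)"
  proof (rule integral_char_prod)
    show "?G (\<xi>(v := j)) = ?G \<xi>" if "v \<in> ?F" for \<xi> v j
    proof -
      have "level_sum (D - ?F) (\<xi>(v := j)) = level_sum (D - ?F) \<xi>"
        by (rule level_sum_cong) (use that in auto)
      then show ?thesis by simp
    qed
  qed (use D G in auto)
  finally have "norm (char (level_law D) t) = norm (char_q (t / ?N)) ^ card ?F * norm (\<integral>\<xi>. ?G \<xi> \<partial>noise)"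
    by (simp add: norm_mult norm_power)
  also have "\<dots> \<le> exp (- char_rate * (t / ?N)\<^sup>2) ^ card ?F * 1"
  proof (intro mult_mono power_mono norm_char_q_le)
    show "\<bar>t / ?N\<bar> \<le> 1" using t N by simp
    have "norm (\<integral>\<xi>. ?G \<xi> \<partial>noise) \<le> (\<integral>\<xi>. norm (?G \<xi>) \<partial>noise)" by (rule integral_norm_bound)
    then show "norm (\<integral>\<xi>. ?G \<xi> \<partial>noise) \<le> 1" by (simp add: noise.prob_space)
  qed auto
  also have "\<dots> = exp (- char_rate * t\<^sup>2 * real (card ?F) / ?N\<^sup>2)"
    by (simp add: exp_of_nat_mult[symmetric] power_divide ac_simps)
  finally show ?thesis .
qed

text \<open>A level of size N with at least half of its increments kept gives the exponent
  \<open>char_rate\<close> t^2 / (2 N), and the level can be chosen with N at most d |t|.\<close>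

definition decay_rate :: real where "decay_rate = char_rate / (2 * real d)"

text \<open>Chosen so that the exponential bound is at least one, hence trivial, for |t| up to d +
  1, the size of the first level.\<close>

definition decay_const :: real where "decay_const = exp (decay_rate * (real d + 1))"

lemma decay_rate_pos: "decay_rate > 0"
  using char_rate_pos d_ge_2 by (simp add: decay_rate_def)

text \<open>The bound comes from a single level, the first one whose size exceeds \<open>|t|\<close>.\<close>

lemma char_level_law_decay:
  assumes D: "D \<subseteq> nonroot d" "\<And>n. n \<ge> 1 \<Longrightarrow> card (level d n) \<le> 2 * card (level d n \<inter> D)"
  shows "norm (char (level_law D) t) \<le> decay_const * exp (- decay_rate * \<bar>t\<bar>)"
proof (cases "\<bar>t\<bar> \<le> real d + 1")
  case True
  interpret L: real_distribution "level_law D" by (rule real_distribution_level_law[OF D(1)])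
  have "norm (char (level_law D) t) \<le> 1" by (rule L.cmod_char_le_1)
  also have "1 \<le> exp (decay_rate * (real d + 1 - \<bar>t\<bar>))" using True decay_rate_pos by simp
  also have "\<dots> = decay_const * exp (- decay_rate * \<bar>t\<bar>)"
    by (simp add: decay_const_def exp_add[symmetric] algebra_simps)
  finally show ?thesis .
next
  case False
  let ?N = "\<lambda>n. real (card (level d n))"
  obtain n where "\<bar>t\<bar> < real n" using reals_Archimedean2 by blast
  also have "real n < 2 ^ n" using of_nat_less_two_power by simp
  also have "\<dots> \<le> ?N n" by (rule card_level_ge[OF d_ge_2])
  finally have ex: "\<bar>t\<bar> \<le> ?N n" by simp
  define m where "m = (LEAST n. \<bar>t\<bar> \<le> ?N n)"
  have m: "\<bar>t\<bar> \<le> ?N m" unfolding m_def by (rule LeastI[of "\<lambda>n. \<bar>t\<bar> \<le> ?N n", OF ex])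
  \<comment> \<open>As |t| exceeds the size d + 1 of the first level, the preceding level
    \<open>k\<close> is at least the first, and from there on sizes grow by the factor d
    exactly.\<close>
  have "m > 1"
    using m False card_level[of d m] by (cases m; cases "m - 1") auto
  then obtain k where k: "m = Suc k" "k \<ge> 1" by (cases m) auto
  have "\<not> \<bar>t\<bar> \<le> ?N k" using not_less_Least[of k "\<lambda>n. \<bar>t\<bar> \<le> ?N n"] k by (simp add: m_def)
  then have Nm: "?N m \<le> real d * \<bar>t\<bar>"
    using k card_level_Suc[of k d] by (simp add: mult_left_mono)
  have Npos: "?N m > 0" using card_level_pos[OF d_ge_2] by simp
  have F: "?N m / 2 \<le> real (card (level d m \<inter> D))" using D(2)[of m] k by simp
  have "norm (char (level_law D) t) \<le> exp (- char_rate * t\<^sup>2 * real (card (level d m \<inter> D)) / (?N m)\<^sup>2)"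
    by (rule char_level_law[OF D(1) m])
  also have "\<dots> \<le> exp (- decay_rate * \<bar>t\<bar>)"
  proof -
    have "decay_rate * \<bar>t\<bar> = char_rate * t\<^sup>2 / (2 * (real d * \<bar>t\<bar>))"
    proof -
      have "t\<^sup>2 = \<bar>t\<bar> * \<bar>t\<bar>" by (simp add: power2_eq_square)
      then show ?thesis using False d_ge_2 by (simp only: decay_rate_def) (simp add: field_simps)
    qed
    also have "\<dots> \<le> char_rate * t\<^sup>2 / (2 * ?N m)"
      using Nm Npos char_rate_pos False d_ge_2 by (intro divide_left_mono) auto
    also have "\<dots> = char_rate * t\<^sup>2 * (?N m / 2) / (?N m)\<^sup>2"
      using Npos by (simp add: power2_eq_square)
    also have "\<dots> \<le> char_rate * t\<^sup>2 * real (card (level d m \<inter> D)) / (?N m)\<^sup>2"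
      using F char_rate_pos by (intro divide_right_mono mult_left_mono) auto
    finally show ?thesis by simp
  qed
  also have "\<dots> \<le> decay_const * exp (- decay_rate * \<bar>t\<bar>)"
    using decay_rate_pos by (simp add: decay_const_def)
  finally show ?thesis .
qed

definition lipschitz_bound :: real where
  "lipschitz_bound = (\<integral>t. \<bar>t\<bar> * (decay_const * exp (- decay_rate * \<bar>t\<bar>)) \<partial>lborel)"

text \<open>The Lipschitz constant is the same for all admissible \<open>D\<close>. Keeping half of
  each level admits in particular the deletion of a single increment, every level from the first on
  having at least two vertices.\<close>

lemma level_law_density:
  assumes "D \<subseteq> nonroot d" "\<And>n. n \<ge> 1 \<Longrightarrow> card (level d n) \<le> 2 * card (level d n \<inter> D)"
  obtains f where "level_law D = density lborel (\<lambda>x. ennreal (f x))" "\<And>x. f x \<ge> 0" "smooth f"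
    "\<And>x y. \<bar>f x - f y\<bar> \<le> lipschitz_bound * \<bar>x - y\<bar>" "f \<in> borel_measurable borel"
proof -
  interpret L: real_distribution "level_law D" by (rule real_distribution_level_law[OF assms(1)])
  obtain f where f: "level_law D = density lborel (\<lambda>x. ennreal (f x))" "\<And>x. f x \<ge> 0" "smooth f"
    "\<And>x y. \<bar>f x - f y\<bar> \<le> lipschitz_bound * \<bar>x - y\<bar>"
    using L.smooth_density[OF decay_rate_pos char_level_law_decay[OF assms]]
    unfolding lipschitz_bound_def by blast
  have "isCont f x" for x
    using f(3) unfolding smooth_def by (metis field_differentiable_imp_continuous_at funpow_0)
  then have "f \<in> borel_measurable borel"
    by (intro borel_measurable_continuous_onI continuous_at_imp_continuous_on) auto
  with f that show ?thesis by blast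
qed

lemma lipschitz_bound_nonneg: "lipschitz_bound \<ge> 0"
  unfolding lipschitz_bound_def by (intro integral_nonneg_AE) (auto simp: decay_const_def)

section \<open>Second moments and positivity of the density\<close>

lemma level_sum_second_moment:
  assumes D: "D \<subseteq> nonroot d"
  shows "integrable noise (\<lambda>\<xi>. (level_sum D \<xi>)\<^sup>2)" "(\<integral>\<xi>. (level_sum D \<xi>)\<^sup>2 \<partial>noise) \<le> 192 * variance"
proof -
  note [measurable] = level_sum_measurable[OF D]
  have e: "integrable noise (\<lambda>\<xi>. 64 * enn2real (energy D \<xi>))"
    using energy_integrable(1)[OF D] by simp
  have b: "AE \<xi> in noise. (level_sum D \<xi>)\<^sup>2 \<le> 64 * enn2real (energy D \<xi>)"
    using AE_energy_finite[OF D] by eventually_elim (rule partial_sum_bound(2))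
  show i: "integrable noise (\<lambda>\<xi>. (level_sum D \<xi>)\<^sup>2)"
    by (rule Bochner_Integration.integrable_bound[OF e]) (use b in auto)
  have "(\<integral>\<xi>. (level_sum D \<xi>)\<^sup>2 \<partial>noise) \<le> (\<integral>\<xi>. 64 * enn2real (energy D \<xi>) \<partial>noise)"
    by (rule integral_mono_AE[OF i e b])
  also have "\<dots> \<le> 192 * variance" using energy_integrable(2)[OF D] by simp
  finally show "(\<integral>\<xi>. (level_sum D \<xi>)\<^sup>2 \<partial>noise) \<le> 192 * variance" .
qed

text \<open>The second moment is at most 64 * 3 = 192 times \<open>variance\<close>. A squared
  radius exceeding twice this bound leaves mass less than 1/2 outside the interval; the summand 1
  makes the inequality strict.\<close>

definition peak_radius :: real where "peak_radius = sqrt (384 * variance + 1)"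

text \<open>More than half of the mass lies in an interval of length 2 \<open>peak_radius\<close>,
  which a density bounded by 1 / (4 \<open>peak_radius\<close>) cannot supply. The height does not
  depend on \<open>D\<close>.\<close>

lemma density_peak:
  assumes D: "D \<subseteq> nonroot d" and f: "level_law D = density lborel (\<lambda>x. ennreal (f x))"
    and fm: "f \<in> borel_measurable borel"
  shows "\<exists>x. 1 / (4 * peak_radius) \<le> f x"
proof (rule ccontr)
  let ?R = peak_radius
  have R: "?R > 0" "?R\<^sup>2 = 384 * variance + 1"
    using variance_nonneg by (simp_all add: peak_radius_def)
  note [measurable] = level_sum_measurable[OF D]
  assume "\<not> (\<exists>x. 1 / (4 * ?R) \<le> f x)"
  then have "f x \<le> 1 / (4 * ?R)" for x by (meson linear)
  then have "emeasure (level_law D) {- ?R<..<?R} \<le> ennreal (1 / (4 * ?R) * (?R - - ?R))"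
    unfolding f using R fm by (intro density_interval_le) auto
  also have "1 / (4 * ?R) * (?R - - ?R) = 1 / 2" using R by (simp add: field_simps)
  finally have half: "measure (level_law D) {- ?R<..<?R} \<le> 1 / 2"
    unfolding measure_def by (rule enn2real_leI[rotated]) simp
  have "measure (level_law D) {- ?R<..<?R} = measure noise {\<xi> \<in> space noise. level_sum D \<xi> \<in> {- ?R<..<?R}}"
    unfolding level_law_def by (subst measure_distr) (auto simp: vimage_def Int_def conj_commute)
  also have "{\<xi> \<in> space noise. level_sum D \<xi> \<in> {- ?R<..<?R}} =
      space noise - {\<xi> \<in> space noise. ?R\<^sup>2 \<le> (level_sum D \<xi>)\<^sup>2}"
  proof -
    have "y \<in> {- ?R<..<?R} \<longleftrightarrow> \<not> ?R\<^sup>2 \<le> y\<^sup>2" for y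
      using R(1) abs_le_square_iff[of ?R y] by auto
    then show ?thesis by blast
  qed
  also have "measure noise (space noise - {\<xi> \<in> space noise. ?R\<^sup>2 \<le> (level_sum D \<xi>)\<^sup>2}) =
      1 - measure noise {\<xi> \<in> space noise. ?R\<^sup>2 \<le> (level_sum D \<xi>)\<^sup>2}"
    by (rule noise.prob_compl) measurable
  finally have eq: "measure (level_law D) {- ?R<..<?R} = 1 - measure noise {\<xi> \<in> space noise. ?R\<^sup>2 \<le> (level_sum D \<xi>)\<^sup>2}" .
  have "measure noise {\<xi> \<in> space noise. ?R\<^sup>2 \<le> (level_sum D \<xi>)\<^sup>2} \<le> (\<integral>\<xi>. (level_sum D \<xi>)\<^sup>2 \<partial>noise) / ?R\<^sup>2"
    using level_sum_second_moment(1)[OF D] zero_less_power[OF R(1), of 2]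
    by (intro integral_Markov_inequality_measure[where A="{}"]) auto
  also have "(\<integral>\<xi>. (level_sum D \<xi>)\<^sup>2 \<partial>noise) / ?R\<^sup>2 < 1 / 2"
  proof -
    have "2 * (\<integral>\<xi>. (level_sum D \<xi>)\<^sup>2 \<partial>noise) < ?R\<^sup>2"
      unfolding R(2) using level_sum_second_moment(2)[OF D] by simp
    moreover have "?R\<^sup>2 > 0" by (rule zero_less_power[OF R(1)])
    ultimately show ?thesis by (simp only: pos_divide_less_eq)
  qed
  finally show False using half eq by linarith
qed

text \<open>At a zero x of \<open>f\<close> the Lipschitz bound allows the interval of radius
  \<open>\<delta>\<close> around x mass at most a \<open>\<delta>\<close>, while one increment with
  a suitable value already contributes 2 a \<open>\<delta>\<close>.\<close>

theorem level_law_positive_density: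
  obtains f where "level_law (nonroot d) = density lborel (\<lambda>x. ennreal (f x))" "smooth f" "\<And>x. f x > 0"
    "f \<in> borel_measurable borel"
proof -
  have big: "card (level d n) \<ge> 2" if "n \<ge> 1" for n
  proof -
    have "(2::real) ^ 1 \<le> 2 ^ n" using that by (intro power_increasing) auto
    also have "\<dots> \<le> real (card (level d n))" by (rule card_level_ge[OF d_ge_2])
    finally show ?thesis by simp
  qed
  have lev: "level d n \<subseteq> nonroot d" if "n \<ge> 1" for n using that by (auto simp: level_def nonroot_def)
  have "card (level d n) \<le> 2 * card (level d n \<inter> nonroot d)" if "n \<ge> 1" for n
    using lev[OF that] by (simp add: Int_absorb2)
  then obtain f where f: "level_law (nonroot d) = density lborel (\<lambda>x. ennreal (f x))" "\<And>x. f x \<ge> 0" "smooth f"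
    "\<And>x y. \<bar>f x - f y\<bar> \<le> lipschitz_bound * \<bar>x - y\<bar>" "f \<in> borel_measurable borel"
    using level_law_density[OF order_refl] by metis
  let ?C = "lipschitz_bound" and ?c = "1 / (4 * peak_radius)"
  have C: "?C \<ge> 0" by (rule lipschitz_bound_nonneg)
  have c: "?c > 0" using variance_nonneg by (simp add: peak_radius_def add_nonneg_pos)
  have "f x > 0" for x
  proof (rule ccontr)
    assume "\<not> f x > 0"
    then have fx: "f x = 0" using f(2)[of x] by simp
    \<comment> \<open>The level is taken so deep that over one mesh width 1 / N a density with
      Lipschitz constant \<open>?C\<close> drops by less than half of the guaranteed peak height
      \<open>?c\<close>.\<close>
    obtain n0 where n0: "2 * ?C / ?c < real n0" using reals_Archimedean2 by blast
    define n where "n = Suc n0"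
    let ?N = "real (card (level d n))"
    have "real n0 < ?N"
    proof -
      have "real n < 2 ^ n" using of_nat_less_two_power by simp
      then show ?thesis using card_level_ge[OF d_ge_2, of n] by (simp add: n_def)
    qed
    then have N: "?N > 0" "?C / ?N < ?c / 2" using n0 c C by (auto simp: field_simps)
    have "level d n \<noteq> {}" using big[of n] by (auto simp: n_def)
    then obtain w where w: "w \<in> level d n" by blast
    have wn: "w \<in> nonroot d" using w lev[of n] by (auto simp: n_def)
    let ?D = "nonroot d - {w}"
    have "card (level d m) \<le> 2 * card (level d m \<inter> ?D)" if "m \<ge> 1" for m
    proof -
      have "level d m \<inter> ?D = level d m - {w}" using lev[OF that] by auto
      then have "card (level d m) - 1 \<le> card (level d m \<inter> ?D)"
        using diff_card_le_card_Diff[of "{w}" "level d m"] by simp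
      then show ?thesis using big[OF that] by simp
    qed
    then obtain g where g: "level_law ?D = density lborel (\<lambda>x. ennreal (g x))" "\<And>x. g x \<ge> 0"
      "\<And>x y. \<bar>g x - g y\<bar> \<le> ?C * \<bar>x - y\<bar>" "g \<in> borel_measurable borel"
      using level_law_density[of ?D] by (metis Diff_subset)
    obtain v where v: "?c \<le> g v" using density_peak[OF _ g(1) g(4)] by auto
    \<comment> \<open>The value of the chosen increment that moves x to a point z within one mesh
      width of the peak v.\<close>
    define k where "k = \<lfloor>(x - v) * ?N\<rfloor>"
    define z where "z = x - real_of_int k / ?N"
    have "real_of_int k \<le> (x - v) * ?N" "(x - v) * ?N < real_of_int k + 1" by (auto simp: k_def)
    then have "real_of_int k / ?N \<le> x - v" "x - v < (real_of_int k + 1) / ?N"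
      using N(1) by (auto simp: pos_divide_le_eq pos_less_divide_eq)
    then have "\<bar>z - v\<bar> \<le> 1 / ?N" by (simp add: z_def add_divide_distrib)
    then have "?C * \<bar>z - v\<bar> \<le> ?C / ?N" using mult_left_mono[OF _ C, of "\<bar>z - v\<bar>" "1 / ?N"] by simp
    then have gz: "g z > ?c / 2" using g(3)[of z v] v N(2) by linarith
    define a where "a = prob k * ?c / 4"
    have a: "a > 0" using prob_pos c by (simp add: a_def)
    \<comment> \<open>The first term keeps \<open>g\<close> above \<open>?c / 4\<close> near z, the
      second keeps \<open>f\<close> below \<open>a / 2\<close> near x. Adding 1 to \<open>?C\<close>
      avoids division by zero.\<close>
    define \<delta> where "\<delta> = min (?c / (4 * (?C + 1))) (a / (2 * (?C + 1)))"
    have \<delta>: "\<delta> > 0" using c a C by (auto simp: \<delta>_def intro!: divide_pos_pos)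
    have "?C * \<delta> \<le> (?C + 1) * \<delta>" using \<delta> by simp
    then have \<delta>1: "?C * \<delta> \<le> ?c / 4" and \<delta>2: "?C * \<delta> \<le> a / 2"
    proof -
      have canc: "(?C + 1) * (y / (b * (?C + 1))) = y / b" for y b :: real
        using C by simp
      have "(?C + 1) * \<delta> \<le> (?C + 1) * (?c / (4 * (?C + 1)))" "(?C + 1) * \<delta> \<le> (?C + 1) * (a / (2 * (?C + 1)))"
        using C by (intro mult_left_mono; simp add: \<delta>_def)+
      then have "(?C + 1) * \<delta> \<le> ?c / 4" "(?C + 1) * \<delta> \<le> a / 2" by (simp_all only: canc)
      then show "?C * \<delta> \<le> ?c / 4" "?C * \<delta> \<le> a / 2" using \<open>?C * \<delta> \<le> (?C + 1) * \<delta>\<close> by auto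
    qed
    have "ennreal (?c / 4 * ((z + \<delta>) - (z - \<delta>))) \<le> emeasure (level_law ?D) {z - \<delta><..<z + \<delta>}"
      unfolding g(1)
    proof (rule density_interval_ge[OF g(4)])
      fix y assume "y \<in> {z - \<delta><..<z + \<delta>}"
      then have "?C * \<bar>z - y\<bar> \<le> ?C * \<delta>" using C by (intro mult_left_mono) auto
      then show "?c / 4 \<le> g y" using g(3)[of z y] gz \<delta>1 by linarith
    qed (use c \<delta> in auto)
    then have lower: "ennreal (prob k) * ennreal (?c / 4 * (2 * \<delta>)) \<le> ennreal (prob k) * emeasure (level_law ?D) {z - \<delta><..<z + \<delta>}"
      by (intro mult_left_mono) (auto simp: algebra_simps)
    \<comment> \<open>Fixing the increment at \<open>w\<close> to the value \<open>k\<close> costs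
      the factor \<open>prob k\<close> and translates the remaining sum by k / N.\<close>
    have split: "ennreal (prob k) * emeasure (level_law ?D) {z - \<delta><..<z + \<delta>} \<le> emeasure (level_law (nonroot d)) {x - \<delta><..<x + \<delta>}"
    proof -
      let ?J = "{x - \<delta><..<x + \<delta>}"
      have D: "?D \<subseteq> nonroot d" by auto
      note [measurable] = level_sum_measurable[OF D] level_sum_measurable[OF order_refl]
      have "emeasure (level_law ?D) {z - \<delta><..<z + \<delta>} = (\<integral>\<^sup>+\<xi>. indicator {z - \<delta><..<z + \<delta>} (level_sum ?D \<xi>) \<partial>noise)"
        unfolding level_law_def
        by (subst nn_integral_indicator[symmetric], simp, subst nn_integral_distr) auto
      then have "ennreal (prob k) * emeasure (level_law ?D) {z - \<delta><..<z + \<delta>} =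
          (\<integral>\<^sup>+\<xi>. ennreal (prob k) * indicator {z - \<delta><..<z + \<delta>} (level_sum ?D \<xi>) \<partial>noise)"
        by (simp add: nn_integral_cmult)
      also have "\<dots> \<le> (\<integral>\<^sup>+\<xi>. (\<integral>\<^sup>+j. indicator ?J (level_sum (nonroot d) (\<xi>(w := j))) \<partial>q) \<partial>noise)"
        using AE_resample[OF wn AE_energy_finite[OF order_refl]]
      proof (intro nn_integral_mono_AE, eventually_elim)
        case (elim \<xi>)
        have "level_sum (nonroot d) (\<xi>(w := k)) = real_of_int k / ?N + level_sum ?D (\<xi>(w := k))"
          using level_average_remove[of "nonroot d" "\<xi>(w := k)" "{w}" n] elim w wn by auto
        also have "level_sum ?D (\<xi>(w := k)) = level_sum ?D \<xi>" by (rule level_sum_cong) auto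
        finally have eq: "level_sum (nonroot d) (\<xi>(w := k)) = real_of_int k / ?N + level_sum ?D \<xi>" .
        have "level_sum (nonroot d) (\<xi>(w := k)) \<in> ?J \<longleftrightarrow> level_sum ?D \<xi> \<in> {z - \<delta><..<z + \<delta>}"
          unfolding eq z_def greaterThanLessThan_iff by linarith
        then have "ennreal (prob k) * indicator {z - \<delta><..<z + \<delta>} (level_sum ?D \<xi>) =
            (\<integral>\<^sup>+j. indicator ?J (level_sum (nonroot d) (\<xi>(w := k))) * indicator {k} j \<partial>q)"
          by (subst nn_integral_cmult_indicator) (auto simp: emeasure_q_singleton indicator_def)
        also have "\<dots> \<le> (\<integral>\<^sup>+j. indicator ?J (level_sum (nonroot d) (\<xi>(w := j))) \<partial>q)"
          by (intro nn_integral_mono) (auto simp: indicator_def)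
        finally show ?case .
      qed
      also have "\<dots> = (\<integral>\<^sup>+\<xi>. indicator ?J (level_sum (nonroot d) \<xi>) \<partial>noise)"
        using wn by (intro nn_integral_resample[symmetric]) measurable
      also have "\<dots> = emeasure (level_law (nonroot d)) ?J"
        unfolding level_law_def
        by (subst nn_integral_indicator[symmetric], simp, subst nn_integral_distr) auto
      finally show ?thesis .
    qed
    have upper: "emeasure (level_law (nonroot d)) {x - \<delta><..<x + \<delta>} \<le> ennreal (a / 2 * ((x + \<delta>) - (x - \<delta>)))"
      unfolding f(1)
    proof (rule density_interval_le[OF f(5)])
      fix y assume "y \<in> {x - \<delta><..<x + \<delta>}"
      then have "?C * \<bar>y - x\<bar> \<le> ?C * \<delta>" using C by (intro mult_left_mono) auto
      then show "f y \<le> a / 2" using f(4)[of y x] fx \<delta>2 by linarith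
    qed (use a \<delta> in auto)
    have "ennreal (prob k * (?c / 4 * (2 * \<delta>))) \<le> ennreal (a / 2 * (2 * \<delta>))"
    proof -
      have "ennreal (prob k * (?c / 4 * (2 * \<delta>))) = ennreal (prob k) * ennreal (?c / 4 * (2 * \<delta>))"
        using prob_pos[of k] c \<delta> by (intro ennreal_mult) auto
      also have "\<dots> \<le> ennreal (a / 2 * ((x + \<delta>) - (x - \<delta>)))"
        by (rule order_trans[OF lower order_trans[OF split upper]])
      also have "(x + \<delta>) - (x - \<delta>) = 2 * \<delta>" by simp
      finally show ?thesis .
    qed
    then have "prob k * (?c / 4 * (2 * \<delta>)) \<le> a / 2 * (2 * \<delta>)"
      using a \<delta> by (subst (asm) ennreal_le_iff) auto
    moreover have "prob k * (?c / 4 * (2 * \<delta>)) = a * (2 * \<delta>)" by (simp add: a_def)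
    moreover have "a / 2 * (2 * \<delta>) < a * (2 * \<delta>)" using a \<delta> by simp
    ultimately show False by linarith
  qed
  with f show ?thesis using that by blast
qed

lemma pinned_average_increments: "pinned_average d r (increments \<xi>) = sphere_average d r (heights 0 \<xi>)"
  by (simp add: pinned_average_def heights_from_increments)

theorem pinned_limit_density:
  "\<exists>f. distributed (free_state d Q) lborel (pinned_limit d) (\<lambda>x. ennreal (f x)) \<and> smooth f \<and> (\<forall>x. f x > 0)"
proof -
  obtain f where f: "level_law (nonroot d) = density lborel (\<lambda>x. ennreal (f x))" "smooth f" "\<And>x. f x > 0"
    "f \<in> borel_measurable borel"
    by (rule level_law_positive_density) blast
  have [measurable]: "pinned_average d r \<in> borel_measurable (gradient_space d)" for r
    unfolding pinned_average_def[abs_def] by measurable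
  have m: "pinned_limit d \<in> borel_measurable (gradient_space d)"
    unfolding pinned_limit_def[abs_def] by measurable
  have "distr (free_state d Q) lborel (pinned_limit d) = distr noise lborel (\<lambda>\<xi>. pinned_limit d (increments \<xi>))"
    unfolding free_state_eq using m by (subst distr_distr) (auto simp: o_def)
  also have "\<dots> = distr noise lborel (level_sum (nonroot d))"
  proof (rule distr_cong_AE)
    show "AE \<xi> in noise. pinned_limit d (increments \<xi>) = level_sum (nonroot d) \<xi>"
      using AE_energy_finite[OF order_refl]
    proof eventually_elim
      case (elim \<xi>)
      show ?case
        unfolding pinned_limit_def pinned_average_increments
        using limit_average_heights(1)[OF elim, of 0] by (intro limI) simp
    qed
    show "(\<lambda>\<xi>. pinned_limit d (increments \<xi>)) \<in> noise \<rightarrow>\<^sub>M lborel"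
      using measurable_compose[OF increments_measurable m] by simp
    show "level_sum (nonroot d) \<in> noise \<rightarrow>\<^sub>M lborel" by simp
  qed auto
  also have "\<dots> = level_law (nonroot d)" unfolding level_law_def by (rule distr_cong) auto
  also note f(1)
  finally have "distributed (free_state d Q) lborel (pinned_limit d) (\<lambda>x. ennreal (f x))"
    using m f(4) by (simp add: distributed_def free_state_eq)
  then show ?thesis using f by blast
qed

end

section \<open>Localization\<close>

text \<open>Pairing x with -x removes the linear term of the exponential; for a symmetric law this
  leaves a bound of second order.\<close>

lemma exp_pair_bound: "exp x + exp (- x) \<le> 2 + 2 * (x\<^sup>2 * exp \<bar>x\<bar>)" for x :: real
proof -
  have *: "exp y \<le> 1 + y + y\<^sup>2 * exp \<bar>y\<bar>" for y :: real
  proof -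
    obtain t where t: "\<bar>t\<bar> \<le> \<bar>y\<bar>" "exp y = (\<Sum>m<2. y ^ m / fact m) + exp t / fact 2 * y ^ 2"
      using Maclaurin_exp_le[of y 2] by auto
    have "exp t / fact 2 * y\<^sup>2 \<le> exp \<bar>y\<bar> * y\<^sup>2"
    proof (rule mult_right_mono)
      have "exp t \<le> exp \<bar>y\<bar>" using t(1) by simp
      moreover have "exp t / fact 2 \<le> exp t" by (simp add: fact_2)
      ultimately show "exp t / fact 2 \<le> exp \<bar>y\<bar>" by linarith
    qed simp
    then show ?thesis using t(2) by (simp add: numeral_2_eq_2 mult.commute)
  qed
  show ?thesis using *[of x] *[of "- x"] by simp
qed

lemma square_le_exp: "y\<^sup>2 \<le> 2 / e\<^sup>2 * exp (e * \<bar>y\<bar>)" if "e > 0" for y e :: real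
proof -
  have "(e * \<bar>y\<bar>)\<^sup>2 / 2 \<le> 1 + e * \<bar>y\<bar> + (e * \<bar>y\<bar>)\<^sup>2 / 2" using that by simp
  also have "\<dots> \<le> exp (e * \<bar>y\<bar>)" using that by (intro exp_lower_Taylor_quadratic) simp
  finally show ?thesis using that by (simp add: power_mult_distrib field_simps)
qed

lemma sum_inverse_card_level:
  assumes "d \<ge> 2" shows "(\<Sum>n=1..r. 1 / real (card (level d n))) \<le> 2"
proof -
  have "(\<Sum>n=1..r. 1 / real (card (level d n))) \<le> (\<Sum>n=1..r. (1/2) ^ n)"
  proof (rule sum_mono)
    fix n
    have "1 / real (card (level d n)) \<le> 1 / 2 ^ n"
      using card_level_ge[OF assms, of n] card_level_pos[OF assms, of n]
      by (intro divide_left_mono) (auto intro!: mult_pos_pos simp del: card_level_pos)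
    then show "1 / real (card (level d n)) \<le> (1/2) ^ n" by (simp add: power_divide)
  qed
  also have "\<dots> \<le> (\<Sum>n. (1/2 :: real) ^ n)"
    by (intro sum_le_suminf summable_geometric) auto
  also have "\<dots> = 2" by (subst suminf_geometric) auto
  finally show ?thesis .
qed

context tree_gradient
begin

lemma nn_integral_noise_prod:
  assumes "finite F" "F \<subseteq> nonroot d"
  shows "(\<integral>\<^sup>+\<xi>. (\<Prod>v\<in>F. f v (\<xi> v)) \<partial>noise) = (\<Prod>v\<in>F. \<integral>\<^sup>+j. f v j \<partial>q)"
  using assms
proof (induction F rule: finite_induct)
  case empty
  then show ?case by (simp add: noise.emeasure_space_1)
next
  case (insert v F)
  have v: "v \<in> nonroot d" and F: "F \<subseteq> nonroot d" using insert by auto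
  have f [measurable]: "(\<lambda>\<xi>. f u (\<xi> u)) \<in> borel_measurable noise" if "u \<in> nonroot d" for u
    by (rule measurable_compose[OF noise_component[OF that]]) simp
  have [measurable]: "(\<lambda>\<xi>. \<Prod>u\<in>F. f u (\<xi> u)) \<in> borel_measurable noise"
    using F by (intro borel_measurable_prod_ennreal f) auto
  have "(\<integral>\<^sup>+\<xi>. (\<Prod>u\<in>insert v F. f u (\<xi> u)) \<partial>noise) = (\<integral>\<^sup>+\<xi>. f v (\<xi> v) * (\<Prod>u\<in>F. f u (\<xi> u)) \<partial>noise)"
    using insert.hyps by simp
  also have "\<dots> = (\<integral>\<^sup>+\<xi>. (\<integral>\<^sup>+j. f v ((\<xi>(v := j)) v) * (\<Prod>u\<in>F. f u ((\<xi>(v := j)) u)) \<partial>q) \<partial>noise)"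
    using v by (intro nn_integral_resample) measurable
  also have "\<dots> = (\<integral>\<^sup>+\<xi>. (\<integral>\<^sup>+j. f v j \<partial>q) * (\<Prod>u\<in>F. f u (\<xi> u)) \<partial>noise)"
  proof -
    have "(\<Prod>u\<in>F. f u ((\<xi>(v := j)) u)) = (\<Prod>u\<in>F. f u (\<xi> u))" for \<xi> j
      using insert.hyps by (intro prod.cong) auto
    then show ?thesis by (simp add: nn_integral_multc)
  qed
  also have "\<dots> = (\<integral>\<^sup>+j. f v j \<partial>q) * (\<Prod>u\<in>F. \<integral>\<^sup>+j. f u j \<partial>q)"
    using insert.IH[OF F] by (simp add: nn_integral_cmult)
  finally show ?case using insert.hyps by simp
qed

text \<open>The factor j^2 is absorbed by the room between \<open>u0\<close> and a larger exponent
  \<open>u1\<close> that is still below \<open>R\<close>.\<close>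

lemma exponential_moment_finite:
  assumes mgf: "\<And>t. t \<in> {-R<..<R} \<Longrightarrow> (\<lambda>j::int. exp (t * of_int j) * (Q j / l1_norm Q)) summable_on UNIV"
    and u0: "0 \<le> u0" "u0 < R"
  obtains C where "C \<ge> 0" "(\<integral>\<^sup>+j. ennreal ((real_of_int j)\<^sup>2 * exp (u0 * \<bar>real_of_int j\<bar>)) \<partial>q) \<le> ennreal C"
proof -
  \<comment> \<open>Any exponent strictly between \<open>u0\<close> and \<open>R\<close> would
    serve; the midpoint is one.\<close>
  define u1 where "u1 = (u0 + R) / 2"
  have u1: "u0 < u1" "u1 < R" using u0 by (auto simp: u1_def)
  define K where "K = 2 / (u1 - u0)\<^sup>2"
  have K: "K \<ge> 0" by (simp add: K_def)
  let ?m = "\<lambda>t. \<Sum>\<^sub>\<infinity>j. exp (t * of_int j) * (Q j / l1_norm Q)"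
  have m: "(\<integral>\<^sup>+j. ennreal (exp (t * real_of_int j)) \<partial>q) = ennreal (?m t)" if "t \<in> {-R<..<R}" for t
  proof -
    have "(\<integral>\<^sup>+j. ennreal (exp (t * real_of_int j)) \<partial>q) = (\<integral>\<^sup>+j. ennreal (exp (t * of_int j) * (Q j / l1_norm Q)) \<partial>count_space UNIV)"
      unfolding nn_integral_q prob_def[symmetric] using less_imp_le[OF prob_pos]
      by (intro nn_integral_cong) (simp add: ennreal_mult[symmetric] mult.commute)
    also have "\<dots> = ennreal (?m t)"
      using mgf[OF that] l1_norm_pos by (intro nn_integral_count_space_summable_on) auto
    finally show ?thesis .
  qed
  have m_nonneg: "?m t \<ge> 0" for t using l1_norm_pos by (intro infsum_nonneg) auto
  have bnd: "y\<^sup>2 * exp (u0 * \<bar>y\<bar>) \<le> K * (exp (u1 * y) + exp (- u1 * y))" for y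
  proof -
    have "y\<^sup>2 * exp (u0 * \<bar>y\<bar>) \<le> K * exp ((u1 - u0) * \<bar>y\<bar>) * exp (u0 * \<bar>y\<bar>)"
      using square_le_exp[of "u1 - u0" y] u1 by (intro mult_right_mono) (auto simp: K_def)
    also have "\<dots> = K * exp (u1 * \<bar>y\<bar>)" by (simp add: exp_add[symmetric] algebra_simps)
    also have "\<dots> \<le> K * (exp (u1 * y) + exp (- u1 * y))"
      using K by (intro mult_left_mono) (auto simp: abs_if)
    finally show ?thesis .
  qed
  have "(\<integral>\<^sup>+j. ennreal ((real_of_int j)\<^sup>2 * exp (u0 * \<bar>real_of_int j\<bar>)) \<partial>q) \<le>
      (\<integral>\<^sup>+j. ennreal K * (ennreal (exp (u1 * real_of_int j)) + ennreal (exp (- u1 * real_of_int j))) \<partial>q)"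
    using bnd K by (intro nn_integral_mono) (simp add: ennreal_plus[symmetric] ennreal_mult[symmetric] del: ennreal_plus)
  also have "\<dots> = ennreal K * (ennreal (?m u1) + ennreal (?m (- u1)))"
    using m[of u1] m[of "- u1"] u0 u1 by (simp add: nn_integral_cmult nn_integral_add)
  also have "\<dots> = ennreal (K * (?m u1 + ?m (- u1)))"
    using K m_nonneg
    by (simp only: ennreal_plus[symmetric] ennreal_mult[symmetric] add_nonneg_nonneg)
  finally show ?thesis
    by (rule that[rotated]) (use K m_nonneg in \<open>intro mult_nonneg_nonneg add_nonneg_nonneg\<close>)
qed

text \<open>A sub-Gaussian estimate on the bounded range |u| at most \<open>u0\<close>: symmetry
  cancels the linear term and the weighted second moment \<open>C\<close> controls the rest.\<close>

lemma nn_integral_exp_q_le: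
  assumes C: "C \<ge> 0" "(\<integral>\<^sup>+j. ennreal ((real_of_int j)\<^sup>2 * exp (u0 * \<bar>real_of_int j\<bar>)) \<partial>q) \<le> ennreal C"
    and u: "\<bar>u\<bar> \<le> u0"
  shows "(\<integral>\<^sup>+j. ennreal (exp (u * real_of_int j)) \<partial>q) \<le> ennreal (exp (C * u\<^sup>2))"
proof -
  let ?I = "\<integral>\<^sup>+j. ennreal (exp (u * real_of_int j)) \<partial>q"
  have "?I + ?I = ?I + (\<integral>\<^sup>+j. ennreal (exp (u * real_of_int (- j))) \<partial>q)"
    by (subst (2) nn_integral_q_uminus[symmetric]) simp
  also have "\<dots> = (\<integral>\<^sup>+j. ennreal (exp (u * real_of_int j)) + ennreal (exp (u * real_of_int (- j))) \<partial>q)"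
    by (rule nn_integral_add[symmetric]) auto
  also have "\<dots> \<le> (\<integral>\<^sup>+j. 2 + ennreal (2 * u\<^sup>2) * ennreal ((real_of_int j)\<^sup>2 * exp (u0 * \<bar>real_of_int j\<bar>)) \<partial>q)"
  proof (rule nn_integral_mono)
    fix j :: int
    let ?j = "real_of_int j"
    have "exp (u * ?j) + exp (u * real_of_int (- j)) \<le> 2 + 2 * ((u * ?j)\<^sup>2 * exp \<bar>u * ?j\<bar>)"
      using exp_pair_bound[of "u * ?j"] by simp
    also have "\<dots> \<le> 2 + 2 * ((u * ?j)\<^sup>2 * exp (u0 * \<bar>?j\<bar>))"
      using u by (intro add_left_mono mult_left_mono) (auto simp: abs_mult mult_right_mono)
    also have "\<dots> = 2 + (2 * u\<^sup>2) * (?j\<^sup>2 * exp (u0 * \<bar>?j\<bar>))" by (simp add: power_mult_distrib)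
    finally have "ennreal (exp (u * ?j) + exp (u * real_of_int (- j))) \<le> ennreal (2 + (2 * u\<^sup>2) * (?j\<^sup>2 * exp (u0 * \<bar>?j\<bar>)))"
      by (rule ennreal_leI)
    then show "ennreal (exp (u * ?j)) + ennreal (exp (u * real_of_int (- j))) \<le> 2 + ennreal (2 * u\<^sup>2) * ennreal (?j\<^sup>2 * exp (u0 * \<bar>?j\<bar>))"
      by (simp add: ennreal_mult)
  qed
  also have "\<dots> = 2 + ennreal (2 * u\<^sup>2) * (\<integral>\<^sup>+j. ennreal ((real_of_int j)\<^sup>2 * exp (u0 * \<bar>real_of_int j\<bar>)) \<partial>q)"
    by (simp add: nn_integral_add nn_integral_cmult q.emeasure_space_1[simplified])
  also have "\<dots> \<le> 2 + ennreal (2 * u\<^sup>2) * ennreal C"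
    by (intro add_left_mono mult_left_mono C) auto
  also have "\<dots> = ennreal (2 * (1 + C * u\<^sup>2))"
    using C(1) by (simp add: ennreal_mult[symmetric] ennreal_plus[symmetric] mult.commute mult.left_commute distrib_left del: ennreal_plus flip: ennreal_numeral)
  finally have *: "?I + ?I \<le> ennreal (2 * (1 + C * u\<^sup>2))" .
  show ?thesis
  proof (cases ?I rule: ennreal_cases)
    case (real r)
    have "ennreal (r + r) = ennreal r + ennreal r" using real(1) by (rule ennreal_plus[OF _ real(1)])
    then have "ennreal (r + r) \<le> ennreal (2 * (1 + C * u\<^sup>2))" using * by (simp only: real(2))
    then have "r + r \<le> 2 * (1 + C * u\<^sup>2)" using C(1) by (subst (asm) ennreal_le_iff) auto
    also have "1 + C * u\<^sup>2 \<le> exp (C * u\<^sup>2)" by (rule exp_ge_add_one_self)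
    finally show ?thesis unfolding real(2) by (intro ennreal_leI) simp
  next
    case top
    then have False using * by (simp add: top_unique)
    then show ?thesis ..
  qed
qed

text \<open>In level n each increment has the coefficient t / |W_n|, at most |t| / (d + 1) in
  absolute value; this is why t may reach (d + 1) \<open>u0\<close>. The squared coefficients add up
  to t^2 times the sum of 1 / |W_n|, at most 2 t^2. Fatou's lemma passes from partial sums to the
  limit.\<close>

lemma nn_integral_exp_level_sum:
  assumes C: "C \<ge> 0" "(\<integral>\<^sup>+j. ennreal ((real_of_int j)\<^sup>2 * exp (u0 * \<bar>real_of_int j\<bar>)) \<partial>q) \<le> ennreal C"
    and t: "\<bar>t\<bar> \<le> (real d + 1) * u0"
  shows "(\<integral>\<^sup>+\<xi>. ennreal (exp (t * level_sum (nonroot d) \<xi>)) \<partial>noise) \<le> ennreal (exp (2 * C * t\<^sup>2))"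
proof -
  let ?N = "\<lambda>n. real (card (level d n))"
  let ?S = "\<lambda>r \<xi>. \<Sum>n\<le>r. level_average (nonroot d) n \<xi>"
  have N: "?N n \<ge> real d + 1" if "n \<ge> 1" for n
  proof -
    have "(d + 1) * 1 \<le> (d + 1) * d ^ (n - 1)" using d_ge_2 by (intro mult_left_mono) auto
    then have "d + 1 \<le> card (level d n)" using that by (simp add: card_level)
    then show ?thesis by linarith
  qed
  have u0: "u0 \<ge> 0"
    using order_trans[OF abs_ge_zero t] by (simp add: zero_le_mult_iff)
  have partial: "(\<integral>\<^sup>+\<xi>. ennreal (exp (t * ?S r \<xi>)) \<partial>noise) \<le> ennreal (exp (2 * C * t\<^sup>2))" for r
  proof -
    define F where "F = (\<Union>n\<in>{1..r}. level d n)"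
    have F: "finite F" "F \<subseteq> nonroot d"
      unfolding F_def by (simp, auto simp: level_def nonroot_def)
    have sumF: "(\<Sum>v\<in>F. g v) = (\<Sum>n=1..r. \<Sum>v\<in>level d n. g v)" for g :: "nat list \<Rightarrow> real"
      unfolding F_def by (rule sum.UNION_disjoint) (simp, simp, auto simp: level_def)
    have S: "t * ?S r \<xi> = (\<Sum>v\<in>F. t / ?N (length v) * real_of_int (\<xi> v))" for \<xi>
    proof -
      have "?S r \<xi> = (\<Sum>n=1..r. level_average (nonroot d) n \<xi>)"
        by (intro sum.mono_neutral_right) (auto simp: level_average_def level_0 nonroot_def not_le less_Suc_eq_0_disj)
      also have "t * \<dots> = (\<Sum>n=1..r. \<Sum>v\<in>level d n. t / ?N (length v) * real_of_int (\<xi> v))"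
        unfolding sum_distrib_left
      proof (rule sum.cong[OF refl])
        fix n assume "n \<in> {1..r}"
        then have "level d n \<inter> nonroot d = level d n" by (auto simp: level_def nonroot_def)
        then have "t * level_average (nonroot d) n \<xi> = (\<Sum>v\<in>level d n. t / ?N n * real_of_int (\<xi> v))"
          by (simp add: level_average_def sum_distrib_left sum_divide_distrib)
        also have "\<dots> = (\<Sum>v\<in>level d n. t / ?N (length v) * real_of_int (\<xi> v))"
          by (intro sum.cong) (auto simp: level_def)
        finally show "t * level_average (nonroot d) n \<xi> = (\<Sum>v\<in>level d n. t / ?N (length v) * real_of_int (\<xi> v))" .
      qed
      finally show ?thesis by (simp add: sumF)
    qed
    have "(\<integral>\<^sup>+\<xi>. ennreal (exp (t * ?S r \<xi>)) \<partial>noise) =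
        (\<integral>\<^sup>+\<xi>. (\<Prod>v\<in>F. ennreal (exp (t / ?N (length v) * real_of_int (\<xi> v)))) \<partial>noise)"
      unfolding S by (intro nn_integral_cong) (simp add: exp_sum F prod_ennreal)
    also have "\<dots> = (\<Prod>v\<in>F. \<integral>\<^sup>+j. ennreal (exp (t / ?N (length v) * real_of_int j)) \<partial>q)"
      by (rule nn_integral_noise_prod[OF F])
    also have "\<dots> \<le> (\<Prod>v\<in>F. ennreal (exp (C * (t / ?N (length v))\<^sup>2)))"
    proof (rule prod_mono_ennreal)
      fix v assume "v \<in> F"
      then have "?N (length v) \<ge> real d + 1" using N by (auto simp: F_def level_def)
      then have "\<bar>t\<bar> \<le> ?N (length v) * u0" using t u0 by (meson mult_right_mono order_trans)
      then have "\<bar>t / ?N (length v)\<bar> \<le> u0"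
        using \<open>?N (length v) \<ge> real d + 1\<close> by (simp add: abs_divide pos_divide_le_eq mult.commute)
      then show "(\<integral>\<^sup>+j. ennreal (exp (t / ?N (length v) * real_of_int j)) \<partial>q) \<le> ennreal (exp (C * (t / ?N (length v))\<^sup>2))"
        by (rule nn_integral_exp_q_le[OF C])
    qed
    also have "\<dots> = ennreal (exp (\<Sum>v\<in>F. C * (t / ?N (length v))\<^sup>2))"
      by (simp add: prod_ennreal exp_sum F)
    also have "(\<Sum>v\<in>F. C * (t / ?N (length v))\<^sup>2) = C * t\<^sup>2 * (\<Sum>n=1..r. 1 / ?N n)"
    proof -
      have "(\<Sum>v\<in>level d n. C * (t / ?N (length v))\<^sup>2) = C * t\<^sup>2 * (1 / ?N n)" for n
      proof -
        have "(\<Sum>v\<in>level d n. C * (t / ?N (length v))\<^sup>2) = (\<Sum>v\<in>level d n. C * (t / ?N n)\<^sup>2)"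
          by (intro sum.cong) (auto simp: level_def)
        also have "\<dots> = C * t\<^sup>2 * (1 / ?N n)"
          using card_level_pos[OF d_ge_2, of n] by (simp add: power_divide power2_eq_square)
        finally show ?thesis .
      qed
      then have "(\<Sum>n=1..r. \<Sum>v\<in>level d n. C * (t / ?N (length v))\<^sup>2) = (\<Sum>n=1..r. C * t\<^sup>2 * (1 / ?N n))"
        by (intro sum.cong refl)
      also have "\<dots> = C * t\<^sup>2 * (\<Sum>n=1..r. 1 / ?N n)" by (rule sum_distrib_left[symmetric])
      finally show ?thesis unfolding sumF .
    qed
    also have "ennreal (exp (C * t\<^sup>2 * (\<Sum>n=1..r. 1 / ?N n))) \<le> ennreal (exp (2 * C * t\<^sup>2))"
      using mult_left_mono[OF sum_inverse_card_level[OF d_ge_2, of r], of "C * t\<^sup>2"] C(1)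
      by (intro ennreal_leI) (simp add: mult.commute mult.left_commute)
    finally show ?thesis .
  qed
  have "(\<integral>\<^sup>+\<xi>. ennreal (exp (t * level_sum (nonroot d) \<xi>)) \<partial>noise) =
      (\<integral>\<^sup>+\<xi>. liminf (\<lambda>r. ennreal (exp (t * ?S r \<xi>))) \<partial>noise)"
    using AE_energy_finite[OF order_refl]
  proof (intro nn_integral_cong_AE, eventually_elim)
    case (elim \<xi>)
    then have "(\<lambda>r. ?S r \<xi>) \<longlonglongrightarrow> level_sum (nonroot d) \<xi>"
      using level_average_sums[OF elim(2)] by (simp add: sums_def_le)
    then have "(\<lambda>r. ennreal (exp (t * ?S r \<xi>))) \<longlonglongrightarrow> ennreal (exp (t * level_sum (nonroot d) \<xi>))"
      by (intro tendsto_intros)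
    then show ?case by (intro lim_imp_Liminf[symmetric]) auto
  qed
  also have "\<dots> \<le> liminf (\<lambda>r. \<integral>\<^sup>+\<xi>. ennreal (exp (t * ?S r \<xi>)) \<partial>noise)"
    by (rule nn_integral_liminf) measurable
  also have "\<dots> \<le> ennreal (exp (2 * C * t\<^sup>2))"
  proof -
    have "liminf (\<lambda>r. \<integral>\<^sup>+\<xi>. ennreal (exp (t * ?S r \<xi>)) \<partial>noise) \<le> limsup (\<lambda>r. \<integral>\<^sup>+\<xi>. ennreal (exp (t * ?S r \<xi>)) \<partial>noise)"
      by (rule Liminf_le_Limsup) simp
    also have "\<dots> \<le> ennreal (exp (2 * C * t\<^sup>2))"
      by (intro Limsup_bounded always_eventually allI partial)
    finally show ?thesis .
  qed
  finally show ?thesis .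
qed

text \<open>A Chernoff bound for both tails of the limiting average, whose floor is up to sign the
  height at the root. For nonpositive \<open>A\<close> the claim is trivial.\<close>

theorem localization:
  assumes R: "R > 0" "\<And>t. t \<in> {-R<..<R} \<Longrightarrow> (\<lambda>j::int. exp (t * of_int j) * (Q j / l1_norm Q)) summable_on UNIV"
    and A: "A < real (d + 1) * R"
  shows "\<exists>B>0. \<forall>s::nat. measure mu {\<omega> \<in> space (height_space d). \<bar>\<omega> []\<bar> \<ge> int s} \<le> B * exp (- A * real s)"
proof (cases "A \<le> 0")
  case True
  have "measure mu X \<le> 1 * exp (- A * real s)" for X s
  proof -
    have "measure mu X \<le> 1" by (rule mu.prob_le_1)
    also have "1 \<le> exp (- A * real s)" using True by (simp add: mult_nonpos_nonneg)
    finally show ?thesis by simp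
  qed
  then show ?thesis by (intro exI[of _ 1]) auto
next
  case False
  \<comment> \<open>The largest coefficient of a single increment at exponent \<open>A\<close>; the
    hypothesis on \<open>A\<close> says exactly that it is below \<open>R\<close>.\<close>
  define u0 where "u0 = A / (real d + 1)"
  have u0: "0 \<le> u0" "u0 < R" "\<bar>A\<bar> \<le> (real d + 1) * u0" "\<bar>- A\<bar> \<le> (real d + 1) * u0"
    using False A by (auto simp: u0_def field_simps)
  obtain C where C: "C \<ge> 0" "(\<integral>\<^sup>+j. ennreal ((real_of_int j)\<^sup>2 * exp (u0 * \<bar>real_of_int j\<bar>)) \<partial>q) \<le> ennreal C"
    using exponential_moment_finite[OF R(2) u0(1,2)] by blast
  let ?L = "level_sum (nonroot d)"
  let ?E = "exp (2 * C * A\<^sup>2)"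
  have [measurable]: "?L \<in> borel_measurable noise" by (rule level_sum_measurable) simp
  have E: "(\<integral>\<^sup>+\<xi>. ennreal (exp (A * ?L \<xi>)) \<partial>noise) \<le> ennreal ?E" "(\<integral>\<^sup>+\<xi>. ennreal (exp (- A * ?L \<xi>)) \<partial>noise) \<le> ennreal ?E"
    using nn_integral_exp_level_sum[OF C u0(3)] nn_integral_exp_level_sum[OF C u0(4)] by simp_all
  have "measure mu {\<omega> \<in> space (height_space d). \<bar>\<omega> []\<bar> \<ge> int s} \<le> 2 * ?E * exp A * exp (- A * real s)" for s :: nat
  proof -
    let ?X = "{\<omega> \<in> space (height_space d). \<bar>\<omega> []\<bar> \<ge> int s}"
    have X [measurable]: "?X \<in> sets (height_space d)"
    proof -
      have "(\<lambda>\<omega>. \<omega> []) \<in> height_space d \<rightarrow>\<^sub>M count_space UNIV" by (rule height_space_component) simp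
      from measurable_sets[OF this, of "{i. \<bar>i\<bar> \<ge> int s}"] show ?thesis
        by (auto simp: vimage_def Int_def conj_commute elim!: back_subst[of "\<lambda>A. A \<in> _"])
    qed
    let ?c = "exp (A * (1 - real s))"
    have "emeasure mu ?X = (\<integral>\<^sup>+\<xi>. indicator ?X (heights (- \<lfloor>?L \<xi>\<rfloor>) \<xi>) \<partial>noise)"
      using nn_integral_mu_offset[of "indicator ?X"] by simp
    also have "\<dots> \<le> (\<integral>\<^sup>+\<xi>. ennreal ?c * (ennreal (exp (A * ?L \<xi>)) + ennreal (exp (- A * ?L \<xi>))) \<partial>noise)"
    proof (rule nn_integral_mono)
      fix \<xi>
      show "indicator ?X (heights (- \<lfloor>?L \<xi>\<rfloor>) \<xi>) \<le> ennreal ?c * (ennreal (exp (A * ?L \<xi>)) + ennreal (exp (- A * ?L \<xi>)))"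
      proof (cases "\<bar>\<lfloor>?L \<xi>\<rfloor>\<bar> \<ge> int s")
        case True
        \<comment> \<open>Taking the floor costs at most one unit, which appears as the factor
          \<open>exp A\<close> in the final constant.\<close>
        then have "real s - 1 \<le> \<bar>?L \<xi>\<bar>" by linarith
        then have "0 \<le> A * (1 - real s) + A * \<bar>?L \<xi>\<bar>" using False by (simp add: distrib_left[symmetric] zero_le_mult_iff)
        then have "1 \<le> exp (A * (1 - real s) + A * \<bar>?L \<xi>\<bar>)" by simp
        also have "\<dots> = ?c * exp (A * \<bar>?L \<xi>\<bar>)" by (rule exp_add)
        also have "\<dots> \<le> ?c * (exp (A * ?L \<xi>) + exp (- A * ?L \<xi>))"
          by (intro mult_left_mono) (auto simp: abs_if)
        finally have "ennreal 1 \<le> ennreal (?c * (exp (A * ?L \<xi>) + exp (- A * ?L \<xi>)))" by (rule ennreal_leI)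
        then show ?thesis by (simp add: ennreal_mult indicator_def)
      next
        case False
        then show ?thesis by (simp add: indicator_def)
      qed
    qed
    also have "\<dots> = ennreal ?c * ((\<integral>\<^sup>+\<xi>. ennreal (exp (A * ?L \<xi>)) \<partial>noise) + (\<integral>\<^sup>+\<xi>. ennreal (exp (- A * ?L \<xi>)) \<partial>noise))"
      by (subst nn_integral_cmult, measurable, subst nn_integral_add) auto
    also have "\<dots> \<le> ennreal ?c * (ennreal ?E + ennreal ?E)"
      by (intro mult_left_mono add_mono E) auto
    also have "\<dots> = ennreal (2 * ?E * exp A * exp (- A * real s))"
    proof -
      have "?c * (?E + ?E) = 2 * ?E * exp A * exp (- A * real s)"
        by (simp add: right_diff_distrib exp_diff exp_minus divide_inverse)
      then show ?thesis by (simp only: ennreal_plus[symmetric] exp_ge_zero ennreal_mult[symmetric] add_nonneg_nonneg)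
    qed
    finally show ?thesis by (simp add: mu.emeasure_eq_measure)
  qed
  then show ?thesis by (intro exI[of _ "2 * ?E * exp A"]) auto
qed

end

section \<open>Failure of translation invariance, extremality and the Markov property\<close>

lemma gen_cons_in_verts: "g \<le> d \<Longrightarrow> u \<in> verts d \<Longrightarrow> gen_cons g u \<in> verts d"
  by (cases u) (auto simp: verts_Cons)

text \<open>Away from the root, left multiplication by \<open>g\<close> interchanges the branch of
  words starting with \<open>g\<close> and its complement; a translated sphere therefore sees a
  raised branch with the complementary share.\<close>

lemma hd_gen_cons:
  assumes "u \<in> verts d" "u \<noteq> []"
  shows "gen_cons g u \<noteq> [] \<and> hd (gen_cons g u) = g \<longleftrightarrow> hd u \<noteq> g"
  using assms by (cases u; cases "tl u") (auto simp: verts_Cons)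

lemma translate_generator: "translate d [g] \<omega> = (\<lambda>u\<in>verts d. \<omega> (gen_cons g u))"
  by (simp add: translate_def gmult_def)

lemma translate_generator_measurable [measurable]:
  assumes "g \<le> d" shows "translate d [g] \<in> height_space d \<rightarrow>\<^sub>M height_space d"
  unfolding translate_generator[abs_def]
  by (subst (2) height_space_def, intro measurable_restrict height_space_component gen_cons_in_verts assms)

lemma height_event: "v \<in> verts d \<Longrightarrow> {\<omega> \<in> space (height_space d). \<omega> v = j} \<in> sets (height_space d)"
  using measurable_sets[OF height_space_component, of v d "{j}"]
  by (auto simp: vimage_def Int_def conj_commute elim!: back_subst[of "\<lambda>A. A \<in> _"])

text \<open>The sum of a constant over all integers is 0 or infinite.\<close>

lemma nn_integral_const_int_neq_1:
  fixes c :: ennreal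
  assumes "(\<integral>\<^sup>+n. c \<partial>count_space (UNIV :: int set)) = 1" shows False
proof -
  have "(\<integral>\<^sup>+n. c \<partial>count_space (UNIV :: int set)) = c * emeasure (count_space (UNIV :: int set)) UNIV"
    by simp
  also have "\<dots> = c * top" by (simp add: infinite_UNIV_int)
  finally show False using assms by (cases "c = 0") (auto simp: ennreal_mult_top)
qed

context tree_gradient
begin

lemma heights_update_generator:
  assumes "g \<le> d"
  shows "heights s (\<xi>([g] := \<xi> [g] + k)) =
    (\<lambda>u\<in>verts d. heights s \<xi> u + (if u \<noteq> [] \<and> hd u = g then k else 0))"
proof -
  have "(\<Sum>n\<in>{1..length u}. (\<xi>([g] := \<xi> [g] + k)) (take n u)) =
      (\<Sum>n\<in>{1..length u}. \<xi> (take n u)) + (if u \<noteq> [] \<and> hd u = g then k else 0)" for u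
  proof -
    have "(\<Sum>n\<in>{1..length u}. (\<xi>([g] := \<xi> [g] + k)) (take n u)) =
        (\<Sum>n\<in>{1..length u}. \<xi> (take n u) + (if n = 1 then (if hd u = g then k else 0) else 0))"
    proof (intro sum.cong refl)
      fix n assume n: "n \<in> {1..length u}"
      have "take n u = [g] \<longleftrightarrow> n = 1 \<and> hd u = g"
      proof
        assume t: "take n u = [g]"
        then have "length (take n u) = 1" by simp
        then have "n = 1" using n by simp
        then show "n = 1 \<and> hd u = g" using t n by (cases u) auto
      qed (use n in \<open>cases u; auto\<close>)
      then show "(\<xi>([g] := \<xi> [g] + k)) (take n u) = \<xi> (take n u) + (if n = 1 then (if hd u = g then k else 0) else 0)"
        by auto
    qed
    also have "\<dots> = (\<Sum>n\<in>{1..length u}. \<xi> (take n u)) + (if u \<noteq> [] \<and> hd u = g then k else 0)"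
      by (cases u) (simp_all add: sum.distrib sum.delta Suc_le_eq)
    finally show ?thesis .
  qed
  then show ?thesis by (auto simp: heights_def)
qed

lemma level_fraction_hd:
  assumes "g \<le> d"
  shows "real (card {v \<in> level d (Suc n). hd v = g}) / real (card (level d (Suc n))) = 1 / (real d + 1)"
proof -
  have "real (card (level d (Suc n))) = (real d + 1) * real d ^ n" by (simp add: card_level algebra_simps)
  then show ?thesis unfolding card_level_hd[OF assms] using d_ge_2 by simp
qed

lemma sphere_average_add_indicator:
  assumes "\<And>u. u \<in> level d r \<Longrightarrow> \<omega>' u = \<omega> u + (if P u then k else 0)"
  shows "sphere_average d r \<omega>' = sphere_average d r \<omega> +
    real_of_int k * (real (card {u \<in> level d r. P u}) / real (card (level d r)))"
proof -
  have "(\<Sum>u\<in>level d r. real_of_int (\<omega>' u)) = (\<Sum>u\<in>level d r. real_of_int (\<omega> u)) + (\<Sum>u\<in>level d r. if P u then real_of_int k else 0)"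
    unfolding sum.distrib[symmetric] by (intro sum.cong) (auto simp: assms)
  also have "(\<Sum>u\<in>level d r. if P u then real_of_int k else 0) = real_of_int k * real (card {u \<in> level d r. P u})"
    by (simp add: sum.If_cases Int_def)
  finally show ?thesis
    by (simp add: sphere_average_def sphere_verts_eq_level add_divide_distrib)
qed

text \<open>From the first level on, the branch of \<open>g\<close> has the share 1 / (d + 1) of
  every level, so the averages differ by a constant. The identity holds for every
  \<open>\<xi>\<close>, convergent or not.\<close>

lemma limit_average_update_generator:
  assumes g: "g \<le> d"
  shows "limit_average d (heights s (\<xi>([g] := \<xi> [g] + k))) =
    limit_average d (heights s \<xi>) + ereal (real_of_int k / (real d + 1))"
  unfolding limit_average_eq_limsup
proof (rule limsup_add_const)
  show "\<forall>\<^sub>F r in sequentially. sphere_average d r (heights s (\<xi>([g] := \<xi> [g] + k))) =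
      sphere_average d r (heights s \<xi>) + real_of_int k / (real d + 1)"
    using eventually_ge_at_top[of 1]
  proof eventually_elim
    case (elim r)
    then obtain n where r: "r = Suc n" by (cases r) auto
    have eq: "{u \<in> level d r. u \<noteq> [] \<and> hd u = g} = {u \<in> level d (Suc n). hd u = g}"
      by (auto simp: r level_def)
    have "sphere_average d r (heights s (\<xi>([g] := \<xi> [g] + k))) = sphere_average d r (heights s \<xi>) +
        real_of_int k * (real (card {u \<in> level d r. u \<noteq> [] \<and> hd u = g}) / real (card (level d r)))"
      by (rule sphere_average_add_indicator) (simp add: heights_update_generator[OF g] level_def)
    then show ?case unfolding eq using level_fraction_hd[OF g, of n] by (simp add: r)
  qed
qed

lemma limit_average_translate_update_generator:
  assumes g: "g \<le> d"
  shows "limit_average d (translate d [g] (heights s (\<xi>([g] := \<xi> [g] + k)))) =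
    limit_average d (translate d [g] (heights s \<xi>)) + ereal (real_of_int k * (real d / (real d + 1)))"
  unfolding limit_average_eq_limsup
proof (rule limsup_add_const)
  show "\<forall>\<^sub>F r in sequentially. sphere_average d r (translate d [g] (heights s (\<xi>([g] := \<xi> [g] + k)))) =
      sphere_average d r (translate d [g] (heights s \<xi>)) + real_of_int k * (real d / (real d + 1))"
    using eventually_ge_at_top[of 1]
  proof eventually_elim
    case (elim r)
    then obtain n where r: "r = Suc n" by (cases r) auto
    have card: "real (card {u \<in> level d r. hd u \<noteq> g}) / real (card (level d r)) = real d / (real d + 1)"
    proof -
      have "{u \<in> level d r. hd u \<noteq> g} = level d r - {u \<in> level d r. hd u = g}" by auto
      then have "real (card {u \<in> level d r. hd u \<noteq> g}) = real (card (level d r)) - real (card {u \<in> level d r. hd u = g})"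
        by (simp add: card_Diff_subset of_nat_diff card_mono)
      then have "real (card {u \<in> level d r. hd u \<noteq> g}) / real (card (level d r)) = 1 - 1 / (real d + 1)"
        using level_fraction_hd[OF g, of n] card_level_pos[OF d_ge_2, of r]
        unfolding card_gt_0_iff by (simp add: r diff_divide_distrib)
      then show ?thesis by (simp add: field_simps)
    qed
    have "sphere_average d r (translate d [g] (heights s (\<xi>([g] := \<xi> [g] + k)))) = sphere_average d r (translate d [g] (heights s \<xi>)) +
        real_of_int k * (real (card {u \<in> level d r. hd u \<noteq> g}) / real (card (level d r)))"
    proof (rule sphere_average_add_indicator)
      fix u assume "u \<in> level d r"
      then have u: "u \<in> verts d" "u \<noteq> []" by (auto simp: r level_def)
      then show "translate d [g] (heights s (\<xi>([g] := \<xi> [g] + k))) u = translate d [g] (heights s \<xi>) u + (if hd u \<noteq> g then k else 0)"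
        using hd_gen_cons[OF u, of g] gen_cons_in_verts[OF g u(1)]
        by (simp add: translate_generator heights_update_generator[OF g])
    qed
    then show ?case unfolding card .
  qed
qed

lemma translate_heights:
  assumes "g \<le> d"
  shows "translate d [g] (heights s \<xi>) = height_shift d (- s) (translate d [g] (heights 0 \<xi>))"
  using assms by (auto simp: translate_generator height_shift_def heights_def gen_cons_in_verts)

lemma generator_nonroot: "g \<le> d \<Longrightarrow> [g] \<in> nonroot d"
  by (simp add: nonroot_def verts_def)

text \<open>Raising the heights in one branch at the root by \<open>k\<close> raises the limiting average by
  \<open>k / (d + 1)\<close>, but the one centred at the adjacent vertex by \<open>k d / (d + 1)\<close>; so these cannot
  both be confined to a bounded window.\<close>

theorem not_translation_invariant:
  "\<not> (\<forall>v\<in>verts d. distr mu (height_space d) (translate d v) = mu)"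
proof
  assume inv: "\<forall>v\<in>verts d. distr mu (height_space d) (translate d v) = mu"
  let ?L = "level_sum (nonroot d)"
  let ?T = "\<lambda>\<xi>. limit_average d (translate d [0] (heights 0 \<xi>))"
  have [measurable]: "Measurable.pred (height_space d) (\<lambda>\<omega>. \<omega> \<in> window)" by simp
  have "AE \<omega> in mu. \<omega> \<in> window"
    unfolding AE_mu_iff[OF \<open>Measurable.pred (height_space d) (\<lambda>\<omega>. \<omega> \<in> window)\<close>]
    using AE_limit_average by eventually_elim (simp add: floor_in_window)
  then have "AE \<omega> in distr mu (height_space d) (translate d [0]). \<omega> \<in> window"
  proof -
    have "[0] \<in> verts d" using generator_nonroot[of 0] by (simp add: nonroot_def)
    then have "distr mu (height_space d) (translate d [0]) = mu" by (rule bspec[OF inv])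
    then show ?thesis using \<open>AE \<omega> in mu. \<omega> \<in> window\<close> by (simp only:)
  qed
  then have "AE \<omega> in mu. translate d [0] \<omega> \<in> window"
    by (rule AE_distrD[rotated]) simp
  moreover have "Measurable.pred (height_space d) (\<lambda>\<omega>. translate d [0] \<omega> \<in> window)"
    by measurable
  ultimately have "AE \<xi> in noise. translate d [0] (heights (- \<lfloor>?L \<xi>\<rfloor>) \<xi>) \<in> window"
    by (simp add: AE_mu_iff)
  \<comment> \<open>The same integer is subtracted in both averages, and both land in the window;
    hence they differ by less than one before the subtraction too.\<close>
  then have close: "AE \<xi> in noise. limit_average d (heights 0 \<xi>) = ereal (?L \<xi>) \<and>
      (\<exists>\<tau>. ?T \<xi> = ereal \<tau> \<and> \<bar>\<tau> - ?L \<xi>\<bar> < 1)"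
    using AE_limit_average
  proof eventually_elim
    case (elim \<xi>)
    have "limit_average d (translate d [0] (heights (- \<lfloor>?L \<xi>\<rfloor>) \<xi>)) = ?T \<xi> - ereal (real_of_int \<lfloor>?L \<xi>\<rfloor>)"
      using translate_heights[of 0 "- \<lfloor>?L \<xi>\<rfloor>" \<xi>] by (simp add: limit_average_shift[OF d_ge_2])
    then have *: "0 \<le> ?T \<xi> - ereal (real_of_int \<lfloor>?L \<xi>\<rfloor>)" "?T \<xi> - ereal (real_of_int \<lfloor>?L \<xi>\<rfloor>) < 1"
      using elim(1) by (auto simp: window_def)
    then obtain \<tau> where \<tau>: "?T \<xi> = ereal \<tau>" by (cases "?T \<xi>") auto
    then have "0 \<le> \<tau> - real_of_int \<lfloor>?L \<xi>\<rfloor>" "\<tau> - real_of_int \<lfloor>?L \<xi>\<rfloor> < 1"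
      using * by (auto simp: one_ereal_def zero_ereal_def)
    then have "\<bar>\<tau> - ?L \<xi>\<bar> < 1" by linarith
    then show ?case using \<tau> elim(2) by simp
  qed
  have "AE \<xi> in noise. False"
    using AE_resample[OF generator_nonroot close, of 0, simplified]
  proof eventually_elim
    case (elim \<xi>)
    \<comment> \<open>A shift by 6 separates the two averages by a further 6 (d - 1) / (d + 1), at
      least 2 for every d from 2 on, whereas two differences in (-1, 1) are less than 2
      apart.\<close>
    let ?\<xi>' = "\<xi>([0] := \<xi> [0] + 6)"
    have self: "\<xi>([0] := \<xi> [0]) = \<xi>" by simp
    obtain \<tau> where \<tau>: "limit_average d (heights 0 \<xi>) = ereal (?L \<xi>)" "?T \<xi> = ereal \<tau>" "\<bar>\<tau> - ?L \<xi>\<bar> < 1"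
      using elim[rule_format, of "\<xi> [0]"] unfolding self by blast
    obtain \<tau>' where \<tau>': "limit_average d (heights 0 ?\<xi>') = ereal (?L ?\<xi>')" "?T ?\<xi>' = ereal \<tau>'" "\<bar>\<tau>' - ?L ?\<xi>'\<bar> < 1"
      using elim[rule_format, of "\<xi> [0] + 6"] by blast
    have 1: "?L ?\<xi>' = ?L \<xi> + 6 / (real d + 1)"
      using limit_average_update_generator[of 0 0 \<xi> 6] \<tau>(1) \<tau>'(1) by simp
    have 2: "\<tau>' = \<tau> + 6 * (real d / (real d + 1))"
      using limit_average_translate_update_generator[of 0 0 \<xi> 6] \<tau>(2) \<tau>'(2) by simp
    have "6 * (real d / (real d + 1)) - 6 / (real d + 1) \<ge> 2"
    proof -
      have "6 * (real d / (real d + 1)) - 6 / (real d + 1) = (6 * real d - 6) / (real d + 1)"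
        by (simp add: diff_divide_distrib)
      also have "\<dots> \<ge> 2" using d_ge_2 by (simp add: pos_le_divide_eq)
      finally show ?thesis .
    qed
    then show False using 1 2 \<tau>(3) \<tau>'(3) by linarith
  qed
  then show False by simp
qed

subsection \<open>The measure is not extreme\<close>

lemma gibbs_kernel_measurable:
  assumes \<Lambda>: "finite \<Lambda>" "\<Lambda> \<subseteq> verts d" and A [measurable]: "A \<in> sets (height_space d)"
  shows "(\<lambda>\<omega>. emeasure (gibbs_kernel d Q \<Lambda> \<omega>) A) \<in> borel_measurable (height_space d)"
proof -
  note [measurable] = local_partition_measurable[OF \<Lambda>] local_weight_measurable[OF \<Lambda>(2)]
  let ?C = "\<Lambda> \<rightarrow>\<^sub>E (UNIV :: int set)"
  let ?f = "\<lambda>\<theta> \<omega>. ennreal (local_weight d Q \<Lambda> (local_shift d \<Lambda> \<theta> \<omega>)) / local_partition \<Lambda> \<omega> *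
      indicator A (local_shift d \<Lambda> \<theta> \<omega>)"
  have "(\<lambda>\<omega>. \<integral>\<^sup>+\<theta>. ?f \<theta> \<omega> \<partial>count_space ?C) \<in> borel_measurable (height_space d)"
    using \<Lambda> by (intro nn_integral_count_space_measurable countable_PiE) auto
  then show ?thesis
    by (rule measurable_cong[THEN iffD1, rotated]) (simp add: emeasure_gibbs_kernel[OF \<Lambda> _ A])
qed

text \<open>The kernels move no configuration into or out of \<open>B\<close>, so conditioning on
  \<open>B\<close> commutes with them and the Gibbs equation for \<open>mu\<close> carries
  over.\<close>

lemma gibbs_measure_conditioned:
  assumes B [measurable]: "B \<in> sets (height_space d)" and pos: "emeasure mu B \<noteq> 0"
    and inv: "\<And>\<Lambda> \<theta> \<omega>. finite \<Lambda> \<Longrightarrow> \<omega> \<in> space (height_space d) \<Longrightarrow> local_shift d \<Lambda> \<theta> \<omega> \<in> B \<longleftrightarrow> \<omega> \<in> B"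
  shows "gibbs_measure d Q (uniform_measure mu B)"
  unfolding gibbs_measure_def
proof (intro conjI allI impI)
  show "prob_space (uniform_measure mu B)"
    using pos by (rule prob_space_uniform_measure) simp
  show "sets (uniform_measure mu B) = sets (height_space d)" by simp
  fix \<Lambda> A assume "finite \<Lambda> \<and> \<Lambda> \<subseteq> verts d \<and> A \<in> sets (height_space d)"
  then have \<Lambda>: "finite \<Lambda>" "\<Lambda> \<subseteq> verts d" and A [measurable]: "A \<in> sets (height_space d)" by auto
  have m: "(\<lambda>\<omega>. emeasure (gibbs_kernel d Q \<Lambda> \<omega>) A) \<in> borel_measurable mu"
    using gibbs_kernel_measurable[OF \<Lambda> A] by (simp add: measurable_cong_sets[OF sets_mu refl])
  have "(\<integral>\<^sup>+\<omega>. emeasure (gibbs_kernel d Q \<Lambda> \<omega>) A \<partial>uniform_measure mu B) =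
      (\<integral>\<^sup>+\<omega>. emeasure (gibbs_kernel d Q \<Lambda> \<omega>) A * indicator B \<omega> \<partial>mu) / emeasure mu B"
    by (rule nn_integral_uniform_measure[OF m]) simp
  also have "(\<integral>\<^sup>+\<omega>. emeasure (gibbs_kernel d Q \<Lambda> \<omega>) A * indicator B \<omega> \<partial>mu) =
      (\<integral>\<^sup>+\<omega>. emeasure (gibbs_kernel d Q \<Lambda> \<omega>) (A \<inter> B) \<partial>mu)"
    using inv[OF \<Lambda>(1)] by (intro nn_integral_cong) (simp add: emeasure_gibbs_kernel_Int[OF \<Lambda> _ A B])
  also have "\<dots> = emeasure mu (A \<inter> B)"
    using gibbs_measure_mu \<Lambda> unfolding gibbs_measure_def by (metis A B sets.Int)
  also have "emeasure mu (A \<inter> B) / emeasure mu B = emeasure (uniform_measure mu B) A"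
    by (simp add: Int_commute)
  finally show "(\<integral>\<^sup>+\<omega>. emeasure (gibbs_kernel d Q \<Lambda> \<omega>) A \<partial>uniform_measure mu B) = emeasure (uniform_measure mu B) A" .
qed

lemma level_sum_interval_pos:
  assumes "a < b" shows "emeasure noise {\<xi> \<in> space noise. level_sum (nonroot d) \<xi> \<in> {a<..<b}} \<noteq> 0"
proof
  assume 0: "emeasure noise {\<xi> \<in> space noise. level_sum (nonroot d) \<xi> \<in> {a<..<b}} = 0"
  obtain f where f: "level_law (nonroot d) = density lborel (\<lambda>x. ennreal (f x))" "\<And>x. f x > 0"
    "f \<in> borel_measurable borel"
    by (rule level_law_positive_density) blast
  have "emeasure (level_law (nonroot d)) {a<..<b} = 0"
    unfolding level_law_def using 0 by (subst emeasure_distr) (auto simp: vimage_def Int_def conj_commute)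
  then have "AE x in lborel. ennreal (f x) * indicator {a<..<b} x = 0"
    unfolding f(1) using f(3) by (simp add: emeasure_density nn_integral_0_iff_AE)
  then have "AE x in lborel. x \<notin> {a<..<b}"
    by eventually_elim (use f(2) in \<open>auto simp: indicator_def split: if_splits\<close>, metis ennreal_eq_0_iff not_le)
  then have "emeasure lborel {x \<in> space lborel. \<not> x \<notin> {a<..<b}} = 0"
    by (subst (asm) AE_iff_measurable[OF _ refl]) auto
  then have "emeasure lborel {a<..<b} = 0"
    by (simp add: greaterThanLessThan_eq Int_def conj_commute)
  then show False using assms by simp
qed

text \<open>Positivity of the density gives the limiting average values on both sides of 1/2 within
  the window with positive probability; \<open>mu\<close> is thus a proper mixture of two
  conditioned Gibbs measures, which differ on \<open>B\<close>.\<close>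

theorem not_extreme: "\<not> extreme_gibbs_measure d Q mu"
proof -
  let ?L = "level_sum (nonroot d)"
  define B where "B = {\<omega> \<in> space (height_space d). limit_average d \<omega> < ereal (1/2)}"
  define B' where "B' = space (height_space d) - B"
  have B [measurable]: "B \<in> sets (height_space d)" unfolding B_def by measurable
  have B' [measurable]: "B' \<in> sets (height_space d)" unfolding B'_def by measurable
  have inv: "local_shift d \<Lambda> \<theta> \<omega> \<in> B \<longleftrightarrow> \<omega> \<in> B" if "finite \<Lambda>" "\<omega> \<in> space (height_space d)" for \<Lambda> \<theta> \<omega>
    using that by (simp add: B_def limit_average_local_shift)
  then have inv': "local_shift d \<Lambda> \<theta> \<omega> \<in> B' \<longleftrightarrow> \<omega> \<in> B'" if "finite \<Lambda>" "\<omega> \<in> space (height_space d)" for \<Lambda> \<theta> \<omega>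
    using that by (simp add: B'_def)
  have H: "AE \<xi> in noise. limit_average d (heights (- \<lfloor>?L \<xi>\<rfloor>) \<xi>) = ereal (?L \<xi> - real_of_int \<lfloor>?L \<xi>\<rfloor>)"
    using AE_limit_average by eventually_elim simp
  have pos: "emeasure mu S \<noteq> 0"
    if S [measurable]: "S \<in> sets (height_space d)" and ab: "0 \<le> a" "a < b" "b \<le> 1"
      and sub: "\<And>\<xi>. limit_average d (heights (- \<lfloor>?L \<xi>\<rfloor>) \<xi>) = ereal (?L \<xi> - real_of_int \<lfloor>?L \<xi>\<rfloor>) \<Longrightarrow>
        ?L \<xi> \<in> {a<..<b} \<Longrightarrow> heights (- \<lfloor>?L \<xi>\<rfloor>) \<xi> \<in> S" for S a b
  proof
    assume "emeasure mu S = 0"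
    then have "AE \<omega> in mu. \<omega> \<notin> S" by (intro AE_I[of _ _ S]) auto
    moreover have "Measurable.pred (height_space d) (\<lambda>\<omega>. \<omega> \<notin> S)" by measurable
    ultimately have "AE \<xi> in noise. heights (- \<lfloor>?L \<xi>\<rfloor>) \<xi> \<notin> S" by (simp add: AE_mu_iff)
    then have "AE \<xi> in noise. \<not> ?L \<xi> \<in> {a<..<b}"
      using H by eventually_elim (use sub in blast)
    then have "emeasure noise {\<xi> \<in> space noise. \<not> \<not> ?L \<xi> \<in> {a<..<b}} = 0"
      by (subst (asm) AE_iff_measurable[OF _ refl]) auto
    then show False using level_sum_interval_pos[OF ab(2)] by simp
  qed
  have posB: "emeasure mu B \<noteq> 0"
  proof (rule pos[of B 0 "1/2"])
    fix \<xi> assume *: "limit_average d (heights (- \<lfloor>?L \<xi>\<rfloor>) \<xi>) = ereal (?L \<xi> - real_of_int \<lfloor>?L \<xi>\<rfloor>)" "?L \<xi> \<in> {0<..<1/2}"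
    then have "\<lfloor>?L \<xi>\<rfloor> = 0" by (intro floor_unique) auto
    then show "heights (- \<lfloor>?L \<xi>\<rfloor>) \<xi> \<in> B" using * by (simp add: B_def)
  qed auto
  have posB': "emeasure mu B' \<noteq> 0"
  proof (rule pos[of B' "1/2" 1])
    fix \<xi> assume *: "limit_average d (heights (- \<lfloor>?L \<xi>\<rfloor>) \<xi>) = ereal (?L \<xi> - real_of_int \<lfloor>?L \<xi>\<rfloor>)" "?L \<xi> \<in> {1/2<..<1}"
    then have "\<lfloor>?L \<xi>\<rfloor> = 0" by (intro floor_unique) auto
    then show "heights (- \<lfloor>?L \<xi>\<rfloor>) \<xi> \<in> B'" using * by (simp add: B'_def B_def)
  qed auto
  let ?t = "measure mu B"
  have compl: "measure mu B' = 1 - ?t"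
    using mu.prob_compl[of B] by (simp add: B'_def)
  have t: "0 < ?t" "?t < 1"
    using posB posB' compl by (auto simp: mu.emeasure_eq_measure zero_less_measure_iff measure_nonneg less_le)
  have um: "measure (uniform_measure mu S) A = measure mu (S \<inter> A) / measure mu S"
    if "S \<in> sets (height_space d)" "emeasure mu S \<noteq> 0" "A \<in> sets (height_space d)" for S A
    using that by (intro measure_uniform_measure) (auto simp: mu.emeasure_eq_measure)
  have ne: "uniform_measure mu B \<noteq> uniform_measure mu B'"
  proof
    assume "uniform_measure mu B = uniform_measure mu B'"
    then have "measure (uniform_measure mu B) B = measure (uniform_measure mu B') B" by simp
    moreover have "B' \<inter> B = {}" by (auto simp: B'_def)
    ultimately show False using um[OF B posB B] um[OF B' posB' B] t by simp
  qed
  have "measure mu A = ?t * measure (uniform_measure mu B) A + (1 - ?t) * measure (uniform_measure mu B') A"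
    if A: "A \<in> sets (height_space d)" for A
  proof -
    have "A = (B \<inter> A) \<union> (B' \<inter> A)" using sets.sets_into_space[OF A] by (auto simp: B'_def)
    then have "measure mu A = measure mu (B \<inter> A) + measure mu (B' \<inter> A)"
      using A B B' by (subst (1) \<open>A = (B \<inter> A) \<union> (B' \<inter> A)\<close>, intro mu.finite_measure_Union) (auto simp: B'_def)
    then show ?thesis using um[OF B posB A] um[OF B' posB' A] t compl by simp
  qed
  then show ?thesis
    unfolding extreme_gibbs_measure_def
    using gibbs_measure_conditioned[OF B posB inv] gibbs_measure_conditioned[OF B' posB' inv'] ne t by blast
qed

subsection \<open>The Markov property fails\<close>

text \<open>The limiting average with the increments of two root edges set to zero, so that it does
  not depend on these two.\<close>

definition base :: "height_config \<Rightarrow> ereal" where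
  "base \<xi> = limit_average d (heights 0 (\<xi>([0] := 0, [1] := 0)))"

text \<open>The probability that the configuration with root height 0 falls into the window when the
  two selected root increments have sum \<open>m\<close>.\<close>

definition window_prob :: "int \<Rightarrow> ennreal" where
  "window_prob m = emeasure noise {\<xi> \<in> space noise. 0 \<le> base \<xi> + ereal (real_of_int m / (real d + 1)) \<and>
     base \<xi> + ereal (real_of_int m / (real d + 1)) < 1}"

lemma generators_le: "(0::nat) \<le> d" "1 \<le> d" using d_ge_2 by auto

lemma base_measurable [measurable]: "base \<in> borel_measurable noise"
proof -
  have "(\<lambda>\<xi>. \<xi>([0] := 0, [1] := 0)) \<in> noise \<rightarrow>\<^sub>M noise"
    using generators_le by (intro measurable_compose[OF noise_update_const noise_update_const] generator_nonroot)
  then show ?thesis unfolding base_def[abs_def] by measurable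
qed

lemma AE_base_finite: "AE \<xi> in noise. \<bar>base \<xi>\<bar> \<noteq> \<infinity>"
proof -
  have "AE \<xi> in noise. \<bar>limit_average d (heights 0 \<xi>)\<bar> \<noteq> \<infinity>"
    using AE_limit_average by eventually_elim simp
  then have "AE \<xi> in noise. \<forall>k. \<bar>limit_average d (heights 0 (\<xi>([1] := k)))\<bar> \<noteq> \<infinity>"
    by (rule AE_resample[OF generator_nonroot[OF generators_le(2)]])
  then have "AE \<xi> in noise. \<forall>j. \<forall>k. \<bar>limit_average d (heights 0 (\<xi>([0] := j, [1] := k)))\<bar> \<noteq> \<infinity>"
    by (rule AE_resample[OF generator_nonroot[OF generators_le(1)]])
  then show ?thesis by eventually_elim (simp add: base_def)
qed

lemma limit_average_two_generators:
  "limit_average d (heights 0 (\<xi>([0] := j, [1] := k))) = base \<xi> + ereal (real_of_int (j + k) / (real d + 1))"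
proof -
  have "\<xi>([0] := j, [1] := k) = (\<xi>([0] := j, [1] := 0))([1] := (\<xi>([0] := j, [1] := 0)) [1] + k)"
    by simp
  then have "limit_average d (heights 0 (\<xi>([0] := j, [1] := k))) =
      limit_average d (heights 0 (\<xi>([0] := j, [1] := 0))) + ereal (real_of_int k / (real d + 1))"
    using limit_average_update_generator[OF generators_le(2), of 0 "\<xi>([0] := j, [1] := 0)" k] by simp
  also have "\<xi>([0] := j, [1] := 0) = (\<xi>([0] := 0, [1] := 0))([0] := (\<xi>([0] := 0, [1] := 0)) [0] + j)"
    by (auto simp: fun_eq_iff)
  also have "limit_average d (heights 0 ((\<xi>([0] := 0, [1] := 0))([0] := (\<xi>([0] := 0, [1] := 0)) [0] + j))) =
      base \<xi> + ereal (real_of_int j / (real d + 1))"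
    unfolding base_def by (rule limit_average_update_generator[OF generators_le(1)])
  finally have "limit_average d (heights 0 (\<xi>([0] := j, [1] := k))) =
      base \<xi> + ereal (real_of_int j / (real d + 1)) + ereal (real_of_int k / (real d + 1))" .
  then show ?thesis
    by (simp only: add.assoc plus_ereal.simps(1) add_divide_distrib of_int_add)
qed

text \<open>As \<open>m\<close> runs through a residue class modulo \<open>d + 1\<close>, the conditions on \<open>base \<xi>\<close>
  partition the real line into unit intervals.\<close>

lemma window_prob_sum: "(\<integral>\<^sup>+n. window_prob (n * (int d + 1) + m) \<partial>count_space UNIV) = 1"
proof -
  let ?I = "\<lambda>n \<xi>. indicator {\<xi> \<in> space noise. 0 \<le> base \<xi> + ereal (real_of_int (n * (int d + 1) + m) / (real d + 1)) \<and>
     base \<xi> + ereal (real_of_int (n * (int d + 1) + m) / (real d + 1)) < 1} \<xi> :: ennreal"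
  have "(\<integral>\<^sup>+n. window_prob (n * (int d + 1) + m) \<partial>count_space UNIV) = (\<integral>\<^sup>+n. (\<integral>\<^sup>+\<xi>. ?I n \<xi> \<partial>noise) \<partial>count_space UNIV)"
    unfolding window_prob_def by (intro nn_integral_cong nn_integral_indicator[symmetric]) measurable
  also have "\<dots> = (\<integral>\<^sup>+\<xi>. (\<integral>\<^sup>+n. ?I n \<xi> \<partial>count_space UNIV) \<partial>noise)"
    by (rule nn_integral_count_space_nn_integral[symmetric]) measurable
  also have "\<dots> = (\<integral>\<^sup>+\<xi>. 1 \<partial>noise)"
    using AE_base_finite AE_space[of noise]
  proof (intro nn_integral_cong_AE, eventually_elim)
    case (elim \<xi>)
    then obtain b where b: "base \<xi> = ereal b" by (cases "base \<xi>") auto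
    define x where "x = b + real_of_int m / (real d + 1)"
    have "b + real_of_int (n * (int d + 1) + m) / (real d + 1) = x + real_of_int n" for n
      by (simp add: x_def add_divide_distrib)
    then have e: "base \<xi> + ereal (real_of_int (n * (int d + 1) + m) / (real d + 1)) = ereal (x + real_of_int n)" for n
      by (simp only: b plus_ereal.simps(1))
    have I: "?I n \<xi> = indicator {- \<lfloor>x\<rfloor>} n" for n
      unfolding indicator_def mem_Collect_eq e using elim(4) floor_eq_iff[of x "- n"]
      by (auto simp: one_ereal_def zero_ereal_def)
    have "(\<integral>\<^sup>+n. ?I n \<xi> \<partial>count_space UNIV) = (\<integral>\<^sup>+n. indicator {- \<lfloor>x\<rfloor>} n \<partial>count_space UNIV)"
      by (simp only: I)
    also have "\<dots> = 1" by simp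
    finally show ?case .
  qed
  finally show ?thesis by (simp add: noise.emeasure_space_1)
qed

lemma nn_integral_q_at:
  assumes "\<And>i. i \<noteq> k \<Longrightarrow> f i = 0"
  shows "(\<integral>\<^sup>+i. f i \<partial>q) = ennreal (prob k) * f k"
proof -
  have "(\<integral>\<^sup>+i. f i \<partial>q) = (\<integral>\<^sup>+i. f k * indicator {k} i \<partial>q)"
    using assms by (intro nn_integral_cong) (auto simp: indicator_def)
  also have "\<dots> = f k * emeasure q {k}" by (rule nn_integral_cmult_indicator) simp
  finally show ?thesis by (simp add: emeasure_q_singleton mult.commute)
qed

text \<open>With the root at height 0 the two increments are independent except through the window
  condition, which sees only their sum. This dependence on \<open>j + k\<close> is what the Markov
  property cannot accommodate.\<close>

lemma emeasure_mu_two_generators: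
  "emeasure mu {\<omega> \<in> space (height_space d). \<omega> [] = 0 \<and> \<omega> [0] = j \<and> \<omega> [1] = k} =
    ennreal (prob j) * (ennreal (prob k) * window_prob (j + k))"
proof -
  let ?S = "{\<omega> \<in> space (height_space d). \<omega> [] = 0 \<and> \<omega> [0] = j \<and> \<omega> [1] = k}"
  have v: "[] \<in> verts d" "[0] \<in> verts d" "[1] \<in> verts d" using generators_le by (auto simp: verts_def)
  have n: "[0] \<in> nonroot d" "[1] \<in> nonroot d" using generators_le by (auto intro: generator_nonroot)
  have S [measurable]: "?S \<in> sets (height_space d)"
  proof -
    have "?S = {\<omega> \<in> space (height_space d). \<omega> [] = 0} \<inter> ({\<omega> \<in> space (height_space d). \<omega> [0] = j} \<inter>
        {\<omega> \<in> space (height_space d). \<omega> [1] = k})" by auto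
    then show ?thesis using v by (simp only:) (intro sets.Int height_event)
  qed
  have h: "heights 0 \<xi> [0] = \<xi> [0]" "heights 0 \<xi> [Suc 0] = \<xi> [Suc 0]" for \<xi>
    using v by (simp_all add: heights_def)
  let ?f = "\<lambda>\<xi>. indicator ?S (heights 0 \<xi>) * indicator window (heights 0 \<xi>) :: ennreal"
  have "emeasure mu ?S = (\<integral>\<^sup>+\<omega>. indicator ?S \<omega> \<partial>mu)"
    using S by (intro nn_integral_indicator[symmetric]) simp
  also have "\<dots> = (\<integral>\<^sup>+s. (\<integral>\<^sup>+\<xi>. indicator ?S (heights s \<xi>) * indicator window (heights s \<xi>) \<partial>noise) \<partial>count_space UNIV)"
    by (rule nn_integral_mu) measurable
  also have "\<dots> = (\<Sum>s\<in>{0}. (\<integral>\<^sup>+\<xi>. indicator ?S (heights s \<xi>) * indicator window (heights s \<xi>) \<partial>noise))"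
    by (rule nn_integral_count_space') (auto simp: indicator_def)
  also have "\<dots> = (\<integral>\<^sup>+\<xi>. ?f \<xi> \<partial>noise)" by simp
  also have "\<dots> = (\<integral>\<^sup>+\<xi>. (\<integral>\<^sup>+j'. ?f (\<xi>([1] := j')) \<partial>q) \<partial>noise)"
    by (rule nn_integral_resample[OF n(2)]) measurable
  also have "\<dots> = (\<integral>\<^sup>+\<xi>. ennreal (prob k) * ?f (\<xi>([1] := k)) \<partial>noise)"
  proof (rule nn_integral_cong)
    fix \<xi>
    show "(\<integral>\<^sup>+j'. ?f (\<xi>([1] := j')) \<partial>q) = ennreal (prob k) * ?f (\<xi>([1] := k))"
      by (rule nn_integral_q_at) (auto simp: indicator_def h)
  qed
  also have "\<dots> = ennreal (prob k) * (\<integral>\<^sup>+\<xi>. ?f (\<xi>([1] := k)) \<partial>noise)"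
    using n by (intro nn_integral_cmult) measurable
  also have "(\<integral>\<^sup>+\<xi>. ?f (\<xi>([1] := k)) \<partial>noise) = (\<integral>\<^sup>+\<xi>. (\<integral>\<^sup>+j'. ?f (\<xi>([0] := j', [1] := k)) \<partial>q) \<partial>noise)"
    using n by (intro nn_integral_resample) measurable
  also have "\<dots> = (\<integral>\<^sup>+\<xi>. ennreal (prob j) * ?f (\<xi>([0] := j, [1] := k)) \<partial>noise)"
  proof (rule nn_integral_cong)
    fix \<xi>
    show "(\<integral>\<^sup>+j'. ?f (\<xi>([0] := j', [1] := k)) \<partial>q) = ennreal (prob j) * ?f (\<xi>([0] := j, [1] := k))"
      by (rule nn_integral_q_at) (auto simp: indicator_def h)
  qed
  also have "\<dots> = ennreal (prob j) * (\<integral>\<^sup>+\<xi>. ?f (\<xi>([0] := j, [1] := k)) \<partial>noise)"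
  proof (rule nn_integral_cmult)
    have "(\<lambda>\<xi>. \<xi>([0] := j, [1] := k)) \<in> noise \<rightarrow>\<^sub>M noise"
      using n by (intro measurable_compose[OF noise_update_const noise_update_const])
    then show "(\<lambda>\<xi>. ?f (\<xi>([0] := j, [1] := k))) \<in> borel_measurable noise" by measurable
  qed
  also have "(\<integral>\<^sup>+\<xi>. ?f (\<xi>([0] := j, [1] := k)) \<partial>noise) = window_prob (j + k)"
  proof -
    have "?f (\<xi>([0] := j, [1] := k)) = indicator {\<xi> \<in> space noise. 0 \<le> base \<xi> + ereal (real_of_int (j + k) / (real d + 1)) \<and>
       base \<xi> + ereal (real_of_int (j + k) / (real d + 1)) < 1} \<xi>" if "\<xi> \<in> space noise" for \<xi>
      using that limit_average_two_generators[of \<xi> j k] by (simp add: indicator_def h window_def)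
    then have "(\<integral>\<^sup>+\<xi>. ?f (\<xi>([0] := j, [1] := k)) \<partial>noise) =
        (\<integral>\<^sup>+\<xi>. indicator {\<xi> \<in> space noise. 0 \<le> base \<xi> + ereal (real_of_int (j + k) / (real d + 1)) \<and>
       base \<xi> + ereal (real_of_int (j + k) / (real d + 1)) < 1} \<xi> \<partial>noise)"
      by (intro nn_integral_cong) simp
    also have "\<dots> = window_prob (j + k)"
      unfolding window_prob_def by (rule nn_integral_indicator) measurable
    finally show ?thesis .
  qed
  finally show ?thesis by (simp only: mult.left_commute)
qed

text \<open>No event of this sigma-algebra separates two configurations that agree at
  \<open>u\<close>, by induction over its generation; so neither do level sets of
  \<open>f\<close>.\<close>

lemma coord_algebra_single_cong:
  assumes f: "f \<in> borel_measurable (coord_algebra d {u})"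
    and \<omega>: "\<omega> \<in> space (height_space d)" "\<omega>' \<in> space (height_space d)" "\<omega> u = \<omega>' u"
  shows "f \<omega> = (f \<omega>' :: real)"
proof -
  have "\<omega> \<in> S \<longleftrightarrow> \<omega>' \<in> S" if "S \<in> sets (coord_algebra d {u})" for S
    using that unfolding sets_coord_algebra
    by (induction rule: sigma_sets.induct) (use \<omega> in auto)
  moreover have "f -` {f \<omega>} \<inter> space (coord_algebra d {u}) \<in> sets (coord_algebra d {u})"
    by (rule measurable_sets[OF f]) simp
  ultimately have "\<omega>' \<in> f -` {f \<omega>} \<inter> space (coord_algebra d {u})" using \<omega>(1) by auto
  then show ?thesis by simp
qed

text \<open>The Markov property would force a product form \<open>p (j + k) = c j * D k\<close>, so that \<open>p\<close> would
  be constant; but its values along a residue class modulo \<open>d + 1\<close> sum to one.\<close>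

theorem not_markov: "\<not> tree_markov_chain d mu"
proof
  assume mc: "tree_markov_chain d mu"
  have arc: "([], [0]) \<in> arcs d" by (simp add: arcs_iff verts_def)
  have past: "past d [] [0] = {w \<in> verts d. w = [] \<or> hd w \<noteq> 0}" by (rule past_generator) simp
  let ?F = "coord_algebra d (past d [] [0])" and ?G = "coord_algebra d {[]}"
  let ?i = "\<lambda>j. indicator {\<omega>. \<omega> [0] = j} :: height_config \<Rightarrow> real"
  have v: "[] \<in> verts d" "[0] \<in> verts d" "[1] \<in> verts d" using generators_le by (auto simp: verts_def)
  have AE: "AE \<omega> in mu. real_cond_exp mu ?F (?i j) \<omega> = real_cond_exp mu ?G (?i j) \<omega>" for j
    using mc arc unfolding tree_markov_chain_def by blast
  have sub: "subalgebra mu ?F"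
    using sets_coord_algebra_subset[of "past d [] [0]" d] unfolding subalgebra_def past by auto
  interpret F: finite_measure_subalgebra mu ?F
    by standard (rule sub)
  have coord [measurable]: "(\<lambda>\<omega>. \<omega> v) \<in> height_space d \<rightarrow>\<^sub>M count_space UNIV" if "v \<in> verts d" for v
    using that by (rule height_space_component)
  define D where "D k = emeasure mu {\<omega> \<in> space (height_space d). \<omega> [] = 0 \<and> \<omega> [1] = k} / ennreal (prob k)" for k
  have "\<exists>c. \<forall>k. window_prob (j + k) =
      ennreal c * (emeasure mu {\<omega> \<in> space (height_space d). \<omega> [] = 0 \<and> \<omega> [1] = k} / ennreal (prob k))" for j
  proof -
    define \<omega>0 :: height_config where "\<omega>0 = (\<lambda>v\<in>verts d. 0)"
    define \<kappa> where "\<kappa> = real_cond_exp mu ?G (?i j) \<omega>0"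
    have \<omega>0: "\<omega>0 \<in> space (height_space d)" "\<omega>0 [] = 0" by (simp_all add: \<omega>0_def space_height_space)
    \<comment> \<open>Conditioning on the root alone gives a function of the root height, hence a
      single number on the event that this height is 0.\<close>
    have \<kappa>: "real_cond_exp mu ?G (?i j) \<omega> = \<kappa>" if "\<omega> \<in> space (height_space d)" "\<omega> [] = 0" for \<omega>
      unfolding \<kappa>_def using that \<omega>0
      by (intro coord_algebra_single_cong[of _ "[]"] borel_measurable_cond_exp) auto
    have "window_prob (j + k) = ennreal (\<kappa> / prob j) *
        (emeasure mu {\<omega> \<in> space (height_space d). \<omega> [] = 0 \<and> \<omega> [1] = k} / ennreal (prob k))" for k
    proof -
      let ?S = "{\<omega> \<in> space (height_space d). \<omega> [] = 0 \<and> \<omega> [1] = k}"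
      let ?T = "{\<omega> \<in> space (height_space d). \<omega> [] = 0 \<and> \<omega> [0] = j \<and> \<omega> [1] = k}"
      \<comment> \<open>The root and the vertex \<open>[1]\<close> both belong to the past of the
        arc to \<open>[0]\<close>, so this event may be integrated against the conditional
        expectation given the past.\<close>
      have "?S \<in> sets ?F"
      proof -
        have "(\<lambda>\<omega>. \<omega> []) \<in> ?F \<rightarrow>\<^sub>M count_space UNIV" "(\<lambda>\<omega>. \<omega> [1]) \<in> ?F \<rightarrow>\<^sub>M count_space UNIV"
          using v by (auto intro!: coord_algebra_component simp: past)
        from measurable_sets[OF this(1), of "{0}"] measurable_sets[OF this(2), of "{k}"]
        have "((\<lambda>\<omega>. \<omega> []) -` {0} \<inter> space ?F) \<inter> ((\<lambda>\<omega>. \<omega> [1]) -` {k} \<inter> space ?F) \<in> sets ?F" by auto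
        also have "((\<lambda>\<omega>. \<omega> []) -` {0} \<inter> space ?F) \<inter> ((\<lambda>\<omega>. \<omega> [1]) -` {k} \<inter> space ?F) = ?S" by auto
        finally show ?thesis .
      qed
      then have S: "?S \<in> sets ?F" "?S \<in> sets (height_space d)"
        using sub by (auto simp: subalgebra_def)
      have m: "?i j \<in> borel_measurable mu"
      proof -
        have "(\<lambda>\<omega>. indicator {j} (\<omega> [0]) :: real) \<in> borel_measurable (height_space d)"
          by (rule measurable_compose[OF coord[OF v(2)]]) simp
        then have "(\<lambda>\<omega>. indicator {j} (\<omega> [0]) :: real) \<in> borel_measurable mu"
          by (simp add: measurable_cong_sets[OF sets_mu refl])
        moreover have "(\<lambda>\<omega>. indicator {j} (\<omega> [0])) = ?i j" by (auto simp: indicator_def fun_eq_iff)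
        ultimately show ?thesis by (simp only:)
      qed
      have int: "integrable mu (?i j)"
        using m by (intro mu.integrable_const_bound[where B=1]) (auto simp: indicator_def)
      have "measure mu ?T = (\<integral>\<omega>. indicator ?S \<omega> * ?i j \<omega> \<partial>mu)"
      proof -
        have "?T \<in> sets (height_space d)"
        proof -
          have "?T = ?S \<inter> ((\<lambda>\<omega>. \<omega> [0]) -` {j} \<inter> space (height_space d))" by auto
          then show ?thesis using S(2) measurable_sets[OF coord[OF v(2)], of "{j}"] by auto
        qed
        then have "measure mu ?T = (\<integral>\<omega>. indicator ?T \<omega> \<partial>mu)" by simp
        also have "\<dots> = (\<integral>\<omega>. indicator ?S \<omega> * ?i j \<omega> \<partial>mu)"
          by (intro Bochner_Integration.integral_cong) (auto simp: indicator_def)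
        finally show ?thesis .
      qed
      also have "\<dots> = (\<integral>\<omega>. indicator ?S \<omega> * real_cond_exp mu ?F (?i j) \<omega> \<partial>mu)"
        using F.real_cond_exp_intA[OF int S(1)] by (simp add: set_lebesgue_integral_def)
      also have "\<dots> = (\<integral>\<omega>. indicator ?S \<omega> * \<kappa> \<partial>mu)"
      proof (rule integral_cong_AE)
        show "AE \<omega> in mu. indicator ?S \<omega> * real_cond_exp mu ?F (?i j) \<omega> = indicator ?S \<omega> * \<kappa>"
          using AE[of j] by eventually_elim (auto simp: indicator_def \<kappa>)
      qed (use S in simp_all)
      also have "\<dots> = \<kappa> * measure mu ?S" using S(2) by simp
      finally have "measure mu ?T = \<kappa> * measure mu ?S" .
      moreover have "prob j * (prob k * enn2real (window_prob (j + k))) = measure mu ?T"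
        unfolding measure_def emeasure_mu_two_generators using less_imp_le[OF prob_pos]
        by (simp add: enn2real_mult)
      ultimately have "enn2real (window_prob (j + k)) = \<kappa> / prob j * (measure mu ?S / prob k)"
        using prob_pos[of j] prob_pos[of k] by (simp add: field_simps)
      moreover have "window_prob (j + k) = ennreal (enn2real (window_prob (j + k)))"
        unfolding window_prob_def by (simp add: noise.emeasure_eq_measure)
      ultimately have "window_prob (j + k) = ennreal (\<kappa> / prob j * (measure mu ?S / prob k))"
        by (simp only:)
      also have "\<dots> = ennreal (\<kappa> / prob j) * ennreal (measure mu ?S / prob k)"
        using prob_pos[of k] by (intro ennreal_mult'') simp
      also have "ennreal (measure mu ?S / prob k) = emeasure mu ?S / ennreal (prob k)"
        using prob_pos[of k] by (simp add: mu.emeasure_eq_measure divide_ennreal)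
      finally show ?thesis .
    qed
    then show ?thesis by blast
  qed
  then have "\<exists>c. \<forall>k. window_prob (j + k) = ennreal c * D k" for j unfolding D_def .
  then obtain c where p: "\<And>j k. window_prob (j + k) = ennreal (c j) * D k" by metis
  \<comment> \<open>Comparing \<open>k\<close> with 0 eliminates the unknown factor
    \<open>c j\<close>.\<close>
  have cross: "window_prob (j + k) * D 0 = window_prob j * D k" for j k
    using p[of j k] p[of j 0] by (simp add: ac_simps)
  \<comment> \<open>Summing the preceding identity over \<open>j\<close> in the multiples of d + 1
    gives total mass one on either side, since adding \<open>k\<close> merely changes the residue
    class.\<close>
  have Deq: "D k = D 0" for k
  proof -
    have "D 0 * (\<integral>\<^sup>+n. window_prob (n * (int d + 1) + k) \<partial>count_space UNIV) =
        (\<integral>\<^sup>+n. window_prob (n * (int d + 1) + k) * D 0 \<partial>count_space UNIV)"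
      by (subst nn_integral_cmult[symmetric]) (simp_all add: mult.commute)
    also have "\<dots> = (\<integral>\<^sup>+n. window_prob (n * (int d + 1) + 0) * D k \<partial>count_space UNIV)"
      by (simp add: cross)
    also have "\<dots> = D k * (\<integral>\<^sup>+n. window_prob (n * (int d + 1) + 0) \<partial>count_space UNIV)"
      by (subst nn_integral_cmult[symmetric]) (simp_all add: mult.commute)
    finally show ?thesis by (simp only: window_prob_sum mult_1_right)
  qed
  have const: "window_prob j = window_prob 0" for j
    using p[of 0 j] p[of 0 0] Deq[of j] by simp
  have "(\<integral>\<^sup>+n. window_prob 0 \<partial>count_space (UNIV :: int set)) = 1"
    unfolding window_prob_sum[of 0, symmetric] by (intro nn_integral_cong const[symmetric])
  then show False by (rule nn_integral_const_int_neq_1)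
qed

end

theorem theorem2:
  fixes d :: nat and Q :: "int \<Rightarrow> real"
  assumes "d \<ge> 2"
    and "\<And>j. Q j > 0"
    and "\<And>j. Q (- j) = Q j"
    and "summable (\<lambda>j::nat. (real j)\<^sup>2 * Q (int j))"
  shows
    \<comment> \<open>existence\<close>
    "(let P = distr (free_state d Q) (height_space d) (heights_from d tree_root 0) in
        (AE \<omega> in P. \<bar>limit_average d \<omega>\<bar> \<noteq> \<infinity> \<and>
           (\<lambda>r. sphere_average d r \<omega>) \<longlonglongrightarrow> real_of_ereal (limit_average d \<omega>)) \<and>
        tendsto_L2 P (sphere_average d) (\<lambda>\<omega>. real_of_ereal (limit_average d \<omega>))) \<and>
     height_offset d (free_state d Q) (limit_average d) \<and>
     gibbs_measure d Q (offset_measure d (free_state d Q) (limit_average d)) \<and>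
     \<comment> \<open>regularity of the density\<close>
     (\<exists>f. distributed (free_state d Q) lborel (pinned_limit d) (\<lambda>x. ennreal (f x)) \<and>
        smooth f \<and> (\<forall>x. f x > 0)) \<and>
     \<comment> \<open>localization\<close>
     (\<forall>R>0. (\<forall>t\<in>{-R<..<R}. (\<lambda>j::int. exp (t * of_int j) * (Q j / l1_norm Q)) summable_on UNIV) \<longrightarrow>
        (\<forall>A < real (d + 1) * R. \<exists>B>0. \<forall>s::nat.
           measure (offset_measure d (free_state d Q) (limit_average d))
             {\<omega> \<in> space (height_space d). \<bar>\<omega> tree_root\<bar> \<ge> int s} \<le> B * exp (- A * real s))) \<and>
     \<comment> \<open>no translation invariance\<close>
     \<not> (\<forall>v\<in>verts d.
          distr (offset_measure d (free_state d Q) (limit_average d)) (height_space d) (translate d v) =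
          offset_measure d (free_state d Q) (limit_average d)) \<and>
     \<comment> \<open>no Markov property, not extreme\<close>
     \<not> tree_markov_chain d (offset_measure d (free_state d Q) (limit_average d)) \<and>
     \<not> extreme_gibbs_measure d Q (offset_measure d (free_state d Q) (limit_average d))"
proof -
  interpret tree_gradient d Q using assms by unfold_locales
  show ?thesis
    unfolding Let_def mu_def[symmetric] distr_heights_from
    using AE_distr_heights_limit L2_limit_average height_offset_limit_average gibbs_measure_mu
      pinned_limit_density localization not_translation_invariant not_markov not_extreme
    by blast
qed

end
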